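(* Let $\phi(x_1, x_2, x_3, \ldots, x_n)$ be a nonduplicating formula, whose distinct free variables $x_1, x_2, x_3, \ldots, x_n$ are of sorts $\mathcal X_1, \mathcal X_2, \mathcal X_3, \ldots, \mathcal X_n$, respectively. Assume that $\mathcal X_2 = \mathcal X_1^*$, and let $\psi(x_3, \ldots, x_n)$ be the nonduplicating formula $$\neg (\forall x_1)\, (\forall x_2)\, (E_{\mathcal X_1}(x_1, x_2) \rightarrow \neg \phi(x_1, x_2, x_3, \ldots, x_n)).$$ Then $$[\![\psi(x_3,\ldots,x_n)]\!] = [\![\phi(x_1,x_2,x_3,\ldots,x_n)]\!]\circ (E_{\mathcal X_1}^\dagger \times I_{\mathcal X_3}\times\cdots\times I_{\mathcal X_n}),$$ where $[\![\psi(x_3,\ldots,x_n)]\!]$ is the interpretation in the context $(x_3,\ldots,x_n)$, a binary relation from $\mathcal X_3\times\cdots\times\mathcal X_n$ to $\mathbf 1$, and $[\![\phi(x_1,\ldots,x_n)]\!]$ is the interpretation in the context $(x_1,\ldots,x_n)$, a binary relation from $\mathcal X_1\times\cdots\times\mathcal X_n$ to $\mathbf 1$. (In the graphical calculus: the diagram of $[\![\psi]\!]$ is obtained from that of $[\![\phi]\!]$ by joining the wires $x_1$ and $x_2$.)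
   Context: Operators. Hilbert spaces are complex. $L(H,K)$ is the space of bounded operators $H\to K$, $L(H)=L(H,H)$, $H^*=L(H,\mathbb C)$. For $a\in L(H,K)$: $a^\dagger\in L(K,H)$ is the Hermitian adjoint, $a^*\in L(K^*,H^* )$ the transpose, $a_*=(a^\dagger)^*\in L(H^*,K^* )$. Products of subspaces of operators denote linear spans of products. The identifications $X^{**}=X$, $(X\otimes Y)^*=X^*\otimes Y^*$, $\mathbb C^*=\mathbb C$, $X\otimes\mathbb C=X$ are used. Quantum sets. A quantum set $\mathcal X$ is an object uniquely determined by a set $\mathrm{At}(\mathcal X)$ of nonzero finite-dimensional Hilbert spaces, its atoms. $\mathcal X\times\mathcal Y$ has atoms $X\otimes Y$ ($X\in \mathrm{At}(\mathcal X)$, $Y\in\mathrm{At}(\mathcal Y)$); $\mathcal X^*$ has atoms $X^*$; $\mathbf 1$ (the empty product) has the single atom $\mathbb C$. Binary relations. A binary relation $R$ from $\mathcal X$ to $\mathcal Y$ is a choice of subspaces $R(X,Y)\le L(X,Y)$ for all atoms $X,Y$. Order $\le$, joins $\vee$, meets $\wedge$ and complement $\neg$ are componentwise (inclusion, span, intersection, orthogonal complement for $\langle a|b\rangle=\mathrm{Tr}(a^\dagger b)$); $\top$ and $\bot$ (or $\top_{\mathcal X}$, $\bot_{\mathcal X}$ for $\mathcal Y=\mathbf 1$) are the largest and smallest. $(S\circ R)(X,Z)=\sum_Y S(Y,Z)\cdot R(X,Y)$; $(R\times S)(X\otimes X',Y\otimes Y')=R(X,Y)\otimes S(X',Y')$;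 $R^\dagger(Y,X)=\{r^\dagger: r\in R(X,Y)\}$; $R_*(X^*,Y^* )=\{r_*: r\in R(X,Y)\}$. $I_{\mathcal X}(X,X)=\mathbb C1_X$, with other components $0$. A function $F:\mathcal X\to\mathcal Y$ is a binary relation with $F^\dagger\circ F\ge I_{\mathcal X}$ and $F\circ F^\dagger\le I_{\mathcal Y}$. A relation of arity $(\mathcal X_1,\dots,\mathcal X_n)$ is a binary relation $R$ from $\mathcal X_1\times\cdots\times\mathcal X_n$ to $\mathbf 1$; write $R(X_1\otimes\cdots\otimes X_n)$ for $R(X_1\otimes\cdots\otimes X_n,\mathbb C)$. The equality relation $E_{\mathcal X}$ of arity $(\mathcal X,\mathcal X^* )$ has $E_{\mathcal X}(X\otimes X^* )=\mathbb C\epsilon_X$, with $\epsilon_X:X\otimes X^*\to\mathbb C$ evaluation, and $E_{\mathcal X}(X_1\otimes X_2^* )=0$ for $X_1\ne X_2$. For a binary relation $B$ from $\mathcal X$ to $\mathcal Y$, $\widehat B=E_{\mathcal Y}\circ(B\times I_{\mathcal Y^*})$, of arity $(\mathcal X,\mathcal Y^* )$. Formulas. Each quantum set is a sort with infinitely many variables. Nonduplicating terms of sort $\mathcal Y$: variables of sort $\mathcal Y$, and $F(s_1,\dots,s_m)$ with $F:\mathcal X_1\times\cdots\times\mathcal X_m\to\mathcal Y$ a function and $s_i$ nonduplicating terms of sorts $\mathcal X_i$, no two sharing a variable. Nonduplicating atomic formulas: $R(t_1,\dots,t_n)$ with $R$ a relation of arity $(\mathcal Y_1,\dots,\mathcal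 Y_n)$ and $t_i$ nonduplicating terms of sorts $\mathcal Y_i$, no two sharing a variable. Nonduplicating formulas are built from these with $\neg,\wedge,\vee,\to,\forall,\exists$. Writing $\phi(x_1,\dots,x_n)$ indicates that the free variables are among the pairwise distinct $x_1,\dots,x_n$. Interpretation. For distinct variables $x_i$ of sorts $\mathcal X_i$, $[\![\phi]\!]=[\![(x_1,\dots,x_n)\in\mathcal X_1\times\cdots\times\mathcal X_n\,|\,\phi]\!]$ is a relation of arity $(\mathcal X_1,\dots,\mathcal X_n)$, defined recursively. For a permutation $\pi$ of $\{1,\dots,n\}$, $m\le n$ and $R$ of arity $(\mathcal X_{\pi(1)},\dots,\mathcal X_{\pi(m)})$, $[\![R(x_{\pi(1)},\dots,x_{\pi(m)})]\!](X_1\otimes\cdots\otimes X_n)=(R\times\top_{\mathcal X_{\pi(m+1)}}\times\cdots\times\top_{\mathcal X_{\pi(n)}})(X_{\pi(1)}\otimes\cdots\otimes X_{\pi(n)})\cdot u_\pi$, where $u_\pi$ is the unitary permuting tensor factors. $[\![\neg\phi]\!]=\neg[\![\phi]\!]$; $[\![\phi\wedge\psi]\!]=[\![\phi]\!]\wedge[\![\psi]\!]$; $[\![(x_1,\dots,x_n)\,|\,(\forall x\in\mathcal X)\,\phi]\!]=\sup\{R \text{ of arity }(\mathcal X_1,\dots,\mathcal X_n): \top_{\mathcal X}\times R\le[\![(x,x_1,\dots,x_n)\,|\,\phi]\!]\}$. Abbreviations: $\phi\vee\psi$ is $\neg(\neg\phi\wedge\neg\psi)$; $\exists$ is $\neg\forall\neg$;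 $\phi\to\psi$ is $\neg\phi\vee(\phi\wedge\psi)$; $(\forall(x=x_* )\in\mathcal X\times\mathcal X^* )\,\phi$ is $(\forall x_*\in\mathcal X^* )(\forall x\in\mathcal X)(E_{\mathcal X}(x,x_* )\to\phi)$, with $x,x_*$ distinct variables; $(\exists(x=x_* )\in\mathcal X\times\mathcal X^* )\,\phi$ is $\neg(\forall(x=x_* )\in\mathcal X\times\mathcal X^* )\,\neg\phi$. If not all $t_i$ are variables, $R(t_1,\dots,t_n)$ abbreviates $(\exists(y_n=y_{n*})\in\mathcal Y_n\times\mathcal Y_n^* )\cdots(\exists(y_1=y_{1*})\in\mathcal Y_1\times\mathcal Y_1^* )(R(y_1,\dots,y_n)\wedge t_1\curvearrowright y_{1*}\wedge\cdots\wedge t_n\curvearrowright y_{n*})$ with all $y_i,y_{i*}$ new variables, where $t\curvearrowright y_*$ is $E_{\mathcal Y}(t,y_* )$ if $t$ is a variable and $\widehat F(s_1,\dots,s_m,y_* )$ if $t=F(s_1,\dots,s_m)$. *)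

theory Defs
  imports Complex_Main "HOL-Library.Function_Algebras"
begin

section \<open>Hilbert spaces\<close>

text \<open>
  Finite-dimensional complex Hilbert spaces are the finite-dimensional subspaces of an arbitrary
  ambient complex inner product space; two of them are the same Hilbert space iff they are the same
  subspace.  Every set of finite-dimensional Hilbert spaces embeds, as pairwise distinct subspaces,
  into its direct sum.  The inner product is linear in the second argument.
\<close>

class complex_inner = ab_group_add +
  fixes scaleC :: "complex \<Rightarrow> 'a \<Rightarrow> 'a"
    and cinner :: "'a \<Rightarrow> 'a \<Rightarrow> complex"
  assumes scaleC_add_right: "scaleC c (x + y) = scaleC c x + scaleC c y"
    and scaleC_add_left: "scaleC (c + d) x = scaleC c x + scaleC d x"
    and scaleC_scaleC: "scaleC c (scaleC d x) = scaleC (c * d) x"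
    and scaleC_one: "scaleC 1 x = x"
    and cinner_commute: "cinner x y = cnj (cinner y x)"
    and cinner_add_right: "cinner x (y + z) = cinner x y + cinner x z"
    and cinner_scaleC_right: "cinner x (scaleC c y) = c * cinner x y"
    and cinner_gt_zero: "x \<noteq> 0 \<Longrightarrow> Re (cinner x x) > 0"

global_interpretation cvec: vector_space "scaleC :: complex \<Rightarrow> 'a \<Rightarrow> 'a::complex_inner"
  by unfold_locales (simp_all add: scaleC_add_right scaleC_add_left scaleC_scaleC scaleC_one)

definition fd_hilbert :: "'v::complex_inner set \<Rightarrow> bool" where
  "fd_hilbert H \<longleftrightarrow> H \<noteq> {0} \<and> (\<exists>B. finite B \<and> H = cvec.span B)"

definition is_onb :: "'v::complex_inner set \<Rightarrow> 'v set \<Rightarrow> bool" where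
  "is_onb H B \<longleftrightarrow> (\<forall>x\<in>B. \<forall>y\<in>B. cinner x y = (if x = y then 1 else 0)) \<and> cvec.span B = H"

definition onb :: "'v::complex_inner set \<Rightarrow> 'v set" where
  "onb H = (SOME B. is_onb H B)"

text \<open>
  An atom is a tensor word: \<open>(H, False)\<close> stands for the factor \<open>H\<close>, \<open>(H, True)\<close> for the factor
  \<open>H\<^sup>*\<close>, and the empty word for the complex numbers.  Tensor product is concatenation and duals flip
  all flags, so the identifications \<open>X\<^sup>*\<^sup>* = X\<close>, \<open>(X \<otimes> Y)\<^sup>* = X\<^sup>* \<otimes> Y\<^sup>*\<close>, \<open>\<complex>\<^sup>* = \<complex>\<close> and
  \<open>X \<otimes> \<complex> = X\<close> hold as equations.
\<close>

type_synonym 'v atom = "('v set \<times> bool) list"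

definition atom :: "'v::complex_inner atom \<Rightarrow> bool" where
  "atom X \<longleftrightarrow> (\<forall>(H, d)\<in>set X. fd_hilbert H)"

definition dual_atom :: "'v atom \<Rightarrow> 'v atom" where
  "dual_atom X = map (apsnd Not) X"

text \<open>
  A vector \<open>f\<close> of the Hilbert space named by a word is stored as its family of inner products
  \<open>f u = \<langle>u\<^sub>1 \<otimes> \<dots> \<otimes> u\<^sub>n | f\<rangle>\<close>, where in a dual factor \<open>u\<^sub>i \<in> H\<close> stands for the functional
  \<open>\<langle>u\<^sub>i| \<in> H\<^sup>*\<close>.  So \<open>f\<close> is antilinear in the slots of factors \<open>H\<close> and linear in the slots of
  factors \<open>H\<^sup>*\<close>: \<open>x \<in> H\<close> is stored as \<open>\<langle>_|x\<rangle>\<close>, and a functional on \<open>H\<close> as itself.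
\<close>

type_synonym 'v vect = "'v list \<Rightarrow> complex"

definition slots :: "'v atom \<Rightarrow> 'v list set" where
  "slots X = listset (map fst X)"

definition hilb :: "'v::complex_inner atom \<Rightarrow> 'v vect set" where
  "hilb X = {f. (\<forall>u. u \<notin> slots X \<longrightarrow> f u = 0) \<and>
     (\<forall>u\<in>slots X. \<forall>i<length X. \<forall>x\<in>fst (X ! i). \<forall>y\<in>fst (X ! i). \<forall>c.
        f (u[i := x + y]) = f (u[i := x]) + f (u[i := y]) \<and>
        f (u[i := scaleC c x]) = (if snd (X ! i) then c else cnj c) * f (u[i := x]))}"

text \<open>
  Sums over product orthonormal bases below do not depend on the bases chosen by \<^const>\<open>onb\<close>.
\<close>

definition basis :: "'v::complex_inner atom \<Rightarrow> 'v list set" where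
  "basis X = listset (map (\<lambda>(H, d). onb H) X)"

definition hinner :: "'v::complex_inner atom \<Rightarrow> 'v vect \<Rightarrow> 'v vect \<Rightarrow> complex" where
  "hinner X f g = (\<Sum>e\<in>basis X. cnj (f e) * g e)"

text \<open>The elementary tensor \<open>v\<^sub>1 \<otimes> \<dots> \<otimes> v\<^sub>n\<close>, with \<open>\<langle>v\<^sub>i|\<close> in place of \<open>v\<^sub>i\<close> in dual factors:\<close>

definition ket :: "'v::complex_inner atom \<Rightarrow> 'v list \<Rightarrow> 'v vect" where
  "ket X v = (\<lambda>u. if u \<in> slots X
     then \<Prod>i<length X. if snd (X ! i) then cinner (v ! i) (u ! i) else cinner (u ! i) (v ! i)
     else 0)"

text \<open>The vector \<open>f \<otimes> g\<close> of \<open>X \<otimes> Y\<close>, and iterated tensor products:\<close>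

definition vtensor :: "'v atom \<Rightarrow> 'v vect \<Rightarrow> 'v vect \<Rightarrow> 'v vect" where
  "vtensor X f g = (\<lambda>u. f (take (length X) u) * g (drop (length X) u))"

definition scalar :: "complex \<Rightarrow> 'v vect" where
  "scalar c = (\<lambda>u. if u = [] then c else 0)"

fun vtensors :: "'v atom list \<Rightarrow> 'v vect list \<Rightarrow> 'v vect" where
  "vtensors (X # Xs) (f # fs) = vtensor X f (vtensors Xs fs)"
| "vtensors _ _ = scalar 1"

text \<open>The value \<open>g(f)\<close> of \<open>g \<in> X\<^sup>*\<close> at \<open>f \<in> X\<close>, expanding \<open>f\<close> in a basis of \<open>X\<close>
  and \<open>g\<close> in the dual basis:\<close>

definition evaluate :: "'v::complex_inner atom \<Rightarrow> 'v vect \<Rightarrow> 'v vect \<Rightarrow> complex" where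
  "evaluate X g f = (\<Sum>e\<in>basis X. g e * f e)"


section \<open>Operators\<close>

text \<open>
  All linear maps between finite-dimensional Hilbert spaces are bounded.  Operators are extended
  by \<open>0\<close> outside their domain, so that they are determined by their values on it and compose
  by \<^term>\<open>(\<circ>)\<close>.
\<close>

type_synonym 'v oper = "'v vect \<Rightarrow> 'v vect"

definition Op :: "'v::complex_inner atom \<Rightarrow> 'v atom \<Rightarrow> 'v oper set" where
  "Op X Y = {a. (\<forall>f\<in>hilb X. a f \<in> hilb Y) \<and>
     (\<forall>f\<in>hilb X. \<forall>g\<in>hilb X. a (f + g) = a f + a g) \<and>
     (\<forall>f\<in>hilb X. \<forall>c. a (\<lambda>u. c * f u) = (\<lambda>u. c * a f u)) \<and>
     (\<forall>f. f \<notin> hilb X \<longrightarrow> a f = 0)}"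

global_interpretation op: vector_space "\<lambda>(c::complex) (a::'v oper) f u. c * a f u"
  by unfold_locales (simp_all add: fun_eq_iff algebra_simps)

definition op_id :: "'v::complex_inner atom \<Rightarrow> 'v oper" where
  "op_id X = (\<lambda>f. if f \<in> hilb X then f else 0)"

definition adjoint :: "'v::complex_inner atom \<Rightarrow> 'v atom \<Rightarrow> 'v oper \<Rightarrow> 'v oper" where
  "adjoint X Y a = (THE b. b \<in> Op Y X \<and>
     (\<forall>f\<in>hilb X. \<forall>g\<in>hilb Y. hinner X (b g) f = hinner Y g (a f)))"

definition op_trace :: "'v::complex_inner atom \<Rightarrow> 'v oper \<Rightarrow> complex" where
  "op_trace X a = (\<Sum>e\<in>basis X. hinner X (ket X e) (a (ket X e)))"

definition op_inner :: "'v::complex_inner atom \<Rightarrow> 'v atom \<Rightarrow> 'v oper \<Rightarrow> 'v oper \<Rightarrow> complex" where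
  "op_inner X Y a b = op_trace X (adjoint X Y a \<circ> b)"

definition op_tensor ::
  "'v::complex_inner atom \<Rightarrow> 'v atom \<Rightarrow> 'v atom \<Rightarrow> 'v atom \<Rightarrow> 'v oper \<Rightarrow> 'v oper \<Rightarrow> 'v oper" where
  "op_tensor X Y X' Y' a b = (THE c. c \<in> Op (X @ X') (Y @ Y') \<and>
     (\<forall>f\<in>hilb X. \<forall>g\<in>hilb X'. c (vtensor X f g) = vtensor Y (a f) (b g)))"

text \<open>\<open>\<epsilon>\<^sub>X : X \<otimes> X\<^sup>* \<rightarrow> \<complex>\<close>:\<close>

definition op_eval :: "'v::complex_inner atom \<Rightarrow> 'v oper" where
  "op_eval X = (THE c. c \<in> Op (X @ dual_atom X) [] \<and>
     (\<forall>f\<in>hilb X. \<forall>g\<in>hilb (dual_atom X). c (vtensor X f g) = scalar (evaluate X g f)))"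

text \<open>\<open>u\<^sub>\<pi> : X\<^sub>0 \<otimes> \<dots> \<otimes> X\<^sub>n\<^sub>-\<^sub>1 \<rightarrow> X\<^bsub>\<pi> 0\<^esub> \<otimes> \<dots> \<otimes> X\<^bsub>\<pi> (n-1)\<^esub>\<close>, where \<open>\<pi>\<close> is
  given as a list:\<close>

definition op_perm :: "nat list \<Rightarrow> 'v::complex_inner atom list \<Rightarrow> 'v oper" where
  "op_perm \<pi> Xs = (THE u. u \<in> Op (concat Xs) (concat (map ((!) Xs) \<pi>)) \<and>
     (\<forall>fs. list_all2 (\<lambda>f X. f \<in> hilb X) fs Xs \<longrightarrow>
        u (vtensors Xs fs) = vtensors (map ((!) Xs) \<pi>) (map ((!) fs) \<pi>)))"


section \<open>Quantum sets and relations\<close>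

text \<open>
  A quantum set is its set of atoms.  A product \<open>\<X>\<^sub>1 \<times> \<dots> \<times> \<X>\<^sub>n\<close> is kept as the list of its
  factors, with \<open>\<one> = []\<close>.  Its atoms are indexed by tuples \<open>(X\<^sub>1, \<dots>, X\<^sub>n)\<close>, the Hilbert space
  belonging to such a tuple \<open>Xs\<close> being \<open>concat Xs\<close>.  Indexing by the tuple matters because different
  tuples can have the same concatenation.
\<close>

type_synonym 'v qset = "'v atom set"

definition qset :: "'v::complex_inner qset \<Rightarrow> bool" where
  "qset \<X> \<longleftrightarrow> (\<forall>X\<in>\<X>. atom X)"

definition dual :: "'v qset \<Rightarrow> 'v qset" where
  "dual \<X> = dual_atom ` \<X>"

text \<open>A binary relation, together with its domain and codomain.  Components at tuples that are not
  atoms carry no information; \<open>mk_rel\<close> sets them to \<open>{0}\<close>.\<close>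

datatype 'v brel = BRel (rdom: "'v qset list") (rcod: "'v qset list")
  (comps: "'v atom list \<Rightarrow> 'v atom list \<Rightarrow> 'v oper set")

definition mk_rel ::
  "'v qset list \<Rightarrow> 'v qset list \<Rightarrow> ('v atom list \<Rightarrow> 'v atom list \<Rightarrow> 'v oper set) \<Rightarrow> 'v brel" where
  "mk_rel \<X>s \<Y>s C =
     BRel \<X>s \<Y>s (\<lambda>Xs Ys. if Xs \<in> listset \<X>s \<and> Ys \<in> listset \<Y>s then C Xs Ys else {0})"

definition binary_relation :: "'v::complex_inner brel \<Rightarrow> bool" where
  "binary_relation R \<longleftrightarrow>
     (\<forall>\<X>\<in>set (rdom R) \<union> set (rcod R). qset \<X>) \<and>
     (\<forall>Xs\<in>listset (rdom R). \<forall>Ys\<in>listset (rcod R).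
        op.subspace (comps R Xs Ys) \<and> comps R Xs Ys \<subseteq> Op (concat Xs) (concat Ys)) \<and>
     (\<forall>Xs Ys. Xs \<notin> listset (rdom R) \<or> Ys \<notin> listset (rcod R) \<longrightarrow> comps R Xs Ys = {0})"

definition relation_of_arity :: "'v::complex_inner brel \<Rightarrow> 'v qset list \<Rightarrow> bool" where
  "relation_of_arity R \<X>s \<longleftrightarrow> binary_relation R \<and> rdom R = \<X>s \<and> rcod R = []"

definition rel_le :: "'v brel \<Rightarrow> 'v brel \<Rightarrow> bool" where
  "rel_le R S \<longleftrightarrow> rdom R = rdom S \<and> rcod R = rcod S \<and> (\<forall>Xs Ys. comps R Xs Ys \<subseteq> comps S Xs Ys)"

definition rel_top :: "'v::complex_inner qset list \<Rightarrow> 'v qset list \<Rightarrow> 'v brel" where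
  "rel_top \<X>s \<Y>s = mk_rel \<X>s \<Y>s (\<lambda>Xs Ys. Op (concat Xs) (concat Ys))"

definition rel_sup :: "'v qset list \<Rightarrow> 'v qset list \<Rightarrow> 'v brel set \<Rightarrow> 'v brel" where
  "rel_sup \<X>s \<Y>s \<R> = mk_rel \<X>s \<Y>s (\<lambda>Xs Ys. op.span (\<Union>R\<in>\<R>. comps R Xs Ys))"

definition rel_inf :: "'v brel \<Rightarrow> 'v brel \<Rightarrow> 'v brel" where
  "rel_inf R S = mk_rel (rdom R) (rcod R) (\<lambda>Xs Ys. comps R Xs Ys \<inter> comps S Xs Ys)"

definition rel_neg :: "'v::complex_inner brel \<Rightarrow> 'v brel" where
  "rel_neg R = mk_rel (rdom R) (rcod R) (\<lambda>Xs Ys.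
     {a \<in> Op (concat Xs) (concat Ys). \<forall>b\<in>comps R Xs Ys. op_inner (concat Xs) (concat Ys) b a = 0})"

definition rel_comp :: "'v brel \<Rightarrow> 'v brel \<Rightarrow> 'v brel" where
  "rel_comp S R = mk_rel (rdom R) (rcod S) (\<lambda>Xs Zs.
     op.span {s \<circ> r | s r Ys. Ys \<in> listset (rcod R) \<and> s \<in> comps S Ys Zs \<and> r \<in> comps R Xs Ys})"

definition rel_times :: "'v::complex_inner brel \<Rightarrow> 'v brel \<Rightarrow> 'v brel" where
  "rel_times R S = mk_rel (rdom R @ rdom S) (rcod R @ rcod S) (\<lambda>Xs Ys.
     let X = take (length (rdom R)) Xs; X' = drop (length (rdom R)) Xs;
         Y = take (length (rcod R)) Ys; Y' = drop (length (rcod R)) Ys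
     in op.span {op_tensor (concat X) (concat Y) (concat X') (concat Y') r s | r s.
          r \<in> comps R X Y \<and> s \<in> comps S X' Y'})"

definition rel_dagger :: "'v::complex_inner brel \<Rightarrow> 'v brel" where
  "rel_dagger R = mk_rel (rcod R) (rdom R)
     (\<lambda>Ys Xs. adjoint (concat Xs) (concat Ys) ` comps R Xs Ys)"

definition rel_id :: "'v::complex_inner qset list \<Rightarrow> 'v brel" where
  "rel_id \<X>s = mk_rel \<X>s \<X>s (\<lambda>Xs Ys. if Xs = Ys then op.span {op_id (concat Xs)} else {0})"

text \<open>\<open>I\<^bsub>\<X>\<^sub>1\<^esub> \<times> \<dots> \<times> I\<^bsub>\<X>\<^sub>n\<^esub>\<close> and \<open>\<top>\<^bsub>\<X>\<^sub>1\<^esub> \<times> \<dots> \<times> \<top>\<^bsub>\<X>\<^sub>n\<^esub>\<close>:\<close>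

fun rel_ids :: "'v::complex_inner qset list \<Rightarrow> 'v brel" where
  "rel_ids [] = rel_id []"
| "rel_ids (\<X> # \<X>s) = rel_times (rel_id [\<X>]) (rel_ids \<X>s)"

fun rel_tops :: "'v::complex_inner qset list \<Rightarrow> 'v brel" where
  "rel_tops [] = rel_top [] []"
| "rel_tops (\<X> # \<X>s) = rel_times (rel_top [\<X>] []) (rel_tops \<X>s)"

definition rel_eq :: "'v::complex_inner qset \<Rightarrow> 'v brel" where
  "rel_eq \<X> = mk_rel [\<X>, dual \<X>] [] (\<lambda>Xs _.
     if Xs ! 1 = dual_atom (Xs ! 0) then op.span {op_eval (Xs ! 0)} else {0})"

definition qfunction :: "'v::complex_inner brel \<Rightarrow> 'v qset list \<Rightarrow> 'v qset \<Rightarrow> bool" where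
  "qfunction F \<X>s \<Y> \<longleftrightarrow> binary_relation F \<and> rdom F = \<X>s \<and> rcod F = [\<Y>] \<and>
     rel_le (rel_id \<X>s) (rel_comp (rel_dagger F) F) \<and>
     rel_le (rel_comp F (rel_dagger F)) (rel_id [\<Y>])"

text \<open>\<open>E\<^sub>\<Y> \<circ> (B \<times> I\<^bsub>\<Y>\<^sup>*\<^esub>)\<close> for \<open>B\<close> with codomain \<open>\<Y>\<close>:\<close>

definition rel_hat :: "'v::complex_inner brel \<Rightarrow> 'v brel" where
  "rel_hat B = (let \<Y> = hd (rcod B) in rel_comp (rel_eq \<Y>) (rel_times B (rel_id [dual \<Y>])))"


section \<open>Formulas\<close>

text \<open>A variable is its sort together with an index.\<close>

type_synonym 'v var = "'v qset \<times> nat"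

datatype 'v trm = Var (the_var: "'v var") | App "'v brel" "'v trm list"
  where "the_var (App _ _) = undefined"

datatype 'v fm = Atomic "'v brel" "'v trm list" | Neg "'v fm" | Conj "'v fm" "'v fm"
  | Forall "'v var" "'v fm"

definition Disj :: "'v fm \<Rightarrow> 'v fm \<Rightarrow> 'v fm" where
  "Disj \<phi> \<psi> = Neg (Conj (Neg \<phi>) (Neg \<psi>))"

definition Imp :: "'v fm \<Rightarrow> 'v fm \<Rightarrow> 'v fm" where
  "Imp \<phi> \<psi> = Disj (Neg \<phi>) (Conj \<phi> \<psi>)"

definition Exists :: "'v var \<Rightarrow> 'v fm \<Rightarrow> 'v fm" where
  "Exists x \<phi> = Neg (Forall x (Neg \<phi>))"

definition Eq :: "'v::complex_inner var \<Rightarrow> 'v var \<Rightarrow> 'v fm" where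
  "Eq x y = Atomic (rel_eq (fst x)) [Var x, Var y]"

definition ForallEq :: "'v::complex_inner var \<Rightarrow> 'v var \<Rightarrow> 'v fm \<Rightarrow> 'v fm" where
  "ForallEq x x' \<phi> = Forall x' (Forall x (Imp (Eq x x') \<phi>))"

definition ExistsEq :: "'v::complex_inner var \<Rightarrow> 'v var \<Rightarrow> 'v fm \<Rightarrow> 'v fm" where
  "ExistsEq x x' \<phi> = Neg (ForallEq x x' (Neg \<phi>))"

fun tvars :: "'v trm \<Rightarrow> 'v var set" where
  "tvars (Var x) = {x}"
| "tvars (App F ts) = (\<Union>t\<in>set ts. tvars t)"

fun trm_size :: "'v trm \<Rightarrow> nat" where
  "trm_size (Var x) = 0"
| "trm_size (App F ts) = Suc (\<Sum>t\<leftarrow>ts. Suc (trm_size t))"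

primrec fvars :: "'v fm \<Rightarrow> 'v var set" where
  "fvars (Atomic R ts) = (\<Union>t\<in>set ts. tvars t)"
| "fvars (Neg \<phi>) = fvars \<phi>"
| "fvars (Conj \<phi> \<psi>) = fvars \<phi> \<union> fvars \<psi>"
| "fvars (Forall x \<phi>) = fvars \<phi> - {x}"

primrec allvars :: "'v fm \<Rightarrow> 'v var set" where
  "allvars (Atomic R ts) = (\<Union>t\<in>set ts. tvars t)"
| "allvars (Neg \<phi>) = allvars \<phi>"
| "allvars (Conj \<phi> \<psi>) = allvars \<phi> \<union> allvars \<psi>"
| "allvars (Forall x \<phi>) = insert x (allvars \<phi>)"

definition no_shared_var :: "'v trm list \<Rightarrow> bool" where
  "no_shared_var ts \<longleftrightarrow>
     (\<forall>i<length ts. \<forall>j<length ts. i \<noteq> j \<longrightarrow> tvars (ts ! i) \<inter> tvars (ts ! j) = {})"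

inductive nondup_term :: "'v::complex_inner trm \<Rightarrow> 'v qset \<Rightarrow> bool" where
  "qset (fst x) \<Longrightarrow> nondup_term (Var x) (fst x)"
| "qfunction F \<X>s \<Y> \<Longrightarrow> list_all2 nondup_term ts \<X>s \<Longrightarrow> no_shared_var ts \<Longrightarrow>
     nondup_term (App F ts) \<Y>"

inductive nondup_formula :: "'v::complex_inner fm \<Rightarrow> bool" where
  "relation_of_arity R \<Y>s \<Longrightarrow> list_all2 nondup_term ts \<Y>s \<Longrightarrow> no_shared_var ts \<Longrightarrow>
     nondup_formula (Atomic R ts)"
| "nondup_formula \<phi> \<Longrightarrow> nondup_formula (Neg \<phi>)"
| "nondup_formula \<phi> \<Longrightarrow> nondup_formula \<psi> \<Longrightarrow> nondup_formula (Conj \<phi> \<psi>)"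
| "qset (fst x) \<Longrightarrow> nondup_formula \<phi> \<Longrightarrow> nondup_formula (Forall x \<phi>)"

text \<open>
  Elimination of function symbols: \<open>expand_atom k R ts\<close> is the formula abbreviated by
  \<open>R(t\<^sub>1, \<dots>, t\<^sub>n)\<close> and \<open>graph k t y\<^sub>*\<close> the one abbreviated by \<open>t \<curvearrowright> y\<^sub>*\<close>, in both cases after all
  function symbols are eliminated.  New variables are taken with indices \<open>\<ge> k\<close>.
\<close>

function graph :: "nat \<Rightarrow> 'v::complex_inner trm \<Rightarrow> 'v var \<Rightarrow> 'v fm"
  and expand_atom :: "nat \<Rightarrow> 'v brel \<Rightarrow> 'v trm list \<Rightarrow> 'v fm" where
  "graph k (Var x) y' = Eq x y'"
| "graph k (App F ss) y' = expand_atom k (rel_hat F) (ss @ [Var y'])"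
| "expand_atom k R ts =
    (if \<forall>t\<in>set ts. is_Var t then Atomic R ts
     else
       let n = length ts;
           y = (\<lambda>i. (rdom R ! i, k + 2 * i));
           y' = (\<lambda>i. (dual (rdom R ! i), k + 2 * i + 1));
           body = foldl Conj (Atomic R (map (\<lambda>i. Var (y i)) [0..<n]))
             (map (\<lambda>i. graph (k + 2 * n) (ts ! i) (y' i)) [0..<n])
       in foldl (\<lambda>\<phi> i. ExistsEq (y i) (y' i) \<phi>) body [0..<n])"
  by pat_completeness auto
termination
proof -
  have *: "2 * trm_size (ts ! i) < 2 * (\<Sum>t\<leftarrow>ts. Suc (trm_size t)) - Suc 0" if "i < length ts"
    for ts :: "'v trm list" and i
  proof -
    have "Suc (trm_size t) \<le> (\<Sum>t\<leftarrow>ts. Suc (trm_size t))" if "t \<in> set ts" for t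
      using that by (induction ts) auto
    from this[of "ts ! i"] that show ?thesis by simp
  qed
  show ?thesis
    by (relation "measure (case_sum (\<lambda>(k, t, y). 2 * trm_size t)
          (\<lambda>(k, R, ts). 2 * (\<Sum>t\<leftarrow>ts. Suc (trm_size t)) - 1))")
      (auto simp: * simp del: sum_list_Suc)
qed

primrec expand :: "nat \<Rightarrow> 'v::complex_inner fm \<Rightarrow> 'v fm" where
  "expand k (Atomic R ts) = expand_atom k R ts"
| "expand k (Neg \<phi>) = Neg (expand k \<phi>)"
| "expand k (Conj \<phi> \<psi>) = Conj (expand k \<phi>) (expand k \<psi>)"
| "expand k (Forall x \<phi>) = Forall x (expand k \<phi>)"


section \<open>Interpretation\<close>

text \<open>
  A context is the list of its variables.  If a bound variable also occurs in the context, the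
  inner binding hides the outer one, i.e. a variable refers to its first occurrence.
\<close>

definition position :: "'v var list \<Rightarrow> 'v var \<Rightarrow> nat" where
  "position \<Gamma> x = (LEAST i. i < length \<Gamma> \<and> \<Gamma> ! i = x)"

text \<open>
  For \<open>R(x\<^bsub>\<pi> 1\<^esub>, \<dots>, x\<^bsub>\<pi> m\<^esub>)\<close> the values \<open>\<pi> 1, \<dots>, \<pi> m\<close> are determined by the variables;
  the remaining positions are appended in increasing order.
\<close>

primrec interp_core :: "'v::complex_inner fm \<Rightarrow> 'v var list \<Rightarrow> 'v brel" where
  "interp_core (Atomic R ts) \<Gamma> =
    (let ps = map (\<lambda>t. position \<Gamma> (the_var t)) ts;
         qs = filter (\<lambda>i. i \<notin> set ps) [0..<length \<Gamma>];
         \<pi> = ps @ qs;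
         S = rel_times R (rel_tops (map (\<lambda>i. fst (\<Gamma> ! i)) qs))
     in mk_rel (map fst \<Gamma>) [] (\<lambda>Xs Ys.
          {a \<circ> op_perm \<pi> Xs | a. a \<in> comps S (map ((!) Xs) \<pi>) Ys}))"
| "interp_core (Neg \<phi>) \<Gamma> = rel_neg (interp_core \<phi> \<Gamma>)"
| "interp_core (Conj \<phi> \<psi>) \<Gamma> = rel_inf (interp_core \<phi> \<Gamma>) (interp_core \<psi> \<Gamma>)"
| "interp_core (Forall x \<phi>) \<Gamma> = rel_sup (map fst \<Gamma>) []
     {R. relation_of_arity R (map fst \<Gamma>) \<and>
         rel_le (rel_times (rel_top [fst x] []) R) (interp_core \<phi> (x # \<Gamma>))}"

definition interp :: "'v::complex_inner var list \<Rightarrow> 'v fm \<Rightarrow> 'v brel" where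
  "interp \<Gamma> \<phi> =
    (let k = (LEAST k. \<forall>x\<in>set \<Gamma> \<union> allvars \<phi>. snd x < k)
     in interp_core (expand k \<phi>) \<Gamma>)"

end

theory Submission
  imports Defs
begin

text \<open>
  Product orthonormal bases turn a functional on \<open>X\<^sub>1 \<otimes> \<dots> \<otimes> X\<^sub>n\<close> into a complex function of lists of basis
  labels, and a relation into \<open>\<one>\<close> into a family of spaces of such functions.  In these coordinates the
  trace inner product is the standard one, tensor products are products of functions in separate
  arguments, permutations of tensor factors permute arguments, and \<open>\<epsilon>\<^sub>X\<close> is the Kronecker delta.  Both
  sides of the theorem are computed in coordinates and turn out to be spanned by the same
  contractions \<open>M \<mapsto> (hs \<mapsto> \<Sum>b. M (b, b, hs))\<close> of the elements \<open>M\<close> of \<open>[\<phi>]\<close>.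

  For the right-hand side this holds because \<open>\<epsilon>\<^sub>X\<^sup>\<dagger>\<close> is the vector \<open>\<Sum>b. b \<otimes> b\<^sup>*\<close> (\<open>amps_contraction\<close>).

  For the left-hand side, a functional \<open>a\<close> belongs to \<open>[\<forall>x1. \<forall>x2. E(x1, x2) \<rightarrow> \<not> \<phi>]\<close> iff \<open>t2 \<otimes> t1 \<otimes> a\<close>
  belongs to \<open>[E \<rightarrow> \<not> \<phi>]\<close> for all functionals \<open>t1\<close>, \<open>t2\<close> on all atoms \<open>X\<^sub>1\<close>, \<open>X\<^sub>2\<close> (\<open>amps_forall\<close>).  The
  implication is \<open>E\<^sup>\<bottom> \<or> (E \<and> \<not> \<phi>)\<close>, so that only the projection to \<open>E\<close> matters.  If \<open>X\<^sub>2\<close> is not the dual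
  of \<open>X\<^sub>1\<close>, then \<open>E\<close> is zero and there is no condition.  If it is, \<open>E\<close> consists of the functionals
  \<open>\<epsilon> \<otimes> c\<close>, the projection of \<open>t2 \<otimes> t1 \<otimes> a\<close> is a multiple of \<open>\<epsilon> \<otimes> a\<close>, and it is a nonzero multiple for
  some \<open>t1\<close>, \<open>t2\<close>; the condition is therefore that \<open>\<epsilon> \<otimes> a\<close> is orthogonal to \<open>[\<phi>]\<close>
  (\<open>implication_of_diag\<close>).  Tensoring with \<open>\<epsilon>\<close> is adjoint to contraction, so this says that \<open>a\<close> is
  orthogonal to all contractions.  Negation takes the complement again, which by finite dimension
  yields the span of the contractions (\<open>amps_join\<close>).

  Two matters of syntax intervene.  The quantifiers put \<open>x2\<close> in front of \<open>x1\<close>, whereas \<open>\<phi>\<close> is to be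
  interpreted with \<open>x1\<close> first; reordering a context permutes tensor factors, by induction on formulas
  (\<open>interp_core_permute\<close>).  And formulas are interpreted after the elimination of function symbols,
  which for nonduplicating formulas leaves only atomic formulas with distinct variables as arguments
  (\<open>expand_wf\<close>).
\<close>

section \<open>Orthonormal bases\<close>

text \<open>
  The form need not be definite: Gram-Schmidt and orthogonal projection are needed both for the
  inner products of the ambient space and for \<open>\<Sum>i\<in>S. cnj (K i) * L i\<close> on complex functions of an
  arbitrary index type, and the latter is definite only on the functions that vanish off \<open>S\<close>.
  Positivity is therefore an assumption of the lemmas that use it.
\<close>

locale complex_form = vector_space scale
  for scale :: "complex \<Rightarrow> 'a::ab_group_add \<Rightarrow> 'a" +
  fixes form :: "'a \<Rightarrow> 'a \<Rightarrow> complex"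
  assumes form_commute: "form x y = cnj (form y x)"
    and form_add_right: "form x (y + z) = form x y + form x z"
    and form_scale_right: "form x (scale c y) = c * form x y"
begin

definition orthonormal :: "'a set \<Rightarrow> bool" where
  "orthonormal C \<longleftrightarrow> (\<forall>x\<in>C. \<forall>y\<in>C. form x y = (if x = y then 1 else 0))"

lemma form_zero_right [simp]: "form x 0 = 0"
  using form_scale_right[of x 0 0] by simp

lemma form_minus_right: "form x (- y) = - form x y"
  using form_scale_right[of x "-1" y] by simp

lemma form_diff_right: "form x (y - z) = form x y - form x z"
  using form_add_right[of x y "- z"] by (simp add: form_minus_right)

lemma form_sum_right: "form x (\<Sum>i\<in>A. f i) = (\<Sum>i\<in>A. form x (f i))"
  by (induction A rule: infinite_finite_induct) (simp_all add: form_add_right)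

lemma form_zero_left [simp]: "form 0 x = 0"
  using form_commute[of 0 x] by simp

lemma form_add_left: "form (x + y) z = form x z + form y z"
  by (metis complex_cnj_add form_add_right form_commute)

lemma form_scale_left: "form (scale c x) y = cnj c * form x y"
  by (metis complex_cnj_mult form_commute form_scale_right)

lemma form_self_real: "form x x = of_real (Re (form x x))"
  using form_commute[of x x] by (simp add: complex_eq_iff)

lemma form_span_left_eq_0:
  assumes "\<And>x. x \<in> S \<Longrightarrow> form x v = 0" "x \<in> span S"
  shows "form x v = 0"
  using assms(2) by (induction rule: span_induct_alt) (simp_all add: assms(1) form_add_left
      form_scale_left)

lemma orthonormal_projection:
  assumes "finite C" "orthonormal C"
  defines "p \<equiv> \<lambda>v. \<Sum>c\<in>C. scale (form c v) c"
  shows "p v \<in> span C" and "x \<in> span C \<Longrightarrow> form x (v - p v) = 0"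
proof -
  show "p v \<in> span C"
    unfolding p_def by (intro span_sum span_scale span_base)
  show "form x (v - p v) = 0" if "x \<in> span C"
  proof (rule form_span_left_eq_0[OF _ that])
    fix c assume c: "c \<in> C"
    have "form c (p v) = (\<Sum>d\<in>C. form d v * form c d)"
      by (simp add: p_def form_sum_right form_scale_right)
    also have "\<dots> = (\<Sum>d\<in>C. if d = c then form d v else 0)"
      by (rule sum.cong) (use c assms(2) in \<open>auto simp: orthonormal_def\<close>)
    also have "\<dots> = form c v"
      using c assms(1) by simp
    finally show "form c (v - p v) = 0"
      by (simp add: form_diff_right)
  qed
qed

text \<open>
  Subtracting from a new vector its projection on the span so far leaves a vector \<open>q\<close> orthogonal to
  that span; unless it is zero, its normalization extends the orthonormal set.
\<close>

lemma gram_schmidt: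
  assumes "finite B" "\<And>x. x \<in> span B \<Longrightarrow> x \<noteq> 0 \<Longrightarrow> Re (form x x) > 0"
  shows "\<exists>C. finite C \<and> orthonormal C \<and> span C = span B"
  using assms
proof (induction B rule: finite_induct)
  case empty
  then show ?case by (intro exI[of _ "{}"]) (simp add: orthonormal_def)
next
  case (insert b B)
  have "span B \<subseteq> span (insert b B)" by (intro span_mono) auto
  have "\<exists>C. finite C \<and> orthonormal C \<and> span C = span B"
    using insert.IH insert.prems \<open>span B \<subseteq> _\<close> by blast
  then obtain C where C: "finite C" "orthonormal C" "span C = span B" by blast
  define p where "p = (\<Sum>c\<in>C. scale (form c b) c)"
  define q where "q = b - p"
  have p: "p \<in> span B" and orth: "\<And>x. x \<in> span B \<Longrightarrow> form x q = 0"
    using orthonormal_projection[OF C(1,2)] by (simp_all add: p_def q_def flip: C(3))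
  have b: "b = q + p" by (simp add: q_def)
  show ?case
  proof (cases "q = 0")
    case True
    with b have "b = p" by (metis add_0)
    with p have "b \<in> span B" by metis
    then show ?thesis using C by (metis span_redundant)
  next
    case False
    have q: "q \<in> span (insert b B)"
      unfolding q_def using p \<open>span B \<subseteq> _\<close> by (intro span_diff) (auto intro: span_base)
    define r where "r = sqrt (Re (form q q))"
    have r: "r > 0" "r\<^sup>2 = Re (form q q)"
      using insert.prems[OF q False] by (simp_all add: r_def)
    define d where "d = scale (of_real (1 / r)) q"
    have "form d d = of_real (1 / r\<^sup>2) * form q q"
      by (simp add: d_def form_scale_left form_scale_right power2_eq_square)
    also have "\<dots> = 1"
      using r by (subst form_self_real) (simp flip: r(2) of_real_mult)
    finally have dd: "form d d = 1" .
    have cd: "form c d = 0" "form d c = 0" if "c \<in> C" for c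
    proof -
      have "c \<in> span B" using that C(3) by (metis span_base)
      then show "form c d = 0" by (simp add: d_def form_scale_right orth)
      then show "form d c = 0" by (subst form_commute) simp
    qed
    have "orthonormal (insert d C)"
      using C(2) dd cd by (auto simp: orthonormal_def)
    moreover have "span (insert d C) = span (insert b B)"
    proof -
      have qd: "q = scale (of_real r) d" using r by (simp add: d_def)
      have BC: "span B \<subseteq> span (insert d C)" using C(3) span_mono[of C "insert d C"] by auto
      have "b \<in> span (insert d C)"
        unfolding b qd using BC p by (intro span_add span_scale) (auto intro: span_base)
      then have "insert b B \<subseteq> span (insert d C)" using BC span_superset by blast
      moreover have "d \<in> span (insert b B)" unfolding d_def by (intro span_scale q)
      then have "insert d C \<subseteq> span (insert b B)"
        using C(3) \<open>span B \<subseteq> span (insert b B)\<close> span_superset by blast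
      ultimately show ?thesis by (simp add: span_eq)
    qed
    ultimately show ?thesis using C(1) by blast
  qed
qed

lemma orthonormal_independent:
  assumes "orthonormal C" shows "independent C"
proof
  assume "dependent C"
  then obtain T u v where T: "finite T" "T \<subseteq> C" "(\<Sum>v\<in>T. scale (u v) v) = 0" "v \<in> T" "u v \<noteq> 0"
    unfolding dependent_explicit by blast
  have "0 = form v (\<Sum>w\<in>T. scale (u w) w)" by (simp add: T(3))
  also have "\<dots> = (\<Sum>w\<in>T. u w * form v w)" by (simp add: form_sum_right form_scale_right)
  also have "\<dots> = (\<Sum>w\<in>T. if w = v then u w else 0)"
    using T assms by (intro sum.cong) (auto simp: orthonormal_def subset_iff)
  also have "\<dots> = u v" using T by simp
  finally show False using T by simp
qed

text \<open>
  A subspace of a finite-dimensional space has a finite basis, hence a finite orthonormal basis, and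
  the projection is the corresponding sum.
\<close>

lemma subspace_projection:
  assumes "finite B" "M \<subseteq> span B" "subspace M"
    and pos: "\<And>x. x \<in> span B \<Longrightarrow> x \<noteq> 0 \<Longrightarrow> Re (form x x) > 0"
    and v: "v \<in> span B"
  obtains p where "p \<in> M" "\<And>x. x \<in> M \<Longrightarrow> form x (v - p) = 0"
proof -
  obtain D where D: "D \<subseteq> M" "independent D" "M \<subseteq> span D"
    using basis_exists[of M] by metis
  have "finite D" using independent_span_bound[OF assms(1) D(2) subset_trans[OF D(1) assms(2)]] by blast
  have sp: "span D = M" using D assms(3) span_minimal by blast
  have "\<exists>C. finite C \<and> orthonormal C \<and> span C = span D"
    using \<open>finite D\<close> by (rule gram_schmidt) (use pos sp assms(2) in auto)
  then obtain C where C: "finite C" "orthonormal C" "span C = M" by (auto simp: sp)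
  show thesis
    using that[of "\<Sum>c\<in>C. scale (form c v) c"] orthonormal_projection[OF C(1,2), where v = v, unfolded
        C(3)]
    by simp
qed

end

global_interpretation cform: complex_form "scaleC :: complex \<Rightarrow> 'a \<Rightarrow> 'a::complex_inner" cinner
  by unfold_locales (rule cinner_commute cinner_add_right cinner_scaleC_right)+

lemma
  fixes H :: "'v::complex_inner set"
  assumes "fd_hilbert H"
  shows onb_cinner: "\<And>x y. x \<in> onb H \<Longrightarrow> y \<in> onb H \<Longrightarrow> cinner x y = (if x = y then 1 else 0)"
    and onb_span: "cvec.span (onb H) = H"
    and onb_finite: "finite (onb H)"
    and onb_nonempty: "onb H \<noteq> {}"
    and onb_subset: "onb H \<subseteq> H"
    and onb_expand: "\<And>h. h \<in> H \<Longrightarrow> h = (\<Sum>b\<in>onb H. scaleC (cinner b h) b)"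
proof -
  obtain B where B: "finite B" "H = cvec.span B" "H \<noteq> {0}"
    using assms by (auto simp: fd_hilbert_def)
  have "\<exists>C. finite C \<and> cform.orthonormal C \<and> cvec.span C = cvec.span B"
    using B(1) by (rule cform.gram_schmidt) (rule cinner_gt_zero)
  then have "\<exists>C. is_onb H C"
    unfolding is_onb_def cform.orthonormal_def B(2) by blast
  then have onb: "is_onb H (onb H)"
    unfolding onb_def by (rule someI_ex)
  then show *: "\<And>x y. x \<in> onb H \<Longrightarrow> y \<in> onb H \<Longrightarrow> cinner x y = (if x = y then 1 else 0)"
    and sp: "cvec.span (onb H) = H" unfolding is_onb_def by blast+
  have orth: "cform.orthonormal (onb H)" using * by (simp add: cform.orthonormal_def)
  show sub: "onb H \<subseteq> H" using cvec.span_superset[of "onb H"] by (simp add: sp)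
  show fin: "finite (onb H)"
    using cvec.independent_span_bound[OF B(1) cform.orthonormal_independent[OF orth]] sub
    by (simp flip: B(2))
  show "onb H \<noteq> {}" using sp B(3) by auto
  show "h = (\<Sum>b\<in>onb H. scaleC (cinner b h) b)" if "h \<in> H" for h
  proof (rule ccontr)
    define p where "p = (\<Sum>b\<in>onb H. scaleC (cinner b h) b)"
    assume "h \<noteq> (\<Sum>b\<in>onb H. scaleC (cinner b h) b)"
    then have "h - p \<noteq> 0" by (simp add: p_def)
    moreover have orth_p: "\<And>x. x \<in> cvec.span (onb H) \<Longrightarrow> cinner x (h - p) = 0"
      and "p \<in> cvec.span (onb H)"
      using cform.orthonormal_projection[OF fin orth, where v = h] by (simp_all add: p_def)
    moreover have span: "h - p \<in> cvec.span (onb H)"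
      using that sp \<open>p \<in> _\<close> by (intro cvec.span_diff) simp_all
    moreover have "cinner (h - p) (h - p) = 0"
      using span by (rule orth_p)
    ultimately show False using cinner_gt_zero[of "h - p"] by simp
  qed
qed

lemma fd_hilbert_closed:
  assumes "fd_hilbert H"
  shows "x \<in> H \<Longrightarrow> y \<in> H \<Longrightarrow> x + y \<in> H" and "x \<in> H \<Longrightarrow> scaleC c x \<in> H" and "0 \<in> H"
proof -
  obtain B where B: "H = cvec.span B"
    using assms by (auto simp: fd_hilbert_def)
  show "x \<in> H \<Longrightarrow> y \<in> H \<Longrightarrow> x + y \<in> H"
    unfolding B by (rule cvec.span_add)
  show "x \<in> H \<Longrightarrow> scaleC c x \<in> H"
    unfolding B by (rule cvec.span_scale)
  show "0 \<in> H"
    unfolding B by (rule cvec.span_zero)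
qed

section \<open>Product bases of tensor words\<close>

lemma listset_iff: "xs \<in> listset As \<longleftrightarrow> list_all2 (\<in>) xs As"
proof (induction As arbitrary: xs)
  case (Cons A As)
  then show ?case by (cases xs) (simp_all add: set_Cons_def)
qed simp

lemma listset_Cons: "x # xs \<in> listset (A # As) \<longleftrightarrow> x \<in> A \<and> xs \<in> listset As"
  by (simp add: set_Cons_def)

lemma listset_length: "xs \<in> listset As \<Longrightarrow> length xs = length As"
  by (auto simp: listset_iff dest: list_all2_lengthD)

lemma listset_append:
  "length xs = length As \<Longrightarrow> xs @ ys \<in> listset (As @ Bs) \<longleftrightarrow> xs \<in> listset As \<and> ys \<in> listset Bs"
  by (simp add: listset_iff list_all2_append)

lemma listset_appendE:
  assumes "zs \<in> listset (As @ Bs)"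
  obtains xs ys where "zs = xs @ ys" "xs \<in> listset As" "ys \<in> listset Bs"
  using assms unfolding listset_iff list_all2_append2 by blast

lemma finite_listset: "(\<And>A. A \<in> set As \<Longrightarrow> finite A) \<Longrightarrow> finite (listset As)"
proof (induction As)
  case (Cons A As)
  have "listset (A # As) = (\<lambda>(x, xs). x # xs) ` (A \<times> listset As)"
    by (auto simp: set_Cons_def)
  with Cons show ?case by simp
qed simp

lemma listset_nonempty: "(\<And>A. A \<in> set As \<Longrightarrow> A \<noteq> {}) \<Longrightarrow> listset As \<noteq> {}"
proof (induction As)
  case (Cons A As)
  then obtain x xs where "x \<in> A" "xs \<in> listset As"
    by (metis ex_in_conv list.set_intros)
  then have "x # xs \<in> listset (A # As)" by (simp add: set_Cons_def)
  then show ?case by blast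
qed simp

lemma sum_listset_Cons:
  "(\<Sum>xs\<in>listset (A # As). f xs) = (\<Sum>x\<in>A. \<Sum>xs\<in>listset As. f (x # xs))"
proof -
  have "(\<Sum>xs\<in>listset (A # As). f xs) = (\<Sum>(x, xs)\<in>A \<times> listset As. f (x # xs))"
    by (rule sum.reindex_bij_witness[of _ "\<lambda>(x, xs). x # xs" "\<lambda>l. (hd l, tl l)"])
      (auto simp: set_Cons_def)
  then show ?thesis by (simp add: sum.cartesian_product)
qed

lemma sum_listset_append:
  "(\<Sum>zs\<in>listset (As @ Bs). f zs) = (\<Sum>xs\<in>listset As. \<Sum>ys\<in>listset Bs. f (xs @ ys))"
  by (induction As arbitrary: f) (simp_all add: sum_listset_Cons del: listset.simps(2))

lemma atom_simps [simp]:
  "atom []" "atom (Hd # X) \<longleftrightarrow> fd_hilbert (fst Hd) \<and> atom X" "atom (X @ Y) \<longleftrightarrow> atom X \<and> atom Y"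
  by (auto simp: atom_def)

lemma atom_concat: "atom (concat Xs) \<longleftrightarrow> (\<forall>X\<in>set Xs. atom X)"
  by (induction Xs) auto

lemma atom_dual [simp]: "atom (dual_atom X) \<longleftrightarrow> atom X"
  by (induction X) (auto simp: dual_atom_def)

lemma basis_Nil [simp]: "basis [] = {[]}" and slots_Nil [simp]: "slots [] = {[]}"
  by (simp_all add: basis_def slots_def)

lemma basis_eq: "basis X = listset (map (onb \<circ> fst) X)"
  unfolding basis_def by (intro arg_cong[where f = listset] map_cong) auto

lemma basis_dual [simp]: "basis (dual_atom X) = basis X"
  by (simp add: basis_eq dual_atom_def comp_def)

lemma length_dual_atom [simp]: "length (dual_atom X) = length X"
  by (simp add: dual_atom_def)

lemma basis_length: "e \<in> basis X \<Longrightarrow> length e = length X"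
  by (auto simp: basis_eq dest: listset_length)

lemma slots_length: "u \<in> slots X \<Longrightarrow> length u = length X"
  by (auto simp: slots_def dest: listset_length)

lemma basis_append:
  "length e = length X \<Longrightarrow> e @ e' \<in> basis (X @ Y) \<longleftrightarrow> e \<in> basis X \<and> e' \<in> basis Y"
  by (simp add: basis_eq listset_append)

lemma slots_append:
  "length e = length X \<Longrightarrow> e @ e' \<in> slots (X @ Y) \<longleftrightarrow> e \<in> slots X \<and> e' \<in> slots Y"
  by (simp add: slots_def listset_append)

lemma finite_basis: "atom X \<Longrightarrow> finite (basis X)"
  unfolding basis_eq by (rule finite_listset) (auto simp: atom_def onb_finite)

lemma basis_nonempty: "atom X \<Longrightarrow> basis X \<noteq> {}"
  unfolding basis_eq by (rule listset_nonempty) (auto simp: atom_def onb_nonempty)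

lemma sum_basis_append: "(\<Sum>e\<in>basis (X @ Y). f e) = (\<Sum>e\<in>basis X. \<Sum>e'\<in>basis Y. f (e @ e'))"
  by (simp add: basis_eq sum_listset_append)

lemma sum_basis_Cons: "(\<Sum>e\<in>basis (Hd # X). f e) = (\<Sum>b\<in>onb (fst Hd). \<Sum>e\<in>basis X. f (b # e))"
  by (simp add: basis_eq sum_listset_Cons del: listset.simps(2))

lemma hilb_off_slots: "f \<in> hilb X \<Longrightarrow> u \<notin> slots X \<Longrightarrow> f u = 0"
  by (auto simp: hilb_def)

lemma slots_Cons: "h # u \<in> slots (Hd # X) \<longleftrightarrow> h \<in> fst Hd \<and> u \<in> slots X"
  by (simp add: slots_def listset_Cons del: listset.simps)

lemma slots_ConsE:
  assumes "u \<in> slots (Hd # X)"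
  obtains h u' where "u = h # u'" "h \<in> fst Hd" "u' \<in> slots X"
  using assms by (auto simp: slots_def set_Cons_def)

lemma hilb_Nil: "f \<in> hilb [] \<longleftrightarrow> (\<forall>u. u \<noteq> [] \<longrightarrow> f u = 0)"
  by (auto simp: hilb_def)

text \<open>
  Peeling off the first factor: a family of inner products over a word \<open>H # X\<close> is a first-slot
  (anti)linear family of vectors of \<open>X\<close>.  This makes induction over the word possible; the next two
  lemmas give the converse.
\<close>

lemma hilb_ConsI:
  assumes "\<And>u. u \<notin> slots (Hd # X) \<Longrightarrow> f u = 0"
    and sl: "\<And>h. h \<in> fst Hd \<Longrightarrow> (\<lambda>u. f (h # u)) \<in> hilb X"
    and add: "\<And>x y u. x \<in> fst Hd \<Longrightarrow> y \<in> fst Hd \<Longrightarrow> u \<in> slots X \<Longrightarrow> f ((x + y) # u) = f (x # u) + f (y # u)"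
    and scale: "\<And>c x u. x \<in> fst Hd \<Longrightarrow> u \<in> slots X \<Longrightarrow> f (scaleC c x # u) = (if snd Hd then c else cnj c) *
        f (x # u)"
  shows "f \<in> hilb (Hd # X)"
  unfolding hilb_def
proof (intro CollectI conjI ballI allI impI)
  fix u i x y c
  assume u: "u \<in> slots (Hd # X)" and i: "i < length (Hd # X)"
    and x: "x \<in> fst ((Hd # X) ! i)" and y: "y \<in> fst ((Hd # X) ! i)"
  obtain h u' where u': "u = h # u'" "h \<in> fst Hd" "u' \<in> slots X" using u by (rule slots_ConsE)
  show "f (u[i := x + y]) = f (u[i := x]) + f (u[i := y])"
    "f (u[i := scaleC c x]) = (if snd ((Hd # X) ! i) then c else cnj c) * f (u[i := x])"
    using sl[OF u'(2)] add scale u'(3) x y i unfolding u'(1) by (cases i; auto simp: hilb_def)+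
qed (use assms(1) in simp)

lemma hilb_Cons_slice:
  assumes "f \<in> hilb (Hd # X)" "h \<in> fst Hd"
  shows "(\<lambda>u. f (h # u)) \<in> hilb X"
  unfolding hilb_def
proof (intro CollectI conjI ballI allI impI)
  fix u assume "u \<notin> slots X"
  then show "f (h # u) = 0" by (intro hilb_off_slots[OF assms(1)]) (simp add: slots_Cons)
next
  fix u i x y c
  assume u: "u \<in> slots X" and i: "i < length X" and x: "x \<in> fst (X ! i)" and y: "y \<in> fst (X ! i)"
  have "h # u \<in> slots (Hd # X)" "Suc i < length (Hd # X)"
    "x \<in> fst ((Hd # X) ! Suc i)" "y \<in> fst ((Hd # X) ! Suc i)"
    using u i x y assms(2) by (simp_all add: slots_Cons)
  with assms(1) have "f ((h # u)[Suc i := x + y]) = f ((h # u)[Suc i := x]) + f ((h # u)[Suc i := y])"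
    "f ((h # u)[Suc i := scaleC c x]) = (if snd ((Hd # X) ! Suc i) then c else cnj c) * f ((h # u)[Suc i
        := x])"
    unfolding hilb_def by blast+
  then show "f (h # u[i := x + y]) = f (h # u[i := x]) + f (h # u[i := y])"
    "f (h # u[i := scaleC c x]) = (if snd (X ! i) then c else cnj c) * f (h # u[i := x])"
    by simp_all
qed

lemma hilb_Cons_linear:
  assumes "f \<in> hilb (Hd # X)" "x \<in> fst Hd" "y \<in> fst Hd" "u \<in> slots X"
  shows "f ((x + y) # u) = f (x # u) + f (y # u)"
    and "f (scaleC c x # u) = (if snd Hd then c else cnj c) * f (x # u)"
proof -
  have "x # u \<in> slots (Hd # X)" using assms by (simp add: slots_Cons)
  with assms(1-3) have "f ((x # u)[0 := x + y]) = f ((x # u)[0 := x]) + f ((x # u)[0 := y])"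
    "f ((x # u)[0 := scaleC c x]) = (if snd ((Hd # X) ! 0) then c else cnj c) * f ((x # u)[0 := x])"
    unfolding hilb_def by (auto simp del: list_update.simps)
  then show "f ((x + y) # u) = f (x # u) + f (y # u)"
    "f (scaleC c x # u) = (if snd Hd then c else cnj c) * f (x # u)" by simp_all
qed

lemma hilb_add: "f \<in> hilb X \<Longrightarrow> g \<in> hilb X \<Longrightarrow> (\<lambda>u. f u + g u) \<in> hilb X"
  by (simp add: hilb_def algebra_simps)

lemma hilb_scale: "f \<in> hilb X \<Longrightarrow> (\<lambda>u. c * f u) \<in> hilb X"
  by (simp add: hilb_def algebra_simps)

lemma hilb_zero: "(\<lambda>u. 0) \<in> hilb X" and hilb_zero': "0 \<in> hilb X"
  by (simp_all add: hilb_def)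

lemma hilb_sum: "(\<And>i. i \<in> I \<Longrightarrow> F i \<in> hilb X) \<Longrightarrow> (\<lambda>u. \<Sum>i\<in>I. c i * F i u) \<in> hilb X"
  by (induction I rule: infinite_finite_induct) (simp_all add: hilb_zero hilb_add hilb_scale)

lemma ket_Nil: "ket [] v u = (if u = [] then 1 else 0)"
  by (simp add: ket_def)

lemma ket_Cons:
  assumes "h \<in> fst Hd"
  shows "ket (Hd # X) (b # v) (h # u) = (if snd Hd then cinner b h else cinner h b) * ket X v u"
  using assms by (auto simp: ket_def slots_Cons prod.lessThan_Suc_shift comp_def
      simp del: prod.lessThan_Suc cong: if_cong)

lemma ket_off_slots: "u \<notin> slots X \<Longrightarrow> ket X v u = 0"
  by (simp add: ket_def)

lemma cinner_add_left: "cinner (x + y) z = cinner x z + cinner y z"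
  by (rule cform.form_add_left)

lemma cinner_scaleC_left: "cinner (scaleC c x) z = cnj c * cinner x z"
  by (rule cform.form_scale_left)

lemma ket_in_hilb: "atom X \<Longrightarrow> length v = length X \<Longrightarrow> ket X v \<in> hilb X"
proof (induction X arbitrary: v)
  case Nil
  then show ?case by (simp add: hilb_Nil ket_Nil)
next
  case (Cons Hd X)
  then obtain b v' where v: "v = b # v'" "length v' = length X" by (cases v) auto
  note closed = fd_hilbert_closed[of "fst Hd"]
  show ?case
    unfolding v(1)
  proof (rule hilb_ConsI)
    fix h assume "h \<in> fst Hd"
    then have "(\<lambda>u. ket (Hd # X) (b # v') (h # u)) =
        (\<lambda>u. (if snd Hd then cinner b h else cinner h b) * ket X v' u)"
      by (simp add: ket_Cons)
    with Cons v(2) show "(\<lambda>u. ket (Hd # X) (b # v') (h # u)) \<in> hilb X"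
      by (simp only: atom_simps) (intro hilb_scale, blast)
  qed (use Cons.prems in \<open>simp_all add: ket_off_slots ket_Cons closed cinner_add_right cinner_add_left
         cinner_scaleC_right cinner_scaleC_left ring_distribs\<close>)
qed

text \<open>
  Product basis vectors serve both as labels \<open>e\<close> and as vectors \<open>ket X e\<close>: the value \<open>f e\<close> of a
  vector at a label is its coordinate, because a vector is stored as its inner products.
\<close>

lemma ket_basis:
  "atom X \<Longrightarrow> e \<in> basis X \<Longrightarrow> e' \<in> basis X \<Longrightarrow> ket X e e' = (if e = e' then 1 else 0)"
proof (induction X arbitrary: e e')
  case Nil
  then show ?case by (simp add: ket_Nil)
next
  case (Cons Hd X)
  then obtain b d b' d' where *: "e = b # d" "e' = b' # d'" "b \<in> onb (fst Hd)" "b' \<in> onb (fst Hd)"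
    "d \<in> basis X" "d' \<in> basis X" by (auto simp: basis_eq set_Cons_def)
  moreover have "b' \<in> fst Hd" using onb_subset[of "fst Hd"] Cons.prems *(4) by auto
  ultimately show ?case
    using Cons by (auto simp: ket_Cons onb_cinner)
qed

lemma hilb_Cons_sum:
  assumes "f \<in> hilb (Hd # X)" "fd_hilbert (fst Hd)" "u \<in> slots X" "finite B" "B \<subseteq> fst Hd"
  shows "f ((\<Sum>b\<in>B. scaleC (c b) b) # u) = (\<Sum>b\<in>B. (if snd Hd then c b else cnj (c b)) * f (b # u)) \<and>
    (\<Sum>b\<in>B. scaleC (c b) b) \<in> fst Hd"
  using assms(4,5)
proof (induction B rule: finite_induct)
  case empty
  show ?case
    using hilb_Cons_linear(2)[OF assms(1), of 0 0 u 0] fd_hilbert_closed(3)[OF assms(2)] assms(3)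
    by (simp split: if_splits)
next
  case (insert b B)
  then show ?case
    using hilb_Cons_linear[OF assms(1) _ _ assms(3)] fd_hilbert_closed[OF assms(2)] by simp
qed

text \<open>
  Expanding the argument of the first slot in the orthonormal basis of the first factor and using
  (anti)linearity in that slot reduces the claim to the remaining factors.
\<close>

lemma hilb_expand:
  assumes "atom X" "f \<in> hilb X"
  shows "f = (\<lambda>u. \<Sum>e\<in>basis X. f e * ket X e u)"
proof
  have "f u = (\<Sum>e\<in>basis X. f e * ket X e u)" if "u \<in> slots X" for u
    using assms that
  proof (induction X arbitrary: f u)
    case Nil
    then show ?case by (simp add: ket_Nil)
  next
    case (Cons Hd X)
    obtain h u' where u: "u = h # u'" "h \<in> fst Hd" "u' \<in> slots X" using Cons.prems(3) by (rule
        slots_ConsE)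
    have Hd: "fd_hilbert (fst Hd)" "atom X" using Cons.prems by simp_all
    let ?c = "\<lambda>b. if snd Hd then cinner b h else cinner h b"
    have "f (h # u') = f ((\<Sum>b\<in>onb (fst Hd). scaleC (cinner b h) b) # u')"
      using onb_expand[OF Hd(1) u(2)] by simp
    also have "\<dots> = (\<Sum>b\<in>onb (fst Hd). (if snd Hd then cinner b h else cnj (cinner b h)) * f (b # u'))"
      by (rule hilb_Cons_sum[OF Cons.prems(2) Hd(1) u(3) onb_finite[OF Hd(1)] onb_subset[OF Hd(1)],
            THEN conjunct1])
    also have "\<dots> = (\<Sum>b\<in>onb (fst Hd). ?c b * f (b # u'))"
      by (intro sum.cong refl) (simp add: cinner_commute[of h])
    also have "\<dots> = (\<Sum>b\<in>onb (fst Hd). ?c b * (\<Sum>e\<in>basis X. f (b # e) * ket X e u'))"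
    proof (rule sum.cong[OF refl])
      fix b assume "b \<in> onb (fst Hd)"
      then have "b \<in> fst Hd" using onb_subset[OF Hd(1)] by auto
      from Cons.IH[OF Hd(2) hilb_Cons_slice[OF Cons.prems(2) this] u(3)]
      show "?c b * f (b # u') = ?c b * (\<Sum>e\<in>basis X. f (b # e) * ket X e u')" by simp
    qed
    also have "\<dots> = (\<Sum>e\<in>basis (Hd # X). f e * ket (Hd # X) e (h # u'))"
      using u(2) by (simp add: sum_basis_Cons ket_Cons sum_distrib_left mult_ac)
    finally show ?case by (simp add: u(1))
  qed
  then show "f u = (\<Sum>e\<in>basis X. f e * ket X e u)" for u
    using hilb_off_slots[OF assms(2)] by (cases "u \<in> slots X") (simp_all add: ket_off_slots)
qed

lemma hilb_eqI:
  assumes "atom X" "f \<in> hilb X" "g \<in> hilb X" "\<And>e. e \<in> basis X \<Longrightarrow> f e = g e"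
  shows "f = g"
proof -
  have "f = (\<lambda>u. \<Sum>e\<in>basis X. f e * ket X e u)" by (rule hilb_expand[OF assms(1,2)])
  also have "\<dots> = (\<lambda>u. \<Sum>e\<in>basis X. g e * ket X e u)" using assms(4) by simp
  also have "\<dots> = g" by (rule hilb_expand[OF assms(1,3), symmetric])
  finally show ?thesis .
qed

lemma sum_delta_basis:
  fixes c :: "'v::complex_inner list \<Rightarrow> complex"
  assumes "atom X" "e \<in> basis X"
  shows "(\<Sum>d\<in>basis X. c d * ket X d e) = c e" and "(\<Sum>d\<in>basis X. c d * ket X e d) = c e"
proof -
  have "(\<Sum>d\<in>basis X. c d * ket X d e) = (\<Sum>d\<in>basis X. if d = e then c d else 0)"
    by (rule sum.cong) (use assms in \<open>auto simp: ket_basis\<close>)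
  then show "(\<Sum>d\<in>basis X. c d * ket X d e) = c e" using assms(2) finite_basis[OF assms(1)] by simp
  have "(\<Sum>d\<in>basis X. c d * ket X e d) = (\<Sum>d\<in>basis X. if d = e then c d else 0)"
    by (rule sum.cong) (use assms in \<open>auto simp: ket_basis\<close>)
  then show "(\<Sum>d\<in>basis X. c d * ket X e d) = c e" using assms(2) finite_basis[OF assms(1)] by simp
qed

lemma vtensor_append: "length u = length X \<Longrightarrow> vtensor X f g (u @ u') = f u * g u'"
  by (simp add: vtensor_def)

lemma vtensor_Cons: "vtensor (Hd # X) f g (h # u) = vtensor X (\<lambda>u. f (h # u)) g u"
  by (simp add: vtensor_def)

lemma vtensor_in_hilb: "f \<in> hilb X \<Longrightarrow> g \<in> hilb Y \<Longrightarrow> vtensor X f g \<in> hilb (X @ Y)"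
proof (induction X arbitrary: f)
  case Nil
  have "vtensor [] f g = (\<lambda>u. f [] * g u)" by (simp add: vtensor_def)
  with Nil show ?case by (simp add: hilb_scale)
next
  case (Cons Hd X)
  show ?case
    unfolding append_Cons
  proof (rule hilb_ConsI)
    fix u assume u: "u \<notin> slots (Hd # X @ Y)"
    show "vtensor (Hd # X) f g u = 0"
    proof (rule ccontr)
      assume "vtensor (Hd # X) f g u \<noteq> 0"
      then have *: "take (length (Hd # X)) u \<in> slots (Hd # X)" "drop (length (Hd # X)) u \<in> slots Y"
        using hilb_off_slots[OF Cons.prems(1)] hilb_off_slots[OF Cons.prems(2)]
        unfolding vtensor_def by force+
      with slots_append[of "take (length (Hd # X)) u" "Hd # X" "drop (length (Hd # X)) u" Y]
      have "u \<in> slots ((Hd # X) @ Y)" using slots_length[OF *(1)] by (metis append_take_drop_id)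
      with u show False by simp
    qed
  next
    fix h assume "h \<in> fst Hd"
    then show "(\<lambda>u. vtensor (Hd # X) f g (h # u)) \<in> hilb (X @ Y)"
      unfolding vtensor_Cons using Cons hilb_Cons_slice by blast
  next
    fix x y u assume u: "x \<in> fst Hd" "y \<in> fst Hd" "u \<in> slots (X @ Y)"
    then have t: "take (length X) u \<in> slots X"
      by (auto simp: slots_def listset_length elim!: listset_appendE)
    show "vtensor (Hd # X) f g ((x + y) # u) = vtensor (Hd # X) f g (x # u) + vtensor (Hd # X) f g (y #
        u)"
      using hilb_Cons_linear(1)[OF Cons.prems(1) u(1,2) t] by (simp add: vtensor_def ring_distribs)
  next
    fix c x u assume u: "x \<in> fst Hd" "u \<in> slots (X @ Y)"
    then have t: "take (length X) u \<in> slots X"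
      by (auto simp: slots_def listset_length elim!: listset_appendE)
    show "vtensor (Hd # X) f g (scaleC c x # u) = (if snd Hd then c else cnj c) * vtensor (Hd # X) f g
        (x # u)"
      using hilb_Cons_linear(2)[OF Cons.prems(1) u(1,1) t] by (simp add: vtensor_def)
  qed
qed

lemma basis_appendE:
  assumes "e \<in> basis (X @ Y)"
  obtains e1 e2 where "e = e1 @ e2" "e1 \<in> basis X" "e2 \<in> basis Y"
  using assms by (auto simp: basis_eq elim: listset_appendE)

lemma vtensor_ket:
  assumes "atom X" "atom Y" "e \<in> basis X" "e' \<in> basis Y"
  shows "vtensor X (ket X e) (ket Y e') = ket (X @ Y) (e @ e')"
proof (rule hilb_eqI[of "X @ Y"])
  fix d assume "d \<in> basis (X @ Y)"
  then obtain d1 d2 where d: "d = d1 @ d2" "d1 \<in> basis X" "d2 \<in> basis Y" by (rule basis_appendE)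
  then show "vtensor X (ket X e) (ket Y e') d = ket (X @ Y) (e @ e') d"
    using assms by (auto simp: vtensor_append basis_length ket_basis basis_append)
qed (use assms in \<open>simp_all add: vtensor_in_hilb ket_in_hilb basis_length\<close>)

section \<open>Operators given on a product basis\<close>

lemma OpD:
  assumes "a \<in> Op X Y"
  shows Op_hilb: "f \<in> hilb X \<Longrightarrow> a f \<in> hilb Y"
    and Op_add: "f \<in> hilb X \<Longrightarrow> g \<in> hilb X \<Longrightarrow> a (f + g) = a f + a g"
    and Op_scale: "f \<in> hilb X \<Longrightarrow> a (\<lambda>u. c * f u) = (\<lambda>u. c * a f u)"
    and Op_off: "f \<notin> hilb X \<Longrightarrow> a f = 0"
  using assms unfolding Op_def by blast+

lemma Op_sum:
  assumes "a \<in> Op X Y" "\<And>i. i \<in> I \<Longrightarrow> F i \<in> hilb X"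
  shows "a (\<lambda>u. \<Sum>i\<in>I. c i * F i u) = (\<lambda>u. \<Sum>i\<in>I. c i * a (F i) u)"
  using assms(2)
proof (induction I rule: infinite_finite_induct)
  case (insert i I)
  have *: "(\<lambda>u. \<Sum>i\<in>insert i I. c i * F i u) = (\<lambda>u. c i * F i u) + (\<lambda>u. \<Sum>i\<in>I. c i * F i u)"
    using insert.hyps by (simp add: fun_eq_iff)
  have "a (\<lambda>u. \<Sum>i\<in>insert i I. c i * F i u) = a (\<lambda>u. c i * F i u) + a (\<lambda>u. \<Sum>i\<in>I. c i * F i u)"
    unfolding * using insert.prems by (intro Op_add[OF assms(1)] hilb_scale hilb_sum) auto
  also have "\<dots> = (\<lambda>u. c i * a (F i) u) + (\<lambda>u. \<Sum>i\<in>I. c i * a (F i) u)"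
    using insert by (simp add: Op_scale[OF assms(1)])
  also have "\<dots> = (\<lambda>u. \<Sum>i\<in>insert i I. c i * a (F i) u)"
    using insert.hyps by (simp add: fun_eq_iff)
  finally show ?case .
qed (use Op_scale[OF assms(1) hilb_zero, of 0] in \<open>simp_all\<close>)

lemma Op_expand:
  assumes "atom X" "a \<in> Op X Y" "f \<in> hilb X"
  shows "a f = (\<lambda>u. \<Sum>e\<in>basis X. f e * a (ket X e) u)"
proof -
  have "a f = a (\<lambda>u. \<Sum>e\<in>basis X. f e * ket X e u)"
    using hilb_expand[OF assms(1,3)] by simp
  also have "\<dots> = (\<lambda>u. \<Sum>e\<in>basis X. f e * a (ket X e) u)"
    by (rule Op_sum[OF assms(2)]) (simp add: assms(1) ket_in_hilb basis_length)
  finally show ?thesis .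
qed

lemma Op_eqI:
  assumes "atom X" "a \<in> Op X Y" "b \<in> Op X Y" "\<And>e. e \<in> basis X \<Longrightarrow> a (ket X e) = b (ket X e)"
  shows "a = b"
proof
  fix f
  show "a f = b f"
  proof (cases "f \<in> hilb X")
    case True
    then show ?thesis using assms(4) by (simp add: Op_expand[OF assms(1,2)] Op_expand[OF assms(1,3)])
  qed (simp add: Op_off[OF assms(2)] Op_off[OF assms(3)])
qed

lemma OpI:
  assumes "\<And>f. f \<in> hilb X \<Longrightarrow> a f \<in> hilb Y"
    and "\<And>f g. f \<in> hilb X \<Longrightarrow> g \<in> hilb X \<Longrightarrow> a (f + g) = a f + a g"
    and "\<And>f c. f \<in> hilb X \<Longrightarrow> a (\<lambda>u. c * f u) = (\<lambda>u. c * a f u)"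
    and "\<And>f. f \<notin> hilb X \<Longrightarrow> a f = 0"
  shows "a \<in> Op X Y"
  using assms unfolding Op_def by blast

lemma hilb_plus: "f \<in> hilb X \<Longrightarrow> g \<in> hilb X \<Longrightarrow> f + g \<in> hilb X"
  by (simp add: plus_fun_def hilb_add)

text \<open>
  The operator with prescribed values \<open>G e\<close> on the basis vectors.  All operators that are defined by
  a unique description are obtained in this form.
\<close>

definition op_ext :: "'v::complex_inner atom \<Rightarrow> ('v list \<Rightarrow> 'v vect) \<Rightarrow> 'v oper" where
  "op_ext X G = (\<lambda>f. if f \<in> hilb X then (\<lambda>u. \<Sum>e\<in>basis X. f e * G e u) else 0)"

lemma op_ext_Op:
  assumes "\<And>e. e \<in> basis X \<Longrightarrow> G e \<in> hilb Y"
  shows "op_ext X G \<in> Op X Y"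
  using assms
  by (intro OpI) (simp_all add: op_ext_def hilb_sum hilb_plus hilb_scale fun_eq_iff sum.distrib
      ring_distribs sum_distrib_left mult.assoc)

lemma op_ext_ket:
  assumes "atom X" "e \<in> basis X"
  shows "op_ext X G (ket X e) = G e"
proof -
  have "op_ext X G (ket X e) = (\<lambda>u. \<Sum>d\<in>basis X. G d u * ket X e d)"
    using assms by (simp add: op_ext_def ket_in_hilb basis_length mult.commute)
  then show ?thesis using sum_delta_basis(2)[OF assms] by simp
qed

lemma Op_zero: "0 \<in> Op X Y"
  by (rule OpI) (simp_all add: hilb_zero' fun_eq_iff)

lemma Op_plus:
  assumes "a \<in> Op X Y" "b \<in> Op X Y"
  shows "a + b \<in> Op X Y"
  by (rule OpI) (simp_all add: OpD[OF assms(1)] OpD[OF assms(2)] hilb_plus fun_eq_iff algebra_simps)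

lemma Op_mult:
  assumes "a \<in> Op X Y"
  shows "(\<lambda>f u. c * a f u) \<in> Op X Y"
  by (rule OpI) (simp_all add: OpD[OF assms] hilb_scale fun_eq_iff algebra_simps)

lemma Op_subspace: "op.subspace (Op X Y)"
  by (rule op.subspaceI) (simp_all add: Op_zero Op_plus Op_mult)

lemma op_id_Op: "op_id X \<in> Op X X"
  by (rule OpI) (simp_all add: op_id_def hilb_scale hilb_plus)

lemma Op_comp:
  assumes "a \<in> Op X Y" "b \<in> Op Y Z"
  shows "b \<circ> a \<in> Op X Z"
proof -
  have "b 0 = 0" using Op_scale[OF assms(2) hilb_zero, of 0] by (simp add: fun_eq_iff zero_fun_def)
  then show ?thesis
    by (intro OpI) (simp_all add: OpD[OF assms(1)] OpD[OF assms(2)])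
qed

text \<open>
  The universal property of the tensor product, in the shape in which tensor products of operators
  and the evaluation map are described.
\<close>

lemma bilinear_extension:
  assumes "atom X" "atom X'" and G: "\<And>e e'. e \<in> basis X \<Longrightarrow> e' \<in> basis X' \<Longrightarrow> G e e' \<in> hilb Z"
    and B: "\<And>f g. f \<in> hilb X \<Longrightarrow> g \<in> hilb X' \<Longrightarrow>
      B f g = (\<lambda>u. \<Sum>e\<in>basis X. \<Sum>e'\<in>basis X'. f e * g e' * G e e' u)"
  defines "t \<equiv> (THE c. c \<in> Op (X @ X') Z \<and> (\<forall>f\<in>hilb X. \<forall>g\<in>hilb X'. c (vtensor X f g) = B f g))"
  shows "t \<in> Op (X @ X') Z"
    and "\<And>e e'. e \<in> basis X \<Longrightarrow> e' \<in> basis X' \<Longrightarrow> t (ket (X @ X') (e @ e')) = G e e'"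
proof -
  define c where "c = op_ext (X @ X') (\<lambda>d. G (take (length X) d) (drop (length X) d))"
  have c: "c \<in> Op (X @ X') Z"
    unfolding c_def by (rule op_ext_Op) (auto elim!: basis_appendE simp: basis_length G)
  have ket: "c (ket (X @ X') (e @ e')) = G e e'" if "e \<in> basis X" "e' \<in> basis X'" for e e'
    using that assms(1,2) by (simp add: c_def op_ext_ket basis_append basis_length)
  have ct: "c (vtensor X f g) = B f g" if "f \<in> hilb X" "g \<in> hilb X'" for f g
    unfolding B[OF that] c_def op_ext_def using vtensor_in_hilb[OF that]
    by (simp add: sum_basis_append) (intro ext sum.cong refl, simp add: vtensor_append basis_length)
  have uniq: "c' = c" if "c' \<in> Op (X @ X') Z"
    "\<And>f g. f \<in> hilb X \<Longrightarrow> g \<in> hilb X' \<Longrightarrow> c' (vtensor X f g) = B f g" for c'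
  proof (rule Op_eqI[OF _ that(1) c])
    fix e assume "e \<in> basis (X @ X')"
    then obtain e1 e2 where e: "e = e1 @ e2" "e1 \<in> basis X" "e2 \<in> basis X'" by (rule basis_appendE)
    then have k: "ket X e1 \<in> hilb X" "ket X' e2 \<in> hilb X'" using assms(1,2) by (simp_all add:
        ket_in_hilb basis_length)
    have "ket (X @ X') e = vtensor X (ket X e1) (ket X' e2)" using e assms(1,2) by (simp add:
        vtensor_ket)
    then show "c' (ket (X @ X') e) = c (ket (X @ X') e)" using that(2)[OF k] ct[OF k] by simp
  qed (simp add: assms(1,2))
  have "t = c"
    unfolding t_def by (rule the_equality, use c ct in blast, rule uniq, blast, blast)
  then show "t \<in> Op (X @ X') Z" "\<And>e e'. e \<in> basis X \<Longrightarrow> e' \<in> basis X' \<Longrightarrow> t (ket (X @ X') (e @ e')) = G e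
      e'"
    using c ket by simp_all
qed

lemma
  assumes "atom X" "atom X'" and a: "a \<in> Op X Y" and b: "b \<in> Op X' Y'"
  shows op_tensor_Op: "op_tensor X Y X' Y' a b \<in> Op (X @ X') (Y @ Y')"
    and op_tensor_ket: "\<And>e e'. e \<in> basis X \<Longrightarrow> e' \<in> basis X' \<Longrightarrow>
      op_tensor X Y X' Y' a b (ket (X @ X') (e @ e')) = vtensor Y (a (ket X e)) (b (ket X' e'))"
proof -
  have G: "vtensor Y (a (ket X e)) (b (ket X' e')) \<in> hilb (Y @ Y')" if "e \<in> basis X" "e' \<in> basis X'" for
      e e'
    using that assms(1,2)
    by (intro vtensor_in_hilb Op_hilb[OF a] Op_hilb[OF b]) (simp_all add: ket_in_hilb basis_length)
  have B: "vtensor Y (a f) (b g) = (\<lambda>u. \<Sum>e\<in>basis X. \<Sum>e'\<in>basis X'. f e * g e' * vtensor Y (a (ket X e))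
      (b (ket X' e')) u)"
    if "f \<in> hilb X" "g \<in> hilb X'" for f g
    unfolding vtensor_def Op_expand[OF assms(1) a that(1)] Op_expand[OF assms(2) b that(2)]
    by (simp add: sum_product mult_ac)
  note ext = bilinear_extension[OF assms(1,2), where Z = "Y @ Y'"
      and G = "\<lambda>e e'. vtensor Y (a (ket X e)) (b (ket X' e'))" and B = "\<lambda>f g. vtensor Y (a f) (b g)"]
  show "op_tensor X Y X' Y' a b \<in> Op (X @ X') (Y @ Y')"
    unfolding op_tensor_def by (rule ext(1)) (rule G B; assumption)+
  show "op_tensor X Y X' Y' a b (ket (X @ X') (e @ e')) = vtensor Y (a (ket X e)) (b (ket X' e'))"
    if "e \<in> basis X" "e' \<in> basis X'" for e e'
    unfolding op_tensor_def by (rule ext(2)[OF _ _ that]) (rule G B; assumption)+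
qed

lemma scalar_hilb [simp]: "scalar c \<in> hilb []"
  by (simp add: hilb_Nil scalar_def)

lemma hilb_Nil_eq: "f \<in> hilb [] \<Longrightarrow> f = scalar (f [])"
  by (auto simp: hilb_Nil scalar_def fun_eq_iff)

lemma ket_Nil_scalar: "ket [] [] = scalar 1"
  by (simp add: fun_eq_iff ket_Nil scalar_def)

lemma
  assumes "atom X"
  shows op_eval_Op: "op_eval X \<in> Op (X @ dual_atom X) []"
    and op_eval_ket: "\<And>e e'. e \<in> basis X \<Longrightarrow> e' \<in> basis X \<Longrightarrow>
      op_eval X (ket (X @ dual_atom X) (e @ e')) = scalar (if e = e' then 1 else 0)"
proof -
  have B: "scalar (evaluate X g f) = (\<lambda>u. \<Sum>e\<in>basis X. \<Sum>e'\<in>basis (dual_atom X).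
      f e * g e' * scalar (if e = e' then 1 else 0) u)" for f g
  proof
    fix u
    have "(\<Sum>e\<in>basis X. \<Sum>e'\<in>basis X. f e * g e' * scalar (if e = e' then 1 else 0) u) =
        (\<Sum>e\<in>basis X. \<Sum>e'\<in>basis X. if e = e' then scalar (g e * f e) u else 0)"
      by (intro sum.cong refl) (auto simp: scalar_def)
    also have "\<dots> = scalar (evaluate X g f) u"
      using finite_basis[OF assms] by (simp add: evaluate_def scalar_def)
    finally show "scalar (evaluate X g f) u = (\<Sum>e\<in>basis X. \<Sum>e'\<in>basis (dual_atom X).
        f e * g e' * scalar (if e = e' then 1 else 0) u)" by simp
  qed
  have "atom (dual_atom X)" using assms by simp
  note ext = bilinear_extension[OF assms this, where Z = "[]"
      and G = "\<lambda>e e'. scalar (if e = e' then 1 else 0)" and B = "\<lambda>f g. scalar (evaluate X g f)"]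
  show "op_eval X \<in> Op (X @ dual_atom X) []"
    unfolding op_eval_def by (rule ext(1)) (rule scalar_hilb B)+
  show "op_eval X (ket (X @ dual_atom X) (e @ e')) = scalar (if e = e' then 1 else 0)"
    if "e \<in> basis X" "e' \<in> basis X" for e e'
    unfolding op_eval_def by (rule ext(2)) (use that in \<open>simp_all add: B\<close>)
qed

lemma hinner_ket:
  assumes "atom X" "e \<in> basis X"
  shows "hinner X (ket X e) f = f e" and "hinner X f (ket X e) = cnj (f e)"
proof -
  have "hinner X (ket X e) f = (\<Sum>d\<in>basis X. f d * ket X e d)"
    unfolding hinner_def by (rule sum.cong) (use assms in \<open>auto simp: ket_basis\<close>)
  then show "hinner X (ket X e) f = f e" using sum_delta_basis(2)[OF assms] by simp
  show "hinner X f (ket X e) = cnj (f e)"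
    unfolding hinner_def using sum_delta_basis(2)[OF assms, of "\<lambda>d. cnj (f d)"] by simp
qed

lemma
  assumes "atom X" "atom Y" and a: "a \<in> Op X Y"
  shows adjoint_Op: "adjoint X Y a \<in> Op Y X"
    and adjoint_hinner: "\<And>f g. f \<in> hilb X \<Longrightarrow> g \<in> hilb Y \<Longrightarrow> hinner X (adjoint X Y a g) f = hinner Y g (a
        f)"
proof -
  \<comment> \<open>The matrix of the adjoint is the conjugate transpose.\<close>
  define b where "b = op_ext Y (\<lambda>d u. \<Sum>e\<in>basis X. cnj (a (ket X e) d) * ket X e u)"
  have b: "b \<in> Op Y X"
    unfolding b_def using assms(1) by (intro op_ext_Op hilb_sum) (simp add: ket_in_hilb basis_length)
  have bh: "hinner X (b g) f = hinner Y g (a f)" if "f \<in> hilb X" "g \<in> hilb Y" for f g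
  proof -
    have bge: "b g e = (\<Sum>d\<in>basis Y. g d * cnj (a (ket X e) d))" if "e \<in> basis X" for e
      using \<open>g \<in> hilb Y\<close> sum_delta_basis(1)[OF assms(1) that] by (simp add: b_def op_ext_def)
    have "hinner X (b g) f = (\<Sum>e\<in>basis X. \<Sum>d\<in>basis Y. cnj (g d) * (f e * a (ket X e) d))"
      unfolding hinner_def
      by (intro sum.cong refl) (simp add: bge sum_distrib_left sum_distrib_right mult_ac)
    also have "\<dots> = hinner Y g (a f)"
      unfolding hinner_def Op_expand[OF assms(1) a that(1)]
      by (subst sum.swap) (simp add: sum_distrib_left)
    finally show ?thesis .
  qed
  have uniq: "b' = b" if b': "b' \<in> Op Y X"
    "\<And>f g. f \<in> hilb X \<Longrightarrow> g \<in> hilb Y \<Longrightarrow> hinner X (b' g) f = hinner Y g (a f)" for b'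
  proof (rule Op_eqI[OF assms(2) that(1) b])
    fix d assume "d \<in> basis Y"
    then have k: "ket Y d \<in> hilb Y" using assms(2) by (simp add: ket_in_hilb basis_length)
    show "b' (ket Y d) = b (ket Y d)"
    proof (rule hilb_eqI[OF assms(1) Op_hilb[OF b'(1) k] Op_hilb[OF b k]])
      fix e assume e: "e \<in> basis X"
      then have k': "ket X e \<in> hilb X" using assms(1) by (simp add: ket_in_hilb basis_length)
      have "hinner X (b' (ket Y d)) (ket X e) = hinner X (b (ket Y d)) (ket X e)"
        using b'(2)[OF k' k] bh[OF k' k] by simp
      then show "b' (ket Y d) e = b (ket Y d) e"
        using e assms(1) by (simp add: hinner_ket)
    qed
  qed
  have "adjoint X Y a = b"
    unfolding adjoint_def by (rule the_equality, use b bh in blast, rule uniq, blast, blast)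
  then show "adjoint X Y a \<in> Op Y X"
    "\<And>f g. f \<in> hilb X \<Longrightarrow> g \<in> hilb Y \<Longrightarrow> hinner X (adjoint X Y a g) f = hinner Y g (a f)"
    using b bh by auto
qed

text \<open>
  For functionals the trace inner product is the standard inner product of their values on a basis:
  the codomain has the single basis label \<open>[]\<close>.
\<close>

lemma op_inner_functional:
  assumes "atom X" "a \<in> Op X []" "b \<in> Op X []"
  shows "op_inner X [] a b = (\<Sum>e\<in>basis X. cnj (a (ket X e) []) * b (ket X e) [])"
  unfolding op_inner_def op_trace_def comp_def
proof (rule sum.cong[OF refl])
  fix e assume e: "e \<in> basis X"
  then have k: "ket X e \<in> hilb X" using assms(1) by (simp add: ket_in_hilb basis_length)
  have "hinner X (ket X e) (adjoint X [] a (b (ket X e))) = cnj (hinner X (adjoint X [] a (b (ket X e)))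
      (ket X e))"
    using e assms(1) by (simp add: hinner_ket)
  also have "\<dots> = cnj (hinner [] (b (ket X e)) (a (ket X e)))"
    using adjoint_hinner[OF assms(1) _ assms(2) k Op_hilb[OF assms(3) k]] by simp
  finally show "hinner X (ket X e) (adjoint X [] a (b (ket X e))) = cnj (a (ket X e) []) * b (ket X e)
      []"
    by (simp add: hinner_def)
qed

lemma adjoint_functional_scalar:
  assumes "atom X" "a \<in> Op X []" "e \<in> basis X"
  shows "adjoint X [] a (scalar 1) e = cnj (a (ket X e) [])"
proof -
  have "cnj (adjoint X [] a (scalar 1) e) = hinner X (adjoint X [] a (scalar 1)) (ket X e)"
    using assms by (simp add: hinner_ket)
  also have "\<dots> = hinner [] (scalar 1) (a (ket X e))"
    using assms by (intro adjoint_hinner) (simp_all add: ket_in_hilb basis_length)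
  also have "\<dots> = a (ket X e) []"
    by (simp add: hinner_def scalar_def)
  finally show ?thesis by (metis complex_cnj_cnj)
qed

section \<open>Orthogonal complements in spaces of functions\<close>

global_interpretation fn: vector_space "\<lambda>(c::complex) (K::'i \<Rightarrow> complex) i. c * K i"
  by unfold_locales (simp_all add: fun_eq_iff algebra_simps)

definition supported :: "'i set \<Rightarrow> ('i \<Rightarrow> complex) set" where
  "supported S = {K. \<forall>i. i \<notin> S \<longrightarrow> K i = 0}"

definition dotp :: "'i set \<Rightarrow> ('i \<Rightarrow> complex) \<Rightarrow> ('i \<Rightarrow> complex) \<Rightarrow> complex" where
  "dotp S K L = (\<Sum>i\<in>S. cnj (K i) * L i)"

lemma dotp_form: "complex_form (\<lambda>(c::complex) (K::'i \<Rightarrow> complex) i. c * K i) (dotp S)"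
  by unfold_locales (simp_all add: dotp_def algebra_simps sum.distrib sum_distrib_left)

lemma supported_subspace: "fn.subspace (supported S)"
  by (rule fn.subspaceI) (simp_all add: supported_def)

lemma supported_sum_delta:
  assumes "finite S" "K \<in> supported S"
  shows "K = (\<Sum>i\<in>S. (\<lambda>j. K i * (if j = i then 1 else 0)))"
proof
  fix j
  have "(\<Sum>i\<in>S. (\<lambda>j. K i * (if j = i then 1 else 0))) j = (\<Sum>i\<in>S. K i * (if j = i then 1 else 0))"
    using assms(1) by (induction S rule: finite_induct) simp_all
  also have "\<dots> = (\<Sum>i\<in>S. if i = j then K i else 0)"
    by (intro sum.cong) auto
  also have "\<dots> = K j"
    using assms by (simp add: supported_def)
  finally show "K j = (\<Sum>i\<in>S. (\<lambda>j. K i * (if j = i then 1 else 0))) j" by simp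
qed

lemma supported_eq_span:
  assumes "finite S"
  shows "supported S = fn.span ((\<lambda>i j. if j = i then 1 else 0) ` S)"
proof
  show "supported S \<subseteq> fn.span ((\<lambda>i j. if j = i then 1 else 0) ` S)"
  proof
    fix K :: "'a \<Rightarrow> complex" assume "K \<in> supported S"
    then have "K = (\<Sum>i\<in>S. (\<lambda>j. K i * (if j = i then 1 else 0)))"
      by (rule supported_sum_delta[OF assms])
    also have "\<dots> \<in> fn.span ((\<lambda>i j. if j = i then 1 else 0) ` S)"
      by (intro fn.span_sum fn.span_scale fn.span_base) simp
    finally show "K \<in> fn.span ((\<lambda>i j. if j = i then 1 else 0) ` S)" .
  qed
  show "fn.span ((\<lambda>i j. if j = i then 1 else 0) ` S) \<subseteq> supported S"
    by (rule fn.span_minimal[OF _ supported_subspace]) (auto simp: supported_def)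
qed

lemma dotp_self_pos:
  assumes "finite S" "K \<in> supported S" "K \<noteq> 0"
  shows "Re (dotp S K K) > 0"
proof -
  obtain i where i: "K i \<noteq> 0" using assms(3) by (auto simp: fun_eq_iff)
  then have "i \<in> S" using assms(2) by (auto simp: supported_def)
  have "Re (dotp S K K) = (\<Sum>i\<in>S. (cmod (K i))\<^sup>2)"
    unfolding dotp_def cmod_power2 by (simp add: power2_eq_square)
  also have "\<dots> > 0"
    using assms(1) \<open>i \<in> S\<close> i by (intro sum_pos2[of _ i]) auto
  finally show ?thesis .
qed

lemma dotp_projection:
  assumes "finite S" "M \<subseteq> supported S" "fn.subspace M" "K \<in> supported S"
  obtains P where "P \<in> M" "\<And>L. L \<in> M \<Longrightarrow> dotp S L (K - P) = 0"
proof (rule complex_form.subspace_projection[OF dotp_form])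
  show "finite ((\<lambda>i (j::'a). if j = i then 1 else (0::complex)) ` S)" using assms(1) by simp
  show "M \<subseteq> fn.span ((\<lambda>i j. if j = i then 1 else 0) ` S)"
    using assms(2) supported_eq_span[OF assms(1)] by simp
  show "fn.subspace M" by (rule assms(3))
  show "0 < Re (dotp S L L)" if "L \<in> fn.span ((\<lambda>i j. if j = i then 1 else 0) ` S)" "L \<noteq> 0" for L
    using that dotp_self_pos[OF assms(1)] supported_eq_span[OF assms(1)] by simp
  show "K \<in> fn.span ((\<lambda>i j. if j = i then 1 else 0) ` S)"
    using assms(4) supported_eq_span[OF assms(1)] by simp
qed (use that in blast)

definition ortho :: "'i set \<Rightarrow> ('i \<Rightarrow> complex) set \<Rightarrow> ('i \<Rightarrow> complex) set" where
  "ortho S M = {K \<in> supported S. \<forall>L\<in>M. dotp S L K = 0}"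

lemma dotp_commute: "dotp S K L = cnj (dotp S L K)"
  by (simp add: dotp_def mult.commute)

lemma dotp_eq_0_commute: "dotp S K L = 0 \<longleftrightarrow> dotp S L K = 0"
  using dotp_commute[of S K L] by auto

lemma dotp_add_right: "dotp S K (L + M) = dotp S K L + dotp S K M"
  by (rule complex_form.form_add_right[OF dotp_form])

lemma dotp_diff_right: "dotp S K (L - M) = dotp S K L - dotp S K M"
  by (rule complex_form.form_diff_right[OF dotp_form])

lemma dotp_scale_right: "dotp S K (\<lambda>i. c * L i) = c * dotp S K L"
  by (rule complex_form.form_scale_right[OF dotp_form])

lemma dotp_zero_right [simp]: "dotp S K 0 = 0"
  by (rule complex_form.form_zero_right[OF dotp_form])

lemma ortho_subspace: "fn.subspace (ortho S M)"
  by (rule fn.subspaceI)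
    (simp_all add: ortho_def dotp_add_right dotp_scale_right
      fn.subspace_0[OF supported_subspace] fn.subspace_add[OF supported_subspace]
      fn.subspace_scale[OF supported_subspace])

lemma ortho_span: "ortho S (fn.span M) = ortho S M"
proof
  show "ortho S (fn.span M) \<subseteq> ortho S M" by (auto simp: ortho_def intro: fn.span_base)
  show "ortho S M \<subseteq> ortho S (fn.span M)"
    using complex_form.form_span_left_eq_0[OF dotp_form, of M S] by (auto simp: ortho_def)
qed

text \<open>
  The difference between an element of the double complement and its projection to \<open>M\<close> is orthogonal
  to itself; the projection exists because \<open>S\<close> is finite.
\<close>

lemma ortho_ortho:
  assumes "finite S" "M \<subseteq> supported S" "fn.subspace M"
  shows "ortho S (ortho S M) = M"
proof
  show "M \<subseteq> ortho S (ortho S M)"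
    using assms(2) dotp_eq_0_commute[of S] unfolding ortho_def by blast
  show "ortho S (ortho S M) \<subseteq> M"
  proof
    fix K assume K: "K \<in> ortho S (ortho S M)"
    then have "K \<in> supported S" by (simp add: ortho_def)
    then obtain P where P: "P \<in> M" "\<And>L. L \<in> M \<Longrightarrow> dotp S L (K - P) = 0"
      using dotp_projection[OF assms] by blast
    have KP: "K - P \<in> supported S"
      using \<open>K \<in> supported S\<close> P(1) assms(2) by (intro fn.subspace_diff[OF supported_subspace]) auto
    then have "K - P \<in> ortho S M" using P(2) by (simp add: ortho_def)
    then have "dotp S (K - P) K = 0" using K unfolding ortho_def by blast
    moreover have "dotp S (K - P) P = 0"
      using P dotp_eq_0_commute by blast
    ultimately have "dotp S (K - P) (K - P) = 0" by (simp add: dotp_diff_right)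
    then have "K - P = 0" using dotp_self_pos[OF assms(1) KP] by force
    then show "K \<in> M" using P(1) by simp
  qed
qed

section \<open>Tuples of basis labels and permutations\<close>

definition perm_list :: "nat list \<Rightarrow> nat \<Rightarrow> bool" where
  "perm_list \<pi> n \<longleftrightarrow> distinct \<pi> \<and> set \<pi> = {..<n}"

abbreviation permute :: "nat list \<Rightarrow> 'b list \<Rightarrow> 'b list" where
  "permute \<pi> xs \<equiv> map ((!) xs) \<pi>"

lemma perm_list_length: "perm_list \<pi> n \<Longrightarrow> length \<pi> = n"
  unfolding perm_list_def by (metis card_lessThan distinct_card)

lemma perm_list_nth: "perm_list \<pi> n \<Longrightarrow> i < n \<Longrightarrow> \<pi> ! i < n"
  using perm_list_length[of \<pi> n] nth_mem[of i \<pi>] by (auto simp: perm_list_def)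

lemma perm_list_inv:
  assumes "perm_list \<pi> n" "j < n"
  obtains i where "i < n" "\<pi> ! i = j"
proof -
  have "j \<in> set \<pi>" using assms by (simp add: perm_list_def)
  then show thesis using that perm_list_length[OF assms(1)] by (metis in_set_conv_nth)
qed

lemma permute_inject:
  assumes "perm_list \<pi> n" "length xs = n" "length ys = n" "permute \<pi> xs = permute \<pi> ys"
  shows "xs = ys"
proof (rule nth_equalityI)
  fix j assume "j < length xs"
  then have "j \<in> set \<pi>" using assms(1,2) by (simp add: perm_list_def)
  with assms(4) show "xs ! j = ys ! j" by simp
qed (use assms in simp)

lemma permute_surj:
  assumes "perm_list \<pi> n" "length zs = n"
  obtains xs where "length xs = n" "permute \<pi> xs = zs"
proof
  define xs where "xs = map (\<lambda>j. zs ! (THE i. i < n \<and> \<pi> ! i = j)) [0..<n]"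
  show "length xs = n" by (simp add: xs_def)
  show "permute \<pi> xs = zs"
  proof (rule nth_equalityI)
    fix i assume "i < length (permute \<pi> xs)"
    then have i: "i < n" using perm_list_length[OF assms(1)] by simp
    have "(THE k. k < n \<and> \<pi> ! k = \<pi> ! i) = i"
    proof (rule the_equality)
      show "k = i" if "k < n \<and> \<pi> ! k = \<pi> ! i" for k
        using that i assms(1) perm_list_length[OF assms(1)] nth_eq_iff_index_eq[of \<pi> k i]
        by (simp add: perm_list_def)
    qed (use i in simp)
    then show "permute \<pi> xs ! i = zs ! i"
      using i perm_list_length[OF assms(1)] perm_list_nth[OF assms(1) i] by (simp add: xs_def)
  qed (use assms perm_list_length in auto)
qed

text \<open>
  A label of the product basis of \<open>X\<^sub>1 \<otimes> \<dots> \<otimes> X\<^sub>n\<close> is kept as a list of \<open>n\<close> blocks, one for every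
  member of the tuple.  The blocks have the lengths of the words \<open>X\<^sub>i\<close>, so concatenation loses
  nothing, and permuting tensor factors is permuting blocks.
\<close>

definition idx :: "'v::complex_inner atom list \<Rightarrow> 'v list list set" where
  "idx Xs = listset (map basis Xs)"

lemma idx_Nil [simp]: "idx [] = {[]}"
  by (simp add: idx_def)

lemma idx_Cons: "e # es \<in> idx (X # Xs) \<longleftrightarrow> e \<in> basis X \<and> es \<in> idx Xs"
  by (simp add: idx_def listset_Cons del: listset.simps)

lemma idx_ConsE:
  assumes "es \<in> idx (X # Xs)"
  obtains e es' where "es = e # es'" "e \<in> basis X" "es' \<in> idx Xs"
  using assms by (auto simp: idx_def set_Cons_def)

lemma idx_length: "es \<in> idx Xs \<Longrightarrow> length es = length Xs"
  by (auto simp: idx_def dest: listset_length)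

lemma idx_append:
  "length es = length Xs \<Longrightarrow> es @ fs \<in> idx (Xs @ Ys) \<longleftrightarrow> es \<in> idx Xs \<and> fs \<in> idx Ys"
  by (simp add: idx_def listset_append)

lemma idx_append_right:
  "length fs = length Ys \<Longrightarrow> es @ fs \<in> idx (Xs @ Ys) \<longleftrightarrow> es \<in> idx Xs \<and> fs \<in> idx Ys"
  using idx_length[of "es @ fs" "Xs @ Ys"] idx_append[of es Xs fs Ys] by (auto dest: idx_length)

lemma idx_appendE:
  assumes "es \<in> idx (Xs @ Ys)"
  obtains ds fs where "es = ds @ fs" "ds \<in> idx Xs" "fs \<in> idx Ys"
  using assms by (auto simp: idx_def elim: listset_appendE)

lemma idx_nth: "es \<in> idx Xs \<longleftrightarrow> length es = length Xs \<and> (\<forall>i<length Xs. es ! i \<in> basis (Xs ! i))"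
  by (auto simp: idx_def listset_iff list_all2_conv_all_nth)

lemma idx_permute:
  assumes "perm_list \<pi> n" "length Xs = n" "length es = n"
  shows "permute \<pi> es \<in> idx (permute \<pi> Xs) \<longleftrightarrow> es \<in> idx Xs"
proof -
  have "(\<forall>i<n. es ! (\<pi> ! i) \<in> basis (Xs ! (\<pi> ! i))) \<longleftrightarrow> (\<forall>j<n. es ! j \<in> basis (Xs ! j))"
    using perm_list_nth[OF assms(1)] perm_list_inv[OF assms(1)] by metis
  then show ?thesis using assms perm_list_length[OF assms(1)] by (simp add: idx_nth)
qed

lemma finite_idx: "(\<And>X. X \<in> set Xs \<Longrightarrow> atom X) \<Longrightarrow> finite (idx Xs)"
  unfolding idx_def by (rule finite_listset) (auto simp: finite_basis)

lemma idx_nonempty: "(\<And>X. X \<in> set Xs \<Longrightarrow> atom X) \<Longrightarrow> idx Xs \<noteq> {}"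
  unfolding idx_def by (rule listset_nonempty) (auto simp: basis_nonempty)

lemma sum_idx_Cons: "(\<Sum>es\<in>idx (X # Xs). f es) = (\<Sum>e\<in>basis X. \<Sum>es\<in>idx Xs. f (e # es))"
  by (simp add: idx_def sum_listset_Cons del: listset.simps)

lemma concat_idx: "es \<in> idx Xs \<Longrightarrow> concat es \<in> basis (concat Xs)"
  by (induction Xs arbitrary: es) (auto elim!: idx_ConsE simp: basis_append basis_length)

lemma concat_idxE:
  assumes "e \<in> basis (concat Xs)"
  obtains es where "e = concat es" "es \<in> idx Xs"
  using assms
proof (induction Xs arbitrary: e thesis)
  case Nil
  then show ?case by (metis basis_Nil concat.simps(1) idx_Nil singletonD singletonI)
next
  case (Cons X Xs)
  from Cons.prems(2) obtain e1 e2 where e: "e = e1 @ e2" "e1 \<in> basis X" "e2 \<in> basis (concat Xs)"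
    by (auto elim: basis_appendE)
  from Cons.IH[OF _ e(3)] obtain es where "e2 = concat es" "es \<in> idx Xs" by blast
  then show ?case using e Cons.prems(1)[of "e1 # es"] by (simp add: idx_Cons)
qed

lemma concat_idx_inject: "es \<in> idx Xs \<Longrightarrow> fs \<in> idx Xs \<Longrightarrow> concat es = concat fs \<Longrightarrow> es = fs"
  by (induction Xs arbitrary: es fs) (auto elim!: idx_ConsE simp: basis_length)

lemma concat_idx_bij: "bij_betw concat (idx Xs) (basis (concat Xs))"
  unfolding bij_betw_def inj_on_def
  using concat_idx_inject by (auto simp: concat_idx elim: concat_idxE)

lemma sum_basis_concat: "(\<Sum>e\<in>basis (concat Xs). f e) = (\<Sum>es\<in>idx Xs. f (concat es))"
  by (rule sum.reindex_bij_betw[OF concat_idx_bij, symmetric])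

lemma vtensors_concat:
  "es \<in> idx Xs \<Longrightarrow> length fs = length Xs \<Longrightarrow> vtensors Xs fs (concat es) = (\<Prod>i<length Xs. (fs ! i) (es ! i))"
proof (induction Xs arbitrary: es fs)
  case Nil
  then show ?case by (simp add: scalar_def)
next
  case (Cons X Xs)
  then obtain f fs' where "fs = f # fs'" by (cases fs) auto
  with Cons show ?case
    by (auto elim!: idx_ConsE simp: vtensor_append basis_length prod.lessThan_Suc_shift comp_def
        simp del: prod.lessThan_Suc)
qed

lemma vtensors_hilb: "list_all2 (\<lambda>f X. f \<in> hilb X) fs Xs \<Longrightarrow> vtensors Xs fs \<in> hilb (concat Xs)"
  by (induction fs Xs rule: list_all2_induct) (simp_all add: vtensor_in_hilb)

lemma vtensors_ket:
  assumes "\<And>X. X \<in> set Xs \<Longrightarrow> atom X" "es \<in> idx Xs"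
  shows "vtensors Xs (map2 ket Xs es) = ket (concat Xs) (concat es)"
  using assms
proof (induction Xs arbitrary: es)
  case Nil
  then show ?case by (simp add: ket_Nil_scalar)
next
  case (Cons X Xs)
  then show ?case
    by (auto elim!: idx_ConsE simp: vtensor_ket concat_idx atom_concat)
qed

text \<open>
  On basis vectors \<open>u\<^sub>\<pi>\<close> permutes the blocks of the label.  The operator defined in this way
  permutes the factors of every elementary tensor: both sides are compared at each basis label.
\<close>

lemma
  assumes at: "\<And>X. X \<in> set Xs \<Longrightarrow> atom X" and \<pi>: "perm_list \<pi> (length Xs)"
  shows op_perm_Op: "op_perm \<pi> Xs \<in> Op (concat Xs) (concat (permute \<pi> Xs))"
    and op_perm_ket: "\<And>es. es \<in> idx Xs \<Longrightarrow>
      op_perm \<pi> Xs (ket (concat Xs) (concat es)) = ket (concat (permute \<pi> Xs)) (concat (permute \<pi> es))"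
proof -
  let ?X = "concat Xs" and ?Y = "concat (permute \<pi> Xs)"
  have atX: "atom ?X" using at by (simp add: atom_concat)
  have set: "set (permute \<pi> Xs) \<subseteq> set Xs" using \<pi> by (simp add: perm_list_def image_subset_iff)
  then have at': "\<And>X. X \<in> set (permute \<pi> Xs) \<Longrightarrow> atom X" using at by blast
  then have atY: "atom ?Y" by (simp only: atom_concat) blast
  define u where "u = op_ext ?X (\<lambda>d. ket ?Y (concat (permute \<pi> (inv_into (idx Xs) concat d))))"
  have bij: "bij_betw ((!) \<pi>) {..<length Xs} {..<length Xs}"
    by (rule bij_betw_nth) (use \<pi> perm_list_length[OF \<pi>] in \<open>simp_all add: perm_list_def\<close>)
  have inv: "inv_into (idx Xs) concat (concat es) = es" if "es \<in> idx Xs" for es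
    using that concat_idx_bij by (intro inv_into_f_f) (auto simp: bij_betw_def)
  have perm: "permute \<pi> es \<in> idx (permute \<pi> Xs)" if "es \<in> idx Xs" for es
    using that idx_permute[OF \<pi> refl] idx_length by blast
  have ukets: "ket ?Y (concat (permute \<pi> es)) \<in> hilb ?Y" if "es \<in> idx Xs" for es
    using concat_idx[OF perm[OF that]] atY by (intro ket_in_hilb basis_length)
  have u: "u \<in> Op ?X ?Y"
    unfolding u_def by (rule op_ext_Op) (metis concat_idxE inv ukets)
  have uket: "u (ket ?X (concat es)) = ket ?Y (concat (permute \<pi> es))" if "es \<in> idx Xs" for es
    using that atX concat_idx[OF that] by (simp add: u_def op_ext_ket inv)
  have ut: "u (vtensors Xs fs) = vtensors (permute \<pi> Xs) (permute \<pi> fs)"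
    if fs: "list_all2 (\<lambda>f X. f \<in> hilb X) fs Xs" for fs
  proof (rule hilb_eqI[OF atY])
    have len: "length fs = length Xs" using fs by (rule list_all2_lengthD)
    show "u (vtensors Xs fs) \<in> hilb ?Y" by (intro Op_hilb[OF u] vtensors_hilb fs)
    have "list_all2 (\<lambda>f X. f \<in> hilb X) (permute \<pi> fs) (permute \<pi> Xs)"
      using fs \<pi> perm_list_nth[OF \<pi>] perm_list_length[OF \<pi>] by (auto simp: list_all2_conv_all_nth)
    then show "vtensors (permute \<pi> Xs) (permute \<pi> fs) \<in> hilb ?Y" by (rule vtensors_hilb)
    fix e' assume "e' \<in> basis ?Y"
    then obtain es' where es': "e' = concat es'" "es' \<in> idx (permute \<pi> Xs)" by (rule concat_idxE)
    then have "length es' = length Xs" using idx_length perm_list_length[OF \<pi>] by fastforce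
    then obtain es where es: "length es = length Xs" "permute \<pi> es = es'" by (rule permute_surj[OF \<pi>])
    then have esi: "es \<in> idx Xs" using es' idx_permute[OF \<pi> refl] by metis
    have "u (vtensors Xs fs) e' = (\<Sum>ds\<in>idx Xs. vtensors Xs fs (concat ds) *
        ket ?Y (concat (permute \<pi> (inv_into (idx Xs) concat (concat ds)))) e')"
      using vtensors_hilb[OF fs] by (simp add: u_def op_ext_def sum_basis_concat)
    also have "\<dots> = (\<Sum>ds\<in>idx Xs. if ds = es then vtensors Xs fs (concat ds) else 0)"
    proof (rule sum.cong[OF refl])
      fix ds assume ds: "ds \<in> idx Xs"
      have "concat (permute \<pi> ds) = e' \<longleftrightarrow> permute \<pi> ds = es'"
        using concat_idx_inject[OF perm[OF ds] es'(2)] es'(1) by auto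
      also have "\<dots> \<longleftrightarrow> ds = es"
        using permute_inject[OF \<pi> idx_length[OF ds] es(1)] es(2) by auto
      finally have "ket ?Y (concat (permute \<pi> ds)) e' = (if ds = es then 1 else 0)"
        using ket_basis[OF atY concat_idx[OF perm[OF ds]] concat_idx[OF es'(2)]] es'(1) by simp
      then show "vtensors Xs fs (concat ds) * ket ?Y (concat (permute \<pi> (inv_into (idx Xs) concat
          (concat ds)))) e'
          = (if ds = es then vtensors Xs fs (concat ds) else 0)"
        using inv[OF ds] by simp
    qed
    also have "\<dots> = vtensors Xs fs (concat es)"
      using esi finite_idx[OF at] by simp
    also have "\<dots> = (\<Prod>i<length Xs. (fs ! i) (es ! i))"
      using esi len by (rule vtensors_concat)
    also have "\<dots> = (\<Prod>i<length Xs. (fs ! (\<pi> ! i)) (es ! (\<pi> ! i)))"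
      by (rule prod.reindex_bij_betw[OF bij, symmetric])
    also have "\<dots> = vtensors (permute \<pi> Xs) (permute \<pi> fs) (concat es')"
      using es'(2) perm_list_length[OF \<pi>] by (subst vtensors_concat) (simp_all flip: es(2))
    finally show "u (vtensors Xs fs) e' = vtensors (permute \<pi> Xs) (permute \<pi> fs) e'"
      by (simp add: es'(1))
  qed
  have uniq: "v = u" if v: "v \<in> Op ?X ?Y"
    "\<And>fs. list_all2 (\<lambda>f X. f \<in> hilb X) fs Xs \<Longrightarrow> v (vtensors Xs fs) = vtensors (permute \<pi> Xs) (permute \<pi>
        fs)" for v
  proof (rule Op_eqI[OF atX v(1) u])
    fix e assume "e \<in> basis ?X"
    then obtain es where es: "e = concat es" "es \<in> idx Xs" by (rule concat_idxE)
    have *: "list_all2 (\<lambda>f X. f \<in> hilb X) (map2 ket Xs es) Xs"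
      using es(2) at by (auto simp: idx_nth list_all2_conv_all_nth intro!: ket_in_hilb basis_length)
    show "v (ket ?X e) = u (ket ?X e)"
      using v(2)[OF *] ut[OF *] by (simp add: es vtensors_ket[OF at])
  qed
  have "op_perm \<pi> Xs = u"
    unfolding op_perm_def by (rule the_equality, use u ut in blast, rule uniq, blast, blast)
  with u uket show "op_perm \<pi> Xs \<in> Op ?X ?Y"
    "\<And>es. es \<in> idx Xs \<Longrightarrow> op_perm \<pi> Xs (ket ?X (concat es)) = ket ?Y (concat (permute \<pi> es))"
    by simp_all
qed

section \<open>Coordinates of relations\<close>

text \<open>
  The coordinates of a functional on \<open>X\<^sub>1 \<otimes> \<dots> \<otimes> X\<^sub>n\<close> are its values on the product basis.  Passing to
  coordinates is a linear bijection onto the functions supported on \<open>idx Xs\<close>, and \<open>amps R Xs\<close> is the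
  image of the component of \<open>R\<close>.  Everything about relations into \<open>\<one>\<close> can be read off from it.
\<close>

definition coord :: "'v::complex_inner atom list \<Rightarrow> 'v oper \<Rightarrow> 'v list list \<Rightarrow> complex" where
  "coord Xs a = (\<lambda>es. if es \<in> idx Xs then a (ket (concat Xs) (concat es)) [] else 0)"

definition amps :: "'v::complex_inner brel \<Rightarrow> 'v atom list \<Rightarrow> ('v list list \<Rightarrow> complex) set" where
  "amps R Xs = coord Xs ` comps R Xs []"

lemma coord_supported: "coord Xs a \<in> supported (idx Xs)"
  by (simp add: coord_def supported_def)

lemma coord_add: "coord Xs (a + b) = coord Xs a + coord Xs b"
  and coord_scale: "coord Xs (\<lambda>f u. c * a f u) = (\<lambda>es. c * coord Xs a es)"
  and coord_zero: "coord Xs 0 = 0"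
  by (simp_all add: coord_def fun_eq_iff)

lemma coord_linear:
  "module_hom (\<lambda>(c::complex) (a::'v::complex_inner oper) f u. c * a f u) (\<lambda>c K es. c * K es) (coord Xs)"
  by unfold_locales (rule coord_add coord_scale)+

lemma coord_span: "coord Xs ` op.span A = fn.span (coord Xs ` A)"
  by (rule module_hom.span_image[OF coord_linear, symmetric])

lemma coord_subspace: "op.subspace A \<Longrightarrow> fn.subspace (coord Xs ` A)"
  by (rule module_hom.subspace_image[OF coord_linear])

lemma concat_atoms: "(\<And>X. X \<in> set Xs \<Longrightarrow> atom X) \<Longrightarrow> atom (concat Xs)"
  by (simp add: atom_concat)

lemma coord_inject:
  assumes "\<And>X. X \<in> set Xs \<Longrightarrow> atom X" "a \<in> Op (concat Xs) []" "b \<in> Op (concat Xs) []"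
    and "coord Xs a = coord Xs b"
  shows "a = b"
proof (rule Op_eqI[OF concat_atoms assms(2,3)])
  fix e assume "e \<in> basis (concat Xs)"
  then obtain es where es: "e = concat es" "es \<in> idx Xs" by (rule concat_idxE)
  then have k: "ket (concat Xs) e \<in> hilb (concat Xs)"
    using assms(1) concat_idx by (intro ket_in_hilb concat_atoms basis_length) auto
  have "a (ket (concat Xs) e) [] = b (ket (concat Xs) e) []"
    using fun_cong[OF assms(4), of es] es by (simp add: coord_def)
  then show "a (ket (concat Xs) e) = b (ket (concat Xs) e)"
    using hilb_Nil_eq[OF Op_hilb[OF assms(2) k]] hilb_Nil_eq[OF Op_hilb[OF assms(3) k]] by simp
qed (rule assms(1))

lemma coord_surj:
  assumes "\<And>X. X \<in> set Xs \<Longrightarrow> atom X" "K \<in> supported (idx Xs)"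
  obtains a where "a \<in> Op (concat Xs) []" "coord Xs a = K"
proof
  define a where "a = op_ext (concat Xs) (\<lambda>e. scalar (K (inv_into (idx Xs) concat e)))"
  show "a \<in> Op (concat Xs) []" unfolding a_def by (rule op_ext_Op) simp
  show "coord Xs a = K"
  proof
    fix es show "coord Xs a es = K es"
    proof (cases "es \<in> idx Xs")
      case True
      then have "inv_into (idx Xs) concat (concat es) = es"
        using concat_idx_bij[of Xs] by (intro inv_into_f_f) (auto simp: bij_betw_def)
      then show ?thesis
        using True by (simp add: coord_def a_def op_ext_ket concat_atoms assms(1) concat_idx scalar_def)
    next
      case False
      then show ?thesis using assms(2) by (simp add: coord_def supported_def)
    qed
  qed
qed

lemma op_inner_coord:
  assumes "\<And>X. X \<in> set Xs \<Longrightarrow> atom X" "a \<in> Op (concat Xs) []" "b \<in> Op (concat Xs) []"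
  shows "op_inner (concat Xs) [] a b = dotp (idx Xs) (coord Xs a) (coord Xs b)"
proof -
  have "op_inner (concat Xs) [] a b =
      (\<Sum>e\<in>basis (concat Xs). cnj (a (ket (concat Xs) e) []) * b (ket (concat Xs) e) [])"
    using assms by (intro op_inner_functional concat_atoms)
  then show ?thesis by (simp add: dotp_def sum_basis_concat coord_def)
qed

lemma comps_mk_rel:
  "comps (mk_rel \<X>s \<Y>s C) Xs Ys = (if Xs \<in> listset \<X>s \<and> Ys \<in> listset \<Y>s then C Xs Ys else {0})"
  and rdom_mk_rel [simp]: "rdom (mk_rel \<X>s \<Y>s C) = \<X>s"
  and rcod_mk_rel [simp]: "rcod (mk_rel \<X>s \<Y>s C) = \<Y>s"
  by (simp_all add: mk_rel_def)

lemma binary_relation_mk_rel: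
  assumes "\<And>\<X>. \<X> \<in> set \<X>s \<Longrightarrow> qset \<X>" "\<And>\<Y>. \<Y> \<in> set \<Y>s \<Longrightarrow> qset \<Y>"
    and "\<And>Xs Ys. Xs \<in> listset \<X>s \<Longrightarrow> Ys \<in> listset \<Y>s \<Longrightarrow> op.subspace (C Xs Ys)"
    and "\<And>Xs Ys a. Xs \<in> listset \<X>s \<Longrightarrow> Ys \<in> listset \<Y>s \<Longrightarrow> a \<in> C Xs Ys \<Longrightarrow> a \<in> Op (concat Xs) (concat Ys)"
  shows "binary_relation (mk_rel \<X>s \<Y>s C)"
  using assms by (auto simp: binary_relation_def comps_mk_rel)

lemma qsets_atoms:
  assumes "Xs \<in> listset \<X>s" "\<And>\<X>. \<X> \<in> set \<X>s \<Longrightarrow> qset \<X>" "X \<in> set Xs"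
  shows "atom X"
proof -
  have "list_all2 (\<in>) Xs \<X>s" using assms(1) by (simp add: listset_iff)
  with assms(3) obtain \<X> where "\<X> \<in> set \<X>s" "X \<in> \<X>"
    by (metis in_set_conv_nth list_all2_conv_all_nth)
  with assms(2) show ?thesis by (auto simp: qset_def)
qed

lemma
  assumes "binary_relation R"
  shows binary_relation_subspace: "op.subspace (comps R Xs Ys)"
    and binary_relation_Op: "Xs \<in> listset (rdom R) \<Longrightarrow> Ys \<in> listset (rcod R) \<Longrightarrow> a \<in> comps R Xs Ys \<Longrightarrow>
      a \<in> Op (concat Xs) (concat Ys)"
    and binary_relation_off: "Xs \<notin> listset (rdom R) \<or> Ys \<notin> listset (rcod R) \<Longrightarrow> comps R Xs Ys = {0}"
    and binary_relation_dom: "\<X> \<in> set (rdom R) \<Longrightarrow> qset \<X>"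
    and binary_relation_cod: "\<X> \<in> set (rcod R) \<Longrightarrow> qset \<X>"
proof -
  show "op.subspace (comps R Xs Ys)"
    using assms op.subspace_single_0
    by (cases "Xs \<in> listset (rdom R) \<and> Ys \<in> listset (rcod R)") (auto simp: binary_relation_def)
qed (use assms in \<open>auto simp: binary_relation_def\<close>)

lemma
  assumes "relation_of_arity R \<X>s"
  shows relation_subspace: "op.subspace (comps R Xs [])"
    and relation_Op: "Xs \<in> listset \<X>s \<Longrightarrow> a \<in> comps R Xs [] \<Longrightarrow> a \<in> Op (concat Xs) []"
    and relation_qset: "\<X> \<in> set \<X>s \<Longrightarrow> qset \<X>"
    and relation_atom: "Xs \<in> listset \<X>s \<Longrightarrow> X \<in> set Xs \<Longrightarrow> atom X"
    and relation_rdom: "rdom R = \<X>s" and relation_rcod: "rcod R = []"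
    and amps_subspace: "fn.subspace (amps R Xs)"
    and amps_supported: "amps R Xs \<subseteq> supported (idx Xs)"
proof -
  have R: "binary_relation R" "rdom R = \<X>s" "rcod R = []"
    using assms by (simp_all add: relation_of_arity_def)
  show "op.subspace (comps R Xs [])" by (rule binary_relation_subspace[OF R(1)])
  then show "fn.subspace (amps R Xs)" unfolding amps_def by (rule coord_subspace)
  show "Xs \<in> listset \<X>s \<Longrightarrow> a \<in> comps R Xs [] \<Longrightarrow> a \<in> Op (concat Xs) []"
    using binary_relation_Op[OF R(1), of Xs "[]" a] R(2,3) by simp
  show "\<X> \<in> set \<X>s \<Longrightarrow> qset \<X>" for \<X>
    using binary_relation_dom[OF R(1)] R(2) by simp
  then show "Xs \<in> listset \<X>s \<Longrightarrow> X \<in> set Xs \<Longrightarrow> atom X"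
    using qsets_atoms by blast
  show "amps R Xs \<subseteq> supported (idx Xs)" by (auto simp: amps_def coord_supported)
qed (use assms in \<open>simp_all add: relation_of_arity_def\<close>)

lemma amps_iff:
  assumes "relation_of_arity R \<X>s" "Xs \<in> listset \<X>s" "a \<in> Op (concat Xs) []"
  shows "coord Xs a \<in> amps R Xs \<longleftrightarrow> a \<in> comps R Xs []"
proof
  assume "coord Xs a \<in> amps R Xs"
  then obtain b where b: "coord Xs a = coord Xs b" "b \<in> comps R Xs []"
    unfolding amps_def by (rule imageE)
  have "a = b"
    by (rule coord_inject[OF relation_atom[OF assms(1,2)] assms(3) relation_Op[OF assms(1,2) b(2)]
        b(1)])
  then show "a \<in> comps R Xs []" using b(2) by simp
qed (simp add: amps_def)

lemma relation_of_arity_eqI: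
  assumes "relation_of_arity R \<X>s" "relation_of_arity S \<X>s"
    and "\<And>Xs. Xs \<in> listset \<X>s \<Longrightarrow> amps R Xs = amps S Xs"
  shows "R = S"
proof (rule brel.expand, intro conjI)
  note R = assms(1)[unfolded relation_of_arity_def] and S = assms(2)[unfolded relation_of_arity_def]
  show "rdom R = rdom S" "rcod R = rcod S" using R S by simp_all
  show "comps R = comps S"
  proof (intro ext)
    fix Xs Ys
    show "comps R Xs Ys = comps S Xs Ys"
    proof (cases "Xs \<in> listset \<X>s \<and> Ys = []")
      case True
      then have "amps R Xs = amps S Xs" using assms(3) by blast
      moreover have "a \<in> comps R Xs [] \<longleftrightarrow> a \<in> Op (concat Xs) [] \<and> coord Xs a \<in> amps R Xs"
        "a \<in> comps S Xs [] \<longleftrightarrow> a \<in> Op (concat Xs) [] \<and> coord Xs a \<in> amps S Xs" for a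
        using True amps_iff[OF assms(1)] amps_iff[OF assms(2)] relation_Op[OF assms(1)] relation_Op[OF
            assms(2)]
        by blast+
      ultimately show ?thesis using True by blast
    next
      case False
      then show ?thesis using R S by (auto simp: binary_relation_off)
    qed
  qed
qed

definition ktensor :: "nat \<Rightarrow> ('a list \<Rightarrow> complex) \<Rightarrow> ('a list \<Rightarrow> complex) \<Rightarrow> 'a list \<Rightarrow> complex" where
  "ktensor n K L = (\<lambda>es. K (take n es) * L (drop n es))"

lemma ktensor_add_right: "ktensor n K (L + L') = ktensor n K L + ktensor n K L'"
  and ktensor_scale_right: "ktensor n K (\<lambda>i. c * L i) = (\<lambda>i. c * ktensor n K L i)"
  and ktensor_zero_right: "ktensor n K 0 = 0"
  by (simp_all add: ktensor_def fun_eq_iff algebra_simps)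

lemma coord_op_tensor:
  assumes "\<And>X. X \<in> set Xs \<Longrightarrow> atom X" "\<And>X. X \<in> set Ys \<Longrightarrow> atom X"
    and "a \<in> Op (concat Xs) []" "b \<in> Op (concat Ys) []"
  shows "coord (Xs @ Ys) (op_tensor (concat Xs) [] (concat Ys) [] a b) =
    ktensor (length Xs) (coord Xs a) (coord Ys b)"
proof
  fix zs
  show "coord (Xs @ Ys) (op_tensor (concat Xs) [] (concat Ys) [] a b) zs =
    ktensor (length Xs) (coord Xs a) (coord Ys b) zs"
  proof (cases "zs \<in> idx (Xs @ Ys)")
    case True
    then obtain es fs where zs: "zs = es @ fs" "es \<in> idx Xs" "fs \<in> idx Ys" by (rule idx_appendE)
    show ?thesis
      using True zs idx_length[OF zs(2)]
        op_tensor_ket[OF concat_atoms[OF assms(1)] concat_atoms[OF assms(2)] assms(3,4)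
          concat_idx[OF zs(2)] concat_idx[OF zs(3)]]
      by (simp add: coord_def ktensor_def vtensor_def)
  next
    case False
    then have "\<not> (take (length Xs) zs \<in> idx Xs \<and> drop (length Xs) zs \<in> idx Ys)"
      using idx_append[of "take (length Xs) zs" Xs "drop (length Xs) zs" Ys] idx_length
      by (metis append_take_drop_id)
    then show ?thesis using False by (auto simp: coord_def ktensor_def)
  qed
qed

lemma binary_relation_times:
  assumes "binary_relation R" "binary_relation S"
  shows "binary_relation (rel_times R S)"
  unfolding rel_times_def Let_def
proof (rule binary_relation_mk_rel)
  fix Xs Ys
  assume Xs: "Xs \<in> listset (rdom R @ rdom S)" and Ys: "Ys \<in> listset (rcod R @ rcod S)"
  obtain X X' where X: "Xs = X @ X'" "X \<in> listset (rdom R)" "X' \<in> listset (rdom S)"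
    using Xs by (rule listset_appendE)
  obtain Y Y' where Y: "Ys = Y @ Y'" "Y \<in> listset (rcod R)" "Y' \<in> listset (rcod S)"
    using Ys by (rule listset_appendE)
  let ?G = "{op_tensor (concat (take (length (rdom R)) Xs)) (concat (take (length (rcod R)) Ys))
          (concat (drop (length (rdom R)) Xs)) (concat (drop (length (rcod R)) Ys)) r s |r s.
         r \<in> comps R (take (length (rdom R)) Xs) (take (length (rcod R)) Ys) \<and>
         s \<in> comps S (drop (length (rdom R)) Xs) (drop (length (rcod R)) Ys)}"
  have "?G \<subseteq> Op (concat Xs) (concat Ys)"
  proof
    fix t assume "t \<in> ?G"
    then obtain r s where t: "t = op_tensor (concat X) (concat Y) (concat X') (concat Y') r s"
      "r \<in> comps R X Y" "s \<in> comps S X' Y'"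
      using X Y listset_length[OF X(2)] listset_length[OF Y(2)] by auto
    have "atom (concat X)" "atom (concat X')"
      using qsets_atoms[OF X(2) binary_relation_dom[OF assms(1)]]
        qsets_atoms[OF X(3) binary_relation_dom[OF assms(2)]] by (simp_all add: concat_atoms)
    moreover have "r \<in> Op (concat X) (concat Y)" "s \<in> Op (concat X') (concat Y')"
      using t X Y binary_relation_Op[OF assms(1)] binary_relation_Op[OF assms(2)] by blast+
    ultimately show "t \<in> Op (concat Xs) (concat Ys)"
      using t(1) X(1) Y(1) op_tensor_Op by simp
  qed
  then have "op.span ?G \<subseteq> Op (concat Xs) (concat Ys)" by (rule op.span_minimal[OF _ Op_subspace])
  then show "a \<in> op.span ?G \<Longrightarrow> a \<in> Op (concat Xs) (concat Ys)" for a by blast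
qed (use binary_relation_dom[OF assms(1)] binary_relation_dom[OF assms(2)]
      binary_relation_cod[OF assms(1)] binary_relation_cod[OF assms(2)] in auto)

lemma relation_times:
  "relation_of_arity R \<X>s \<Longrightarrow> relation_of_arity S \<Y>s \<Longrightarrow> relation_of_arity (rel_times R S) (\<X>s @ \<Y>s)"
  using binary_relation_times[of R S] by (auto simp: relation_of_arity_def rel_times_def)

lemma comps_times:
  assumes "relation_of_arity R \<X>s" "relation_of_arity S \<Y>s" "Xs \<in> listset \<X>s" "Ys \<in> listset \<Y>s"
  shows "comps (rel_times R S) (Xs @ Ys) [] =
    op.span {op_tensor (concat Xs) [] (concat Ys) [] r s | r s. r \<in> comps R Xs [] \<and> s \<in> comps S Ys []}"
proof -
  have "Xs @ Ys \<in> listset (\<X>s @ \<Y>s)" "length Xs = length \<X>s"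
    using assms(3,4) by (simp_all add: listset_length listset_append)
  then show ?thesis
    using relation_rdom[OF assms(1)] relation_rdom[OF assms(2)] relation_rcod[OF assms(1)]
        relation_rcod[OF assms(2)]
    by (simp add: rel_times_def comps_mk_rel Let_def)
qed

lemma amps_times:
  assumes "relation_of_arity R \<X>s" "relation_of_arity S \<Y>s" "Xs \<in> listset \<X>s" "Ys \<in> listset \<Y>s"
  shows "amps (rel_times R S) (Xs @ Ys) =
    fn.span {ktensor (length Xs) K L | K L. K \<in> amps R Xs \<and> L \<in> amps S Ys}"
proof -
  let ?t = "\<lambda>r s. op_tensor (concat Xs) [] (concat Ys) [] r s"
  have "coord (Xs @ Ys) (?t r s) = ktensor (length Xs) (coord Xs r) (coord Ys s)"
    if "r \<in> comps R Xs []" "s \<in> comps S Ys []" for r s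
    using that assms relation_atom[OF assms(1,3)] relation_atom[OF assms(2,4)]
      relation_Op[OF assms(1,3)] relation_Op[OF assms(2,4)] by (intro coord_op_tensor) auto
  then have "coord (Xs @ Ys) ` {?t r s | r s. r \<in> comps R Xs [] \<and> s \<in> comps S Ys []} =
      {ktensor (length Xs) K L | K L. K \<in> amps R Xs \<and> L \<in> amps S Ys}"
    unfolding amps_def by (auto 4 4 simp: image_iff)
  then show ?thesis unfolding amps_def[of "rel_times R S"] comps_times[OF assms] coord_span by simp
qed

lemma ktensor_supported:
  assumes "K \<in> supported (idx Xs)" "L \<in> supported (idx Ys)"
  shows "ktensor (length Xs) K L \<in> supported (idx (Xs @ Ys))"
  unfolding supported_def
proof (intro CollectI allI impI)
  fix es assume "es \<notin> idx (Xs @ Ys)"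
  then have "\<not> (take (length Xs) es \<in> idx Xs \<and> drop (length Xs) es \<in> idx Ys)"
    using idx_append[of "take (length Xs) es" Xs "drop (length Xs) es" Ys] idx_length
    by (metis append_take_drop_id)
  then show "ktensor (length Xs) K L es = 0"
    using assms by (auto simp: ktensor_def supported_def)
qed

lemma sum_fun_apply: "(\<Sum>i\<in>I. F i) x = (\<Sum>i\<in>I. F i x)" for F :: "'i \<Rightarrow> 'b \<Rightarrow> complex"
  by (induction I rule: infinite_finite_induct) simp_all

text \<open>
  \<open>A \<otimes> L(Y, \<complex>)\<close> consists of the functionals all of whose slices belong to \<open>A\<close>: such a functional
  is the sum of its slices tensored with the dual basis.  Unlike the span, the slicewise condition
  does not depend on the order in which the remaining factors are listed.
\<close>

lemma span_ktensor_slices: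
  assumes "\<And>X. X \<in> set Ys \<Longrightarrow> atom X" "fn.subspace A" "A \<subseteq> supported (idx Xs)"
  shows "fn.span {ktensor (length Xs) K L | K L. K \<in> A \<and> L \<in> supported (idx Ys)} =
    {M \<in> supported (idx (Xs @ Ys)). \<forall>fs\<in>idx Ys. (\<lambda>es. M (es @ fs)) \<in> A}" (is "fn.span ?G = ?S")
proof
  have "?G \<subseteq> ?S"
  proof clarify
    fix K L assume K: "K \<in> A" and L: "L \<in> supported (idx Ys)"
    have K': "K es = 0" if "es \<notin> idx Xs" for es using K assms(3) that by (auto simp: supported_def)
    have "ktensor (length Xs) K L \<in> supported (idx (Xs @ Ys))"
      using K assms(3) L by (intro ktensor_supported) auto
    moreover have "(\<lambda>es. ktensor (length Xs) K L (es @ fs)) \<in> A" if fs: "fs \<in> idx Ys" for fs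
    proof -
      have "(\<lambda>es. ktensor (length Xs) K L (es @ fs)) = (\<lambda>es. L fs * K es)"
      proof
        fix es
        show "ktensor (length Xs) K L (es @ fs) = L fs * K es"
        proof (cases "length es = length Xs")
          case False
          then have "es \<notin> idx Xs" using idx_length by blast
          moreover have "take (length Xs) (es @ fs) \<notin> idx Xs \<or> drop (length Xs) (es @ fs) \<notin> idx Ys"
            using False idx_length[OF fs] idx_length[of "take (length Xs) (es @ fs)" Xs]
              idx_length[of "drop (length Xs) (es @ fs)" Ys] by auto
          ultimately show ?thesis using K' L by (auto simp: ktensor_def supported_def)
        qed (simp add: ktensor_def)
      qed
      then show ?thesis using fn.subspace_scale[OF assms(2) K] by simp
    qed
    ultimately show "ktensor (length Xs) K L \<in> supported (idx (Xs @ Ys)) \<and>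
       (\<forall>fs\<in>idx Ys. (\<lambda>es. ktensor (length Xs) K L (es @ fs)) \<in> A)" by blast
  qed
  moreover have "fn.subspace ?S"
  proof (rule fn.subspaceI)
    show "0 \<in> ?S" using fn.subspace_0[OF supported_subspace] fn.subspace_0[OF assms(2)]
      by (simp add: zero_fun_def)
    show "M + N \<in> ?S" if "M \<in> ?S" "N \<in> ?S" for M N
    proof -
      have "M + N \<in> supported (idx (Xs @ Ys))"
        using that by (intro fn.subspace_add[OF supported_subspace]) auto
      moreover have "(\<lambda>es. M (es @ fs)) + (\<lambda>es. N (es @ fs)) \<in> A" if "fs \<in> idx Ys" for fs
        using that \<open>M \<in> ?S\<close> \<open>N \<in> ?S\<close> by (intro fn.subspace_add[OF assms(2)]) auto
      ultimately show ?thesis by (simp add: plus_fun_def)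
    qed
    show "(\<lambda>i. c * M i) \<in> ?S" if "M \<in> ?S" for c M
    proof -
      have "(\<lambda>i. c * M i) \<in> supported (idx (Xs @ Ys))"
        using that by (intro fn.subspace_scale[OF supported_subspace]) auto
      moreover have "(\<lambda>es. c * M (es @ fs)) \<in> A" if "fs \<in> idx Ys" for fs
        using that \<open>M \<in> ?S\<close> fn.subspace_scale[OF assms(2), of "\<lambda>es. M (es @ fs)" c] by simp
      ultimately show ?thesis by simp
    qed
  qed
  ultimately show "fn.span ?G \<subseteq> ?S" by (rule fn.span_minimal)
  show "?S \<subseteq> fn.span ?G"
  proof
    fix M assume M: "M \<in> ?S"
    define sl where "sl = (\<lambda>fs. ktensor (length Xs) (\<lambda>es. M (es @ fs)) (\<lambda>gs. if gs = fs then 1 else 0))"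
    have fin: "finite (idx Ys)" using assms(1) by (rule finite_idx)
    have "M zs = (\<Sum>fs\<in>idx Ys. sl fs zs)" for zs
    proof (cases "zs \<in> idx (Xs @ Ys)")
      case True
      then obtain es fs where zs: "zs = es @ fs" "es \<in> idx Xs" "fs \<in> idx Ys" by (rule idx_appendE)
      have "(\<Sum>gs\<in>idx Ys. sl gs zs) = (\<Sum>gs\<in>idx Ys. if gs = fs then M (es @ gs) else 0)"
        using zs idx_length[OF zs(2)] by (intro sum.cong) (auto simp: sl_def ktensor_def)
      then show ?thesis using zs fin by simp
    next
      case False
      have "sl fs zs = 0" if "fs \<in> idx Ys" for fs
        using M False by (auto simp: sl_def ktensor_def supported_def)
      then show ?thesis using M False by (simp add: supported_def)
    qed
    then have "M = (\<Sum>fs\<in>idx Ys. sl fs)"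
      using fin by (simp add: fun_eq_iff sum_fun_apply)
    also have "\<dots> \<in> fn.span ?G"
    proof (intro fn.span_sum fn.span_base)
      fix fs assume "fs \<in> idx Ys"
      then have "(\<lambda>es. M (es @ fs)) \<in> A" "(\<lambda>gs. if gs = fs then 1 else 0) \<in> supported (idx Ys)"
        using M by (auto simp: supported_def)
      then show "sl fs \<in> ?G" unfolding sl_def by blast
    qed
    finally show "M \<in> fn.span ?G" .
  qed
qed

section \<open>Interpretation in coordinates\<close>

lemma binary_relation_top:
  "(\<And>\<X>. \<X> \<in> set \<X>s \<Longrightarrow> qset \<X>) \<Longrightarrow> (\<And>\<Y>. \<Y> \<in> set \<Y>s \<Longrightarrow> qset \<Y>) \<Longrightarrow> binary_relation (rel_top \<X>s \<Y>s)"
  unfolding rel_top_def by (rule binary_relation_mk_rel) (simp_all add: Op_subspace)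

lemma relation_top: "(\<And>\<X>. \<X> \<in> set \<X>s \<Longrightarrow> qset \<X>) \<Longrightarrow> relation_of_arity (rel_top \<X>s []) \<X>s"
  using binary_relation_top[of \<X>s "[]"] by (simp add: relation_of_arity_def rel_top_def)

lemma coord_image_Op:
  assumes "\<And>X. X \<in> set Xs \<Longrightarrow> atom X"
  shows "coord Xs ` Op (concat Xs) [] = supported (idx Xs)"
proof
  show "supported (idx Xs) \<subseteq> coord Xs ` Op (concat Xs) []"
    using coord_surj[OF assms] by blast
qed (auto simp: coord_supported)

lemma Op_coord_subspace:
  assumes "fn.subspace A"
  shows "op.subspace {a \<in> Op X Y. coord Xs a \<in> A}"
proof (rule op.subspaceI)
  show "0 \<in> {a \<in> Op X Y. coord Xs a \<in> A}"
    using fn.subspace_0[OF assms] by (simp add: Op_zero coord_zero)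
  show "a + b \<in> {a \<in> Op X Y. coord Xs a \<in> A}"
    if "a \<in> {a \<in> Op X Y. coord Xs a \<in> A}" "b \<in> {a \<in> Op X Y. coord Xs a \<in> A}" for a b
    using that fn.subspace_add[OF assms, of "coord Xs a" "coord Xs b"] by (simp add: Op_plus coord_add)
  show "(\<lambda>f u. c * a f u) \<in> {a \<in> Op X Y. coord Xs a \<in> A}" if "a \<in> {a \<in> Op X Y. coord Xs a \<in> A}" for c a
    using that fn.subspace_scale[OF assms, of "coord Xs a" c] by (simp add: Op_mult coord_scale)
qed

lemma coord_image_Collect:
  assumes "\<And>X. X \<in> set Xs \<Longrightarrow> atom X"
  shows "coord Xs ` {a \<in> Op (concat Xs) []. P (coord Xs a)} = {K \<in> supported (idx Xs). P K}"
proof -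
  have "coord Xs ` {a \<in> Op (concat Xs) []. P (coord Xs a)} = {K \<in> coord Xs ` Op (concat Xs) []. P K}"
    by blast
  also have "coord Xs ` Op (concat Xs) [] = supported (idx Xs)"
    using assms by (rule coord_image_Op)
  finally show ?thesis .
qed

lemma amps_top:
  assumes "\<And>\<X>. \<X> \<in> set \<X>s \<Longrightarrow> qset \<X>" "Xs \<in> listset \<X>s"
  shows "amps (rel_top \<X>s []) Xs = supported (idx Xs)"
  using coord_image_Op[OF qsets_atoms[OF assms(2,1)]] assms(2)
  by (simp add: amps_def rel_top_def comps_mk_rel)

lemma amps_times_top:
  assumes "relation_of_arity R \<X>s" "relation_of_arity S \<Y>s" "Xs \<in> listset \<X>s" "Ys \<in> listset \<Y>s"
    and "amps S Ys = supported (idx Ys)"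
  shows "amps (rel_times R S) (Xs @ Ys) =
    {M \<in> supported (idx (Xs @ Ys)). \<forall>fs\<in>idx Ys. (\<lambda>es. M (es @ fs)) \<in> amps R Xs}"
  unfolding amps_times[OF assms(1-4)] assms(5)
  using assms(1-4) by (intro span_ktensor_slices amps_subspace amps_supported) (rule relation_atom)

lemma relation_tops: "(\<And>\<X>. \<X> \<in> set \<X>s \<Longrightarrow> qset \<X>) \<Longrightarrow> relation_of_arity (rel_tops \<X>s) \<X>s"
proof (induction \<X>s)
  case (Cons \<X> \<X>s)
  then show ?case
    using relation_times[OF relation_top[of "[\<X>]"] Cons.IH] by simp
qed (use relation_top[of "[]"] in simp)

lemma amps_tops:
  assumes "\<And>\<X>. \<X> \<in> set \<X>s \<Longrightarrow> qset \<X>" "Xs \<in> listset \<X>s"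
  shows "amps (rel_tops \<X>s) Xs = supported (idx Xs)"
  using assms
proof (induction \<X>s arbitrary: Xs)
  case Nil
  then show ?case using amps_top[of "[]" "[]"] by simp
next
  case (Cons \<X> \<X>s)
  then obtain X Xs' where Xs: "Xs = [X] @ Xs'" "[X] \<in> listset [\<X>]" "Xs' \<in> listset \<X>s"
    by (auto simp: set_Cons_def)
  have q: "\<And>\<Y>. \<Y> \<in> set [\<X>] \<Longrightarrow> qset \<Y>" "\<And>\<Y>. \<Y> \<in> set \<X>s \<Longrightarrow> qset \<Y>" using Cons.prems(1) by auto
  have "amps (rel_tops (\<X> # \<X>s)) Xs =
      {M \<in> supported (idx Xs). \<forall>fs\<in>idx Xs'. (\<lambda>es. M (es @ fs)) \<in> supported (idx [X])}"
    using amps_times_top[OF relation_top[OF q(1)] relation_tops[OF q(2)] Xs(2,3) Cons.IH[OF q(2) Xs(3)]]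
      amps_top[OF q(1) Xs(2)] Xs(1) by simp
  also have "\<dots> = supported (idx Xs)"
    using idx_append_right[of _ Xs' _ "[X]"] unfolding Xs(1)
    by (auto simp: supported_def idx_length)
  finally show ?case .
qed

lemma
  assumes "x \<in> set \<Gamma>"
  shows position_less: "position \<Gamma> x < length \<Gamma>" and position_nth: "\<Gamma> ! position \<Gamma> x = x"
proof -
  have "\<exists>i. i < length \<Gamma> \<and> \<Gamma> ! i = x" using assms by (simp add: in_set_conv_nth)
  then have "position \<Gamma> x < length \<Gamma> \<and> \<Gamma> ! position \<Gamma> x = x"
    unfolding position_def by (rule LeastI_ex)
  then show "position \<Gamma> x < length \<Gamma>" "\<Gamma> ! position \<Gamma> x = x" by simp_all
qed

lemma position_eqI:
  assumes "i < length \<Gamma>" "\<Gamma> ! i = x" "\<And>j. j < i \<Longrightarrow> \<Gamma> ! j \<noteq> x"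
  shows "position \<Gamma> x = i"
  unfolding position_def using assms by (intro Least_equality) (auto simp: not_le[symmetric])

lemma position_less_nth: "x \<in> set \<Gamma> \<Longrightarrow> j < position \<Gamma> x \<Longrightarrow> \<Gamma> ! j \<noteq> x"
  using not_less_Least[of j "\<lambda>i. i < length \<Gamma> \<and> \<Gamma> ! i = x"] position_less[of x \<Gamma>]
  by (auto simp: position_def)

lemma position_Cons:
  assumes "x \<in> set (z # \<Gamma>)"
  shows "position (z # \<Gamma>) x = (if x = z then 0 else Suc (position \<Gamma> x))"
proof (cases "x = z")
  case False
  then have x: "x \<in> set \<Gamma>" using assms by simp
  have "position (z # \<Gamma>) x = Suc (position \<Gamma> x)"
  proof (rule position_eqI)
    fix j assume "j < Suc (position \<Gamma> x)"
    then show "(z # \<Gamma>) ! j \<noteq> x"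
      using False position_less_nth[OF x] by (cases j) auto
  qed (use x in \<open>simp_all add: position_less position_nth\<close>)
  then show ?thesis using False by simp
qed (auto intro: position_eqI)

text \<open>
  What the elimination of function symbols leaves: atomic formulas whose arguments are distinct
  variables of the right sorts.  Distinctness is needed for \<open>u\<^sub>\<pi>\<close> to be a permutation operator.
\<close>

primrec core_wf :: "'v::complex_inner fm \<Rightarrow> bool" where
  "core_wf (Atomic R ts) \<longleftrightarrow>
     (\<exists>vs. ts = map Var vs \<and> distinct vs \<and> relation_of_arity R (map fst vs))"
| "core_wf (Neg \<phi>) \<longleftrightarrow> core_wf \<phi>"
| "core_wf (Conj \<phi> \<psi>) \<longleftrightarrow> core_wf \<phi> \<and> core_wf \<psi>"
| "core_wf (Forall x \<phi>) \<longleftrightarrow> qset (fst x) \<and> core_wf \<phi>"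

lemma permute_listset:
  assumes "\<And>i. i \<in> set \<pi> \<Longrightarrow> i < length Xs" "Xs \<in> listset \<X>s"
  shows "permute \<pi> Xs \<in> listset (permute \<pi> \<X>s)"
  using assms by (auto simp: listset_iff list_all2_conv_all_nth)

definition completion :: "nat list \<Rightarrow> nat \<Rightarrow> nat list" where
  "completion ps n = filter (\<lambda>i. i \<notin> set ps) [0..<n]"

lemma completion_perm_list:
  "distinct ps \<Longrightarrow> (\<And>i. i \<in> set ps \<Longrightarrow> i < n) \<Longrightarrow> perm_list (ps @ completion ps n) n"
  by (auto simp: perm_list_def completion_def)

lemma comp_right_linear:
  "module_hom (\<lambda>(c::complex) (a::'v oper) f u. c * a f u) (\<lambda>c a f u. c * a f u) (\<lambda>a. a \<circ> b)"
  by unfold_locales (simp_all add: fun_eq_iff ring_distribs)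

context
  fixes R :: "'v::complex_inner brel" and vs \<Gamma> :: "'v var list" and ps qs \<pi> :: "nat list" and S :: "'v
      brel"
  assumes R: "relation_of_arity R (map fst vs)" and vs: "distinct vs" "set vs \<subseteq> set \<Gamma>"
    and \<Gamma>: "\<And>x. x \<in> set \<Gamma> \<Longrightarrow> qset (fst x)"
  defines "ps \<equiv> map (position \<Gamma>) vs"
  defines "qs \<equiv> completion ps (length \<Gamma>)"
  defines "\<pi> \<equiv> ps @ qs"
  defines "S \<equiv> rel_times R (rel_tops (map (\<lambda>i. fst (\<Gamma> ! i)) qs))"
begin

lemma atomic_perm_list: "perm_list \<pi> (length \<Gamma>)"
  and atomic_ps_less: "i \<in> set ps \<Longrightarrow> i < length \<Gamma>"
proof -
  have "inj_on (position \<Gamma>) (set vs)"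
    by (rule inj_onI) (metis position_nth subsetD vs(2))
  moreover have less: "i < length \<Gamma>" if "i \<in> set ps" for i
    using that vs(2) position_less by (auto simp: ps_def)
  ultimately show "perm_list \<pi> (length \<Gamma>)"
    unfolding \<pi>_def qs_def using vs(1) by (intro completion_perm_list) (simp_all add: ps_def
        distinct_map)
  show "i \<in> set ps \<Longrightarrow> i < length \<Gamma>" by (rule less)
qed

lemma atomic_relation:
  "relation_of_arity S (map fst vs @ map (\<lambda>i. fst (\<Gamma> ! i)) qs)"
  unfolding S_def by (rule relation_times[OF R relation_tops]) (auto simp: qs_def completion_def \<Gamma>)

lemma interp_core_atomic:
  "interp_core (Atomic R (map Var vs)) \<Gamma> = mk_rel (map fst \<Gamma>) [] (\<lambda>Xs Ys.
     {a \<circ> op_perm \<pi> Xs | a. a \<in> comps S (permute \<pi> Xs) Ys})"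
proof -
  have "map (\<lambda>t. position \<Gamma> (the_var t)) (map Var vs) = ps"
    by (simp add: ps_def)
  then show ?thesis
    by (simp only: interp_core.simps Let_def S_def \<pi>_def qs_def completion_def)
qed

lemma atomic_tuple:
  assumes "Xs \<in> listset (map fst \<Gamma>)"
  shows "permute ps Xs \<in> listset (map fst vs)"
    and "permute qs Xs \<in> listset (map (\<lambda>i. fst (\<Gamma> ! i)) qs)"
proof -
  have len: "length Xs = length \<Gamma>" using listset_length[OF assms] by simp
  have "map fst \<Gamma> ! position \<Gamma> x = fst x" if "x \<in> set vs" for x
    using position_less[OF subsetD[OF vs(2) that]] position_nth[OF subsetD[OF vs(2) that]] by simp
  then have "map (\<lambda>i. map fst \<Gamma> ! i) ps = map fst vs"
    by (simp add: ps_def)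
  then show "permute ps Xs \<in> listset (map fst vs)"
    using permute_listset[of ps Xs, OF _ assms] atomic_ps_less len by simp
  have completion_less: "i < length Xs" if "i \<in> set qs" for i
    using that len by (simp add: qs_def completion_def)
  have "map (\<lambda>i. map fst \<Gamma> ! i) qs = map (\<lambda>i. fst (\<Gamma> ! i)) qs"
    by (auto simp: qs_def completion_def)
  with permute_listset[of qs Xs, OF completion_less assms]
  show "permute qs Xs \<in> listset (map (\<lambda>i. fst (\<Gamma> ! i)) qs)"
    by (simp only:)
qed

lemma relation_atomic: "relation_of_arity (interp_core (Atomic R (map Var vs)) \<Gamma>) (map fst \<Gamma>)"
  unfolding relation_of_arity_def interp_core_atomic rdom_mk_rel rcod_mk_rel
proof (intro conjI refl binary_relation_mk_rel)
  fix Xs Ys :: "'v atom list" assume Xs: "Xs \<in> listset (map fst \<Gamma>)" and Ys: "Ys \<in> listset []"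
  let ?C = "{a \<circ> op_perm \<pi> Xs | a. a \<in> comps S (permute \<pi> Xs) Ys}"
  have Ys': "Ys = []" using Ys by simp
  have "op.subspace ((\<lambda>a. a \<circ> op_perm \<pi> Xs) ` comps S (permute \<pi> Xs) [])"
    by (rule module_hom.subspace_image[OF comp_right_linear relation_subspace[OF atomic_relation]])
  moreover have "?C = (\<lambda>a. a \<circ> op_perm \<pi> Xs) ` comps S (permute \<pi> Xs) Ys" by blast
  ultimately show "op.subspace ?C" unfolding Ys' by simp
  fix a assume "a \<in> ?C"
  then obtain b where b: "a = b \<circ> op_perm \<pi> Xs" "b \<in> comps S (permute \<pi> Xs) []" using Ys' by blast
  have "permute \<pi> Xs \<in> listset (map fst vs @ map (\<lambda>i. fst (\<Gamma> ! i)) qs)"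
    using atomic_tuple[OF Xs] unfolding \<pi>_def map_append by (subst listset_append) (auto simp: ps_def)
  then have "b \<in> Op (concat (permute \<pi> Xs)) []" using relation_Op[OF atomic_relation _ b(2)] by blast
  moreover have "op_perm \<pi> Xs \<in> Op (concat Xs) (concat (permute \<pi> Xs))"
    using \<Gamma> listset_length[OF Xs] atomic_perm_list by (intro op_perm_Op qsets_atoms[OF Xs]) auto
  ultimately show "a \<in> Op (concat Xs) (concat Ys)" unfolding b(1) Ys' by (auto intro: Op_comp)
qed (use \<Gamma> in auto)

text \<open>
  A functional belongs to \<open>[R(x\<^bsub>\<pi> 1\<^esub>, \<dots>, x\<^bsub>\<pi> m\<^esub>)]\<close> iff, whatever the labels at the positions that
  are not arguments, it is an element of \<open>R\<close> as a function of the labels at the argument positions.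
  This form mentions neither the order of the remaining positions nor \<open>u\<^sub>\<pi>\<close>, so that it is
  visibly compatible with reordering the context.
\<close>

lemma amps_atomic:
  assumes Xs: "Xs \<in> listset (map fst \<Gamma>)"
  shows "K \<in> amps (interp_core (Atomic R (map Var vs)) \<Gamma>) Xs \<longleftrightarrow>
    K \<in> supported (idx Xs) \<and> (\<forall>es\<in>idx Xs. \<exists>r\<in>amps R (permute ps Xs). \<forall>es'\<in>idx Xs.
      (\<forall>i<length \<Gamma>. i \<notin> set ps \<longrightarrow> es' ! i = es ! i) \<longrightarrow> K es' = r (permute ps es'))"
    (is "?L \<longleftrightarrow> ?R")
proof -
  have len: "length Xs = length \<Gamma>" using listset_length[OF Xs] by simp
  have atom: "atom X" if "X \<in> set Xs" for X
    by (rule qsets_atoms[OF Xs _ that]) (use \<Gamma> in auto)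
  have permXs: "permute \<pi> Xs = permute ps Xs @ permute qs Xs" by (simp add: \<pi>_def)
  have qsq: "\<X> \<in> set (map (\<lambda>i. fst (\<Gamma> ! i)) qs) \<Longrightarrow> qset \<X>" for \<X> by (auto simp: qs_def completion_def \<Gamma>)
  have amps_S: "amps S (permute \<pi> Xs) = {M \<in> supported (idx (permute \<pi> Xs)).
      \<forall>fs\<in>idx (permute qs Xs). (\<lambda>es. M (es @ fs)) \<in> amps R (permute ps Xs)}"
    unfolding permXs S_def
    by (rule amps_times_top[OF R relation_tops[OF qsq] atomic_tuple[OF Xs] amps_tops[OF qsq
        atomic_tuple(2)[OF Xs]]])
  have perm: "perm_list \<pi> (length Xs)" using atomic_perm_list len by simp
  have pidx: "permute \<pi> es \<in> idx (permute \<pi> Xs) \<longleftrightarrow> es \<in> idx Xs" if "length es = length \<Gamma>" for es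
    using idx_permute[OF perm refl, of es] that len by simp
  have coord: "coord Xs (a \<circ> op_perm \<pi> Xs) es = coord (permute \<pi> Xs) a (permute \<pi> es)" if "es \<in> idx Xs"
      for a es
    using that op_perm_ket[OF atom perm that] pidx[of es] idx_length[OF that] len by (simp add:
        coord_def)
  have L: "?L \<longleftrightarrow> K \<in> supported (idx Xs) \<and> (\<exists>M\<in>amps S (permute \<pi> Xs). \<forall>es\<in>idx Xs. K es = M (permute \<pi>
      es))"
    (is "_ \<longleftrightarrow> ?L'")
  proof
    assume ?L
    then obtain a where "a \<in> comps S (permute \<pi> Xs) []" "K = coord Xs (a \<circ> op_perm \<pi> Xs)"
      using Xs unfolding amps_def interp_core_atomic by (auto simp: comps_mk_rel)
    then show ?L' by (auto simp: coord_supported coord amps_def)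
  next
    assume ?L'
    then obtain a where a: "a \<in> comps S (permute \<pi> Xs) []" "K \<in> supported (idx Xs)"
      "\<And>es. es \<in> idx Xs \<Longrightarrow> K es = coord Xs (a \<circ> op_perm \<pi> Xs) es" by (auto simp: coord amps_def)
    have "K = coord Xs (a \<circ> op_perm \<pi> Xs)"
    proof
      fix es show "K es = coord Xs (a \<circ> op_perm \<pi> Xs) es"
        using a(2,3) by (cases "es \<in> idx Xs") (auto simp: supported_def coord_def)
    qed
    then show ?L using a(1) Xs unfolding amps_def interp_core_atomic by (auto simp: comps_mk_rel)
  qed
  have qs_set: "set qs = {i. i < length \<Gamma> \<and> i \<notin> set ps}" by (auto simp: qs_def completion_def)
  show ?thesis
  proof
    assume ?L
    then obtain M where M: "M \<in> amps S (permute \<pi> Xs)" "\<And>es. es \<in> idx Xs \<Longrightarrow> K es = M (permute \<pi> es)"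
      and K: "K \<in> supported (idx Xs)" using L by blast
    have "\<exists>r\<in>amps R (permute ps Xs). \<forall>es'\<in>idx Xs.
      (\<forall>i<length \<Gamma>. i \<notin> set ps \<longrightarrow> es' ! i = es ! i) \<longrightarrow> K es' = r (permute ps es')" if es: "es \<in> idx Xs"
          for es
    proof (intro bexI ballI impI)
      have "permute \<pi> es \<in> idx (permute \<pi> Xs)" using pidx es idx_length len by metis
      then have "permute qs es \<in> idx (permute qs Xs)"
        by (simp add: \<pi>_def idx_append)
      then show "(\<lambda>ds. M (ds @ permute qs es)) \<in> amps R (permute ps Xs)" using M(1) amps_S by blast
      fix es' assume es': "es' \<in> idx Xs" "\<forall>i<length \<Gamma>. i \<notin> set ps \<longrightarrow> es' ! i = es ! i"
      then have "permute qs es' = permute qs es" using qs_set by simp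
      then show "K es' = M (permute ps es' @ permute qs es)" using M(2)[OF es'(1)] by (simp only: \<pi>_def
          map_append)
    qed
    with K show ?R by blast
  next
    assume R': ?R
    \<comment> \<open>The converse permutation of blocks, which turns \<open>K\<close> into a functional on the permuted factors.\<close>
    define unperm where "unperm = (\<lambda>zs :: 'v list list. SOME es. length es = length \<Gamma> \<and> permute \<pi> es =
        zs)"
    have unperm: "length (unperm zs) = length \<Gamma> \<and> permute \<pi> (unperm zs) = zs" if zs: "length zs = length
        \<Gamma>" for zs
    proof -
      obtain es where "length es = length \<Gamma> \<and> permute \<pi> es = zs"
        using permute_surj[OF atomic_perm_list zs] by metis
      then show ?thesis unfolding unperm_def by (rule someI)
    qed
    define M where "M = (\<lambda>zs. if zs \<in> idx (permute \<pi> Xs) then K (unperm zs) else 0)"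
    have l\<pi>: "length (permute \<pi> Xs) = length \<Gamma>" using perm_list_length[OF atomic_perm_list] by simp
    have invi: "unperm zs \<in> idx Xs" if "zs \<in> idx (permute \<pi> Xs)" for zs
      using that unperm[of zs] pidx[of "unperm zs"] idx_length[OF that] l\<pi> by simp
    have "(\<lambda>ds. M (ds @ fs)) \<in> amps R (permute ps Xs)" if fs: "fs \<in> idx (permute qs Xs)" for fs
    proof -
      \<comment> \<open>Some labels are needed at the argument positions in order to name the slice by a tuple of the
          context.\<close>
      have "idx (permute ps Xs) \<noteq> {}" using atom len atomic_ps_less by (intro idx_nonempty) auto
      then obtain f0 where f0: "f0 \<in> idx (permute ps Xs)" by blast
      have app: "ds @ fs \<in> idx (permute \<pi> Xs) \<longleftrightarrow> ds \<in> idx (permute ps Xs)" for ds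
        unfolding permXs using idx_append_right[OF idx_length[OF fs]] fs by blast
      let ?es = "unperm (f0 @ fs)"
      have es: "?es \<in> idx Xs" using invi app f0 by blast
      with R' obtain r where r: "r \<in> amps R (permute ps Xs)"
        "\<And>es'. es' \<in> idx Xs \<Longrightarrow> (\<forall>i<length \<Gamma>. i \<notin> set ps \<longrightarrow> es' ! i = ?es ! i) \<Longrightarrow> K es' = r (permute ps
            es')"
        by blast
      have "M (ds @ fs) = r ds" for ds
      proof (cases "ds \<in> idx (permute ps Xs)")
        case True
        have split: "permute ps (unperm (ds @ fs)) = ds \<and> permute qs (unperm (ds @ fs)) = fs"
          if "ds \<in> idx (permute ps Xs)" for ds
          using unperm[of "ds @ fs"] idx_length[OF that] app[of ds] that idx_length[of "ds @ fs"
              "permute \<pi> Xs"] l\<pi>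
          by (simp add: \<pi>_def)
        have "permute qs (unperm (ds @ fs)) = permute qs ?es" using split[OF True] split[OF f0] by simp
        then have "\<forall>i<length \<Gamma>. i \<notin> set ps \<longrightarrow> unperm (ds @ fs) ! i = ?es ! i" using qs_set by simp
        then have "K (unperm (ds @ fs)) = r (permute ps (unperm (ds @ fs)))" using invi app True by
            (intro r(2)) auto
        then show ?thesis using app True split[OF True] by (simp add: M_def)
      next
        case False
        then have "r ds = 0" using r(1) amps_supported[OF R, of "permute ps Xs"] by (auto simp:
            supported_def)
        then show ?thesis using False app by (simp add: M_def)
      qed
      then show ?thesis using r(1) by simp
    qed
    then have "M \<in> amps S (permute \<pi> Xs)" unfolding amps_S by (simp add: M_def supported_def)
    moreover have "K es = M (permute \<pi> es)" if es: "es \<in> idx Xs" for es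
    proof -
      have le: "length es = length \<Gamma>" using idx_length[OF es] len by simp
      have "length (permute \<pi> es) = length \<Gamma>" using perm_list_length[OF atomic_perm_list] by simp
      from unperm[OF this] have "unperm (permute \<pi> es) = es"
        using permute_inject[OF atomic_perm_list _ le] by blast
      then show ?thesis using es pidx[OF le] by (simp add: M_def)
    qed
    ultimately show ?L using L R' by blast
  qed
qed

end

lemma
  assumes "relation_of_arity R \<X>s"
  shows relation_neg: "relation_of_arity (rel_neg R) \<X>s"
    and amps_neg: "Xs \<in> listset \<X>s \<Longrightarrow> amps (rel_neg R) Xs = ortho (idx Xs) (amps R Xs)"
proof -
  have neg: "rel_neg R = mk_rel \<X>s [] (\<lambda>Xs Ys. {a \<in> Op (concat Xs) (concat Ys).
      \<forall>b\<in>comps R Xs Ys. op_inner (concat Xs) (concat Ys) b a = 0})"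
    by (simp add: rel_neg_def relation_rdom[OF assms] relation_rcod[OF assms])
  have inner: "op_inner (concat Xs) [] b a = dotp (idx Xs) (coord Xs b) (coord Xs a)"
    if "Xs \<in> listset \<X>s" "a \<in> Op (concat Xs) []" "b \<in> comps R Xs []" for Xs a b
    by (rule op_inner_coord[OF relation_atom[OF assms that(1)] relation_Op[OF assms that(1,3)] that(2)])
  have C: "{a \<in> Op (concat Xs) []. \<forall>b\<in>comps R Xs []. op_inner (concat Xs) [] b a = 0} =
      {a \<in> Op (concat Xs) []. coord Xs a \<in> ortho (idx Xs) (amps R Xs)}"
    if "Xs \<in> listset \<X>s" for Xs
    using inner[OF that] by (auto simp: ortho_def amps_def coord_supported)
  have sub: "op.subspace {a \<in> Op (concat Xs) []. coord Xs a \<in> ortho (idx Xs) (amps R Xs)}" for Xs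
    using ortho_subspace by (rule Op_coord_subspace)
  show "relation_of_arity (rel_neg R) \<X>s"
    unfolding relation_of_arity_def neg rdom_mk_rel rcod_mk_rel
    using C sub relation_qset[OF assms] by (intro conjI refl binary_relation_mk_rel) auto
  show "amps (rel_neg R) Xs = ortho (idx Xs) (amps R Xs)" if Xs: "Xs \<in> listset \<X>s"
  proof -
    have "comps (rel_neg R) Xs [] = {a \<in> Op (concat Xs) []. coord Xs a \<in> ortho (idx Xs) (amps R Xs)}"
      using Xs C[OF Xs] by (simp add: neg comps_mk_rel)
    then have "amps (rel_neg R) Xs = coord Xs ` {a \<in> Op (concat Xs) []. coord Xs a \<in> ortho (idx Xs)
        (amps R Xs)}"
      by (simp only: amps_def[of "rel_neg R"])
    also have "\<dots> = {K \<in> supported (idx Xs). K \<in> ortho (idx Xs) (amps R Xs)}"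
      by (rule coord_image_Collect[OF relation_atom[OF assms Xs]])
    also have "\<dots> = ortho (idx Xs) (amps R Xs)" by (auto simp: ortho_def)
    finally show ?thesis .
  qed
qed

lemma
  assumes "relation_of_arity R \<X>s" "relation_of_arity S \<X>s"
  shows relation_inf: "relation_of_arity (rel_inf R S) \<X>s"
    and amps_inf: "Xs \<in> listset \<X>s \<Longrightarrow> amps (rel_inf R S) Xs = amps R Xs \<inter> amps S Xs"
proof -
  have inf: "rel_inf R S = mk_rel \<X>s [] (\<lambda>Xs Ys. comps R Xs Ys \<inter> comps S Xs Ys)"
    by (simp add: rel_inf_def relation_rdom[OF assms(1)] relation_rcod[OF assms(1)])
  show "relation_of_arity (rel_inf R S) \<X>s"
    unfolding relation_of_arity_def inf rdom_mk_rel rcod_mk_rel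
  proof (intro conjI refl binary_relation_mk_rel)
    fix Xs Ys :: "'a atom list" assume "Ys \<in> listset []"
    then show "op.subspace (comps R Xs Ys \<inter> comps S Xs Ys)"
      using relation_subspace[OF assms(1)] relation_subspace[OF assms(2)] by (simp add:
          op.subspace_inter)
  qed (use relation_qset[OF assms(1)] relation_Op[OF assms(1)] in auto)
  show "amps (rel_inf R S) Xs = amps R Xs \<inter> amps S Xs" if Xs: "Xs \<in> listset \<X>s"
  proof -
    have "inj_on (coord Xs) (Op (concat Xs) [])"
      by (rule inj_onI) (rule coord_inject[OF relation_atom[OF assms(1) Xs]])
    moreover have "comps R Xs [] \<subseteq> Op (concat Xs) []" "comps S Xs [] \<subseteq> Op (concat Xs) []"
      using relation_Op[OF assms(1) Xs] relation_Op[OF assms(2) Xs] by auto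
    ultimately have "coord Xs ` (comps R Xs [] \<inter> comps S Xs []) = coord Xs ` comps R Xs [] \<inter> coord Xs `
        comps S Xs []"
      by (rule inj_on_image_Int)
    then show ?thesis using Xs by (simp add: amps_def inf comps_mk_rel)
  qed
qed

text \<open>
  The supremum in the interpretation of \<open>\<forall>\<close> is attained: the functionals \<open>a\<close> with \<open>T \<otimes> a\<close> in \<open>S\<close> for
  every functional \<open>T\<close> on every atom form a subspace, hence the largest of the relations whose
  supremum is taken.
\<close>

lemma
  fixes x :: "'v::complex_inner var"
  assumes q: "qset (fst x)" "\<And>\<X>. \<X> \<in> set \<X>s \<Longrightarrow> qset \<X>" and S: "relation_of_arity S (fst x # \<X>s)"
  defines "\<R> \<equiv> {R. relation_of_arity R \<X>s \<and> rel_le (rel_times (rel_top [fst x] []) R) S}"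
  shows relation_forall: "relation_of_arity (rel_sup \<X>s [] \<R>) \<X>s"
    and amps_forall: "\<And>Xs. Xs \<in> listset \<X>s \<Longrightarrow> amps (rel_sup \<X>s [] \<R>) Xs =
      {K \<in> supported (idx Xs). \<forall>X\<in>fst x. \<forall>T\<in>supported (idx [X]). ktensor 1 T K \<in> amps S (X # Xs)}"
proof -
  have top: "relation_of_arity (rel_top [fst x] []) [fst x]" by (rule relation_top) (use q in simp)
  have Op: "(\<Union>R\<in>\<R>. comps R Xs []) \<subseteq> Op (concat Xs) []" if "Xs \<in> listset \<X>s" for Xs
    using relation_Op[OF _ that] by (auto simp: \<R>_def)
  show "relation_of_arity (rel_sup \<X>s [] \<R>) \<X>s"
    unfolding relation_of_arity_def rel_sup_def rdom_mk_rel rcod_mk_rel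
  proof (intro conjI refl binary_relation_mk_rel)
    fix Xs Ys a assume "Xs \<in> listset \<X>s" "Ys \<in> listset []" "a \<in> op.span (\<Union>R\<in>\<R>. comps R Xs Ys)"
    then show "a \<in> Op (concat Xs) (concat Ys)"
      using op.span_minimal[OF Op Op_subspace] by auto
  qed (use q in auto)
  define C where "C = (\<lambda>Xs. {a \<in> Op (concat Xs) []. \<forall>X\<in>fst x. \<forall>T\<in>supported (idx [X]).
      ktensor 1 T (coord Xs a) \<in> amps S (X # Xs)})"
  have subC: "op.subspace (C Xs)" for Xs
    using fn.subspace_0[OF amps_subspace[OF S]] fn.subspace_add[OF amps_subspace[OF S]]
      fn.subspace_scale[OF amps_subspace[OF S]] unfolding C_def
    by (intro op.subspaceI) (simp_all add: Op_zero Op_plus Op_mult coord_zero coord_add coord_scale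
        ktensor_zero_right ktensor_add_right ktensor_scale_right)
  fix Xs assume Xs: "Xs \<in> listset \<X>s"
  have atom: "atom X" if "X \<in> set Xs" for X by (rule qsets_atoms[OF Xs q(2) that])
  have single: "[X] \<in> listset [fst x]" if "X \<in> fst x" for X using that by (simp add: set_Cons_def)
  have amps1: "amps (rel_top [fst x] []) [X] = supported (idx [X])" if "X \<in> fst x" for X
    by (rule amps_top) (use q(1) single[OF that] in auto)
  have "comps (rel_sup \<X>s [] \<R>) Xs [] = C Xs"
  proof
    have "(\<Union>R\<in>\<R>. comps R Xs []) \<subseteq> C Xs"
    proof clarify
      fix R a assume "R \<in> \<R>" and a: "a \<in> comps R Xs []"
      then have R: "relation_of_arity R \<X>s" "rel_le (rel_times (rel_top [fst x] []) R) S" by (simp_all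
          add: \<R>_def)
      have "ktensor 1 T (coord Xs a) \<in> amps S (X # Xs)" if X: "X \<in> fst x" and T: "T \<in> supported (idx
          [X])" for X T
      proof -
        have "ktensor 1 T (coord Xs a) \<in> amps (rel_times (rel_top [fst x] []) R) ([X] @ Xs)"
          unfolding amps_times[OF top R(1) single[OF X] Xs] amps1[OF X]
          using T a by (intro fn.span_base) (auto simp: amps_def)
        also have "\<dots> \<subseteq> amps S ([X] @ Xs)"
          using R(2) by (auto simp: amps_def rel_le_def)
        finally show ?thesis by simp
      qed
      then show "a \<in> C Xs" using relation_Op[OF R(1) Xs a] by (simp add: C_def)
    qed
    then have "op.span (\<Union>R\<in>\<R>. comps R Xs []) \<subseteq> C Xs" using subC by (rule op.span_minimal)
    then show "comps (rel_sup \<X>s [] \<R>) Xs [] \<subseteq> C Xs" using Xs by (simp add: rel_sup_def comps_mk_rel)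
    \<comment> \<open>The largest relation \<open>R\<close> with \<open>\<top> \<times> R \<le> S\<close>.\<close>
    define R0 where "R0 = mk_rel \<X>s [] (\<lambda>Xs _. C Xs)"
    have R0: "relation_of_arity R0 \<X>s"
      unfolding relation_of_arity_def R0_def rdom_mk_rel rcod_mk_rel
      using subC q(2) by (intro conjI refl binary_relation_mk_rel) (auto simp: C_def)
    have "comps (rel_times (rel_top [fst x] []) R0) Zs Ws \<subseteq> comps S Zs Ws" for Zs Ws
    proof (cases "Zs \<in> listset ([fst x] @ \<X>s) \<and> Ws = []")
      case False
      then have "comps (rel_times (rel_top [fst x] []) R0) Zs Ws = {0}"
        using relation_times[OF top R0] by (intro binary_relation_off) (auto simp:
            relation_of_arity_def)
      then show ?thesis
        using S op.subspace_0[OF binary_relation_subspace[of S]] by (simp add: relation_of_arity_def)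
    next
      case True
      then obtain X Ys where Zs: "Zs = [X] @ Ys" "X \<in> fst x" "Ys \<in> listset \<X>s"
        by (auto simp: set_Cons_def)
      have atomX: "atom Z" if "Z \<in> set [X]" for Z using that Zs(2) q(1) by (simp add: qset_def)
      have atomY: "atom Z" if "Z \<in> set Ys" for Z by (rule qsets_atoms[OF Zs(3) q(2) that])
      have XYs: "X # Ys \<in> listset (fst x # \<X>s)" using Zs by (simp add: set_Cons_def)
      have "{op_tensor (concat [X]) [] (concat Ys) [] r s |r s.
          r \<in> comps (rel_top [fst x] []) [X] [] \<and> s \<in> comps R0 Ys []} \<subseteq> comps S (X # Ys) []"
      proof clarify
        fix r s assume r: "r \<in> comps (rel_top [fst x] []) [X] []" and s: "s \<in> comps R0 Ys []"
        have s': "s \<in> C Ys" using s Zs(3) by (simp add: R0_def comps_mk_rel)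
        let ?t = "op_tensor (concat [X]) [] (concat Ys) [] r s"
        have rs: "r \<in> Op (concat [X]) []" "s \<in> Op (concat Ys) []"
          using relation_Op[OF top single[OF Zs(2)] r] relation_Op[OF R0 Zs(3) s] by auto
        have "coord ([X] @ Ys) ?t = ktensor 1 (coord [X] r) (coord Ys s)"
          using coord_op_tensor[OF atomX atomY rs] by simp
        also have "\<dots> \<in> amps S (X # Ys)"
          using s' Zs(2) coord_supported[of "[X]" r] by (simp add: C_def)
        finally have "coord (X # Ys) ?t \<in> amps S (X # Ys)" by simp
        moreover have "?t \<in> Op (concat (X # Ys)) []"
          using op_tensor_Op[OF concat_atoms[OF atomX] concat_atoms[OF atomY] rs] by simp
        ultimately show "?t \<in> comps S (X # Ys) []" using amps_iff[OF S XYs] by blast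
      qed
      then have "op.span {op_tensor (concat [X]) [] (concat Ys) [] r s |r s.
          r \<in> comps (rel_top [fst x] []) [X] [] \<and> s \<in> comps R0 Ys []} \<subseteq> comps S (X # Ys) []"
        using relation_subspace[OF S] by (rule op.span_minimal)
      then show ?thesis
        using True comps_times[OF top R0 single[OF Zs(2)] Zs(3)] Zs(1) by simp
    qed
    then have "rel_le (rel_times (rel_top [fst x] []) R0) S"
      using relation_times[OF top R0] S by (simp add: rel_le_def relation_of_arity_def)
    then have "R0 \<in> \<R>" using R0 by (simp add: \<R>_def)
    moreover have "C Xs = comps R0 Xs []" using Xs by (simp add: R0_def comps_mk_rel)
    ultimately show "C Xs \<subseteq> comps (rel_sup \<X>s [] \<R>) Xs []"
      using Xs by (auto simp: rel_sup_def comps_mk_rel intro!: op.span_base)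
  qed
  then have "amps (rel_sup \<X>s [] \<R>) Xs = coord Xs ` C Xs" by (simp add: amps_def)
  also have "\<dots> = {K \<in> supported (idx Xs). \<forall>X\<in>fst x. \<forall>T\<in>supported (idx [X]). ktensor 1 T K \<in> amps S (X #
      Xs)}"
    unfolding C_def by (rule coord_image_Collect[OF atom])
  finally show "amps (rel_sup \<X>s [] \<R>) Xs =
      {K \<in> supported (idx Xs). \<forall>X\<in>fst x. \<forall>T\<in>supported (idx [X]). ktensor 1 T K \<in> amps S (X # Xs)}" .
qed

lemma relation_interp_core:
  "core_wf \<phi> \<Longrightarrow> fvars \<phi> \<subseteq> set \<Gamma> \<Longrightarrow> (\<And>x. x \<in> set \<Gamma> \<Longrightarrow> qset (fst x)) \<Longrightarrow>
    relation_of_arity (interp_core \<phi> \<Gamma>) (map fst \<Gamma>)"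
proof (induction \<phi> arbitrary: \<Gamma>)
  case (Atomic R ts)
  then obtain vs where vs: "ts = map Var vs" "distinct vs" "relation_of_arity R (map fst vs)" by auto
  show ?case
    unfolding vs(1) using Atomic.prems(2) vs(1) by (intro relation_atomic vs(2,3) Atomic.prems(3)) auto
next
  case (Forall x \<phi>)
  have "relation_of_arity (interp_core \<phi> (x # \<Gamma>)) (map fst (x # \<Gamma>))"
    using Forall.prems by (intro Forall.IH) auto
  then show ?case
    unfolding interp_core.simps using Forall.prems by (intro relation_forall) auto
qed (simp_all add: relation_neg relation_inf)

section \<open>Reordering a context\<close>

lemma amps_interp_Neg:
  "relation_of_arity (interp_core \<phi> \<Gamma>) (map fst \<Gamma>) \<Longrightarrow> Xs \<in> listset (map fst \<Gamma>) \<Longrightarrow>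
    amps (interp_core (Neg \<phi>) \<Gamma>) Xs = ortho (idx Xs) (amps (interp_core \<phi> \<Gamma>) Xs)"
  by (simp add: amps_neg)

lemma amps_interp_Conj:
  "relation_of_arity (interp_core \<phi> \<Gamma>) (map fst \<Gamma>) \<Longrightarrow> relation_of_arity (interp_core \<psi> \<Gamma>) (map fst \<Gamma>) \<Longrightarrow>
    Xs \<in> listset (map fst \<Gamma>) \<Longrightarrow>
    amps (interp_core (Conj \<phi> \<psi>) \<Gamma>) Xs = amps (interp_core \<phi> \<Gamma>) Xs \<inter> amps (interp_core \<psi> \<Gamma>) Xs"
  by (simp add: amps_inf)

lemma amps_interp_Forall:
  assumes "qset (fst x)" "\<And>y. y \<in> set \<Gamma> \<Longrightarrow> qset (fst y)"
    and "relation_of_arity (interp_core \<phi> (x # \<Gamma>)) (map fst (x # \<Gamma>))" "Xs \<in> listset (map fst \<Gamma>)"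
  shows "amps (interp_core (Forall x \<phi>) \<Gamma>) Xs = {K \<in> supported (idx Xs).
    \<forall>X\<in>fst x. \<forall>T\<in>supported (idx [X]). ktensor 1 T K \<in> amps (interp_core \<phi> (x # \<Gamma>)) (X # Xs)}"
  unfolding interp_core.simps using assms by (intro amps_forall) auto

text \<open>
  Precomposition with \<open>u\<^sub>\<sigma>\<close>, in coordinates.
\<close>

definition pull :: "nat list \<Rightarrow> 'v::complex_inner atom list \<Rightarrow> ('v list list \<Rightarrow> complex) \<Rightarrow> 'v list list \<Rightarrow>
    complex" where
  "pull \<sigma> Xs K = (\<lambda>es. if es \<in> idx Xs then K (permute \<sigma> es) else 0)"

lemma pull_supported: "pull \<sigma> Xs K \<in> supported (idx Xs)"
  by (simp add: pull_def supported_def)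

lemma permute_idx_bij:
  assumes "perm_list \<sigma> (length Xs)"
  shows "bij_betw (permute \<sigma>) (idx Xs) (idx (permute \<sigma> Xs))"
proof (rule bij_betwI')
  show "permute \<sigma> es = permute \<sigma> fs \<longleftrightarrow> es = fs" if "es \<in> idx Xs" "fs \<in> idx Xs" for es fs
    using permute_inject[OF assms idx_length[OF that(1)] idx_length[OF that(2)]] by auto
  show "permute \<sigma> es \<in> idx (permute \<sigma> Xs)" if "es \<in> idx Xs" for es
    using idx_permute[OF assms refl idx_length[OF that]] that by simp
  show "\<exists>es\<in>idx Xs. es' = permute \<sigma> es" if es': "es' \<in> idx (permute \<sigma> Xs)" for es'
  proof -
    have "length es' = length Xs" using idx_length[OF es'] perm_list_length[OF assms] by simp
    then obtain es where "length es = length Xs" "permute \<sigma> es = es'" by (rule permute_surj[OF assms])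
    then show ?thesis using idx_permute[OF assms refl, of es] es' by auto
  qed
qed

lemma dotp_pull:
  assumes "perm_list \<sigma> (length Xs)"
  shows "dotp (idx Xs) (pull \<sigma> Xs K) (pull \<sigma> Xs L) = dotp (idx (permute \<sigma> Xs)) K L"
  unfolding dotp_def using sum.reindex_bij_betw[OF permute_idx_bij[OF assms], of "\<lambda>es. cnj (K es) * L
      es"]
  by (simp add: pull_def)

lemma pull_surj:
  assumes "perm_list \<sigma> (length Xs)" "M \<in> supported (idx Xs)"
  obtains K where "K \<in> supported (idx (permute \<sigma> Xs))" "pull \<sigma> Xs K = M"
proof
  define K where "K = (\<lambda>es'. if es' \<in> idx (permute \<sigma> Xs) then M (inv_into (idx Xs) (permute \<sigma>) es') else
      0)"
  show "K \<in> supported (idx (permute \<sigma> Xs))" by (simp add: K_def supported_def)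
  note bij = permute_idx_bij[OF assms(1)]
  show "pull \<sigma> Xs K = M"
  proof
    fix es show "pull \<sigma> Xs K es = M es"
    proof (cases "es \<in> idx Xs")
      case True
      then have "inv_into (idx Xs) (permute \<sigma>) (permute \<sigma> es) = es" "permute \<sigma> es \<in> idx (permute \<sigma> Xs)"
        using bij_betw_inv_into_left[OF bij True] bij_betwE[OF bij] by blast+
      then show ?thesis using True by (simp add: pull_def K_def)
    next
      case False
      then show ?thesis using assms(2) by (simp add: pull_def supported_def)
    qed
  qed
qed

lemma perm_list_Cons: "perm_list \<sigma> n \<Longrightarrow> perm_list (0 # map Suc \<sigma>) (Suc n)"
  by (auto simp: perm_list_def distinct_map image_iff less_Suc_eq_0_disj)

lemma permute_Cons: "permute (0 # map Suc \<sigma>) (x # xs) = x # permute \<sigma> xs"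
  by simp

lemma set_permute: "perm_list \<sigma> (length xs) \<Longrightarrow> set (permute \<sigma> xs) = set xs"
  by (simp add: perm_list_def image_def set_conv_nth[of xs]) blast

lemma permute_tuple:
  assumes "perm_list \<sigma> (length \<Gamma>)" "Xs \<in> listset (map fst \<Gamma>)"
  shows "permute \<sigma> Xs \<in> listset (map fst (permute \<sigma> \<Gamma>))"
proof -
  have less: "i < length \<Gamma>" if "i \<in> set \<sigma>" for i
    using that assms(1) by (simp add: perm_list_def)
  then have "permute \<sigma> (map fst \<Gamma>) = map fst (permute \<sigma> \<Gamma>)" by simp
  moreover have "permute \<sigma> Xs \<in> listset (permute \<sigma> (map fst \<Gamma>))"
    using less listset_length[OF assms(2)] assms(2) by (intro permute_listset) simp_all
  ultimately show ?thesis by metis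
qed

lemma relation_interp_core_permute:
  assumes "perm_list \<sigma> (length \<Gamma>)" "core_wf \<phi>" "fvars \<phi> \<subseteq> set \<Gamma>" "\<And>x. x \<in> set \<Gamma> \<Longrightarrow> qset (fst x)"
  shows "relation_of_arity (interp_core \<phi> (permute \<sigma> \<Gamma>)) (map fst (permute \<sigma> \<Gamma>))"
  by (rule relation_interp_core[OF assms(2)]) (use assms(3,4) set_permute[OF assms(1)] in blast)+

lemma pull_ktensor:
  assumes "T \<in> supported (idx [X])"
  shows "pull (0 # map Suc \<sigma>) (X # Xs) (ktensor 1 T K) = ktensor 1 T (pull \<sigma> Xs K)"
proof
  fix es
  show "pull (0 # map Suc \<sigma>) (X # Xs) (ktensor 1 T K) es = ktensor 1 T (pull \<sigma> Xs K) es"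
  proof (cases es)
    case Nil
    then have "es \<notin> idx (X # Xs)" "es \<notin> idx [X]" by (auto dest: idx_length)
    then show ?thesis using assms Nil by (simp add: pull_def ktensor_def supported_def)
  next
    case (Cons e es')
    then show ?thesis
      using assms by (auto simp: pull_def ktensor_def idx_Cons supported_def comp_def)
  qed
qed

text \<open>
  Reordering the context by \<open>\<sigma>\<close> amounts to precomposing with \<open>u\<^sub>\<sigma>\<close>.  The hypothesis on positions
  says that \<open>\<sigma>\<close> respects the hiding of repeated variables; it is inherited when a quantifier puts a
  further variable in front, even one that occurs in the context already.
\<close>

lemma interp_core_permute:
  assumes "perm_list \<sigma> (length \<Gamma>)" "\<And>x. x \<in> set \<Gamma> \<Longrightarrow> position \<Gamma> x = \<sigma> ! position (permute \<sigma> \<Gamma>) x"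
    and "core_wf \<phi>" "fvars \<phi> \<subseteq> set \<Gamma>" "\<And>x. x \<in> set \<Gamma> \<Longrightarrow> qset (fst x)"
    and "Xs \<in> listset (map fst \<Gamma>)" "K \<in> supported (idx (permute \<sigma> Xs))"
  shows "K \<in> amps (interp_core \<phi> (permute \<sigma> \<Gamma>)) (permute \<sigma> Xs) \<longleftrightarrow> pull \<sigma> Xs K \<in> amps (interp_core \<phi> \<Gamma>)
      Xs"
  using assms
proof (induction \<phi> arbitrary: \<sigma> \<Gamma> Xs K)
  case (Atomic R ts)
  let ?\<Gamma>' = "permute \<sigma> \<Gamma>" and ?Xs' = "permute \<sigma> Xs"
  note \<sigma> = Atomic.prems(1)
  have len: "length Xs = length \<Gamma>" using listset_length[OF Atomic.prems(6)] by simp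
  have lenr: "length ?\<Gamma>' = length \<Gamma>" using perm_list_length[OF \<sigma>] by simp
  have \<sigma>X: "perm_list \<sigma> (length Xs)" using \<sigma> len by simp
  obtain vs where vs: "ts = map Var vs" "distinct vs" "relation_of_arity R (map fst vs)"
    using Atomic.prems(3) by auto
  have sub: "set vs \<subseteq> set \<Gamma>" using Atomic.prems(4) vs(1) by auto
  have sub': "set vs \<subseteq> set ?\<Gamma>'" using sub set_permute[OF \<sigma>] by blast
  have q': "qset (fst x)" if "x \<in> set ?\<Gamma>'" for x using that Atomic.prems(5) set_permute[OF \<sigma>] by blast
  have Xs': "?Xs' \<in> listset (map fst ?\<Gamma>')"
    using \<sigma> Atomic.prems(6) by (rule permute_tuple)
  define ps where "ps = map (position \<Gamma>) vs"
  define ps' where "ps' = map (position ?\<Gamma>') vs"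
  have ps'_less: "i < length \<Gamma>" if "i \<in> set ps'" for i
    using that sub' position_less[of _ ?\<Gamma>'] lenr by (auto simp: ps'_def)
  have ps: "ps = map ((!) \<sigma>) ps'"
    using Atomic.prems(2) sub by (auto simp: ps_def ps'_def)
  have pp: "permute ps' (permute \<sigma> l) = permute ps l" for l :: "'b list"
    using ps'_less perm_list_length[OF \<sigma>] by (simp add: ps)
  have mem: "i \<in> set ps' \<longleftrightarrow> \<sigma> ! i \<in> set ps" if "i < length \<Gamma>" for i
  proof
    assume "\<sigma> ! i \<in> set ps"
    then obtain j where j: "j \<in> set ps'" "\<sigma> ! i = \<sigma> ! j" by (auto simp: ps)
    then have "i = j"
      using \<sigma> that ps'_less[OF j(1)] perm_list_length[OF \<sigma>] by (simp add: perm_list_def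
          nth_eq_iff_index_eq)
    then show "i \<in> set ps'" using j by simp
  qed (simp add: ps)
  have agree: "(\<forall>i<length \<Gamma>. i \<notin> set ps' \<longrightarrow> permute \<sigma> fs ! i = permute \<sigma> es ! i) \<longleftrightarrow>
      (\<forall>j<length \<Gamma>. j \<notin> set ps \<longrightarrow> fs ! j = es ! j)" for fs es :: "'a list list"
  proof -
    have "(\<forall>i<length \<Gamma>. i \<notin> set ps' \<longrightarrow> permute \<sigma> fs ! i = permute \<sigma> es ! i) \<longleftrightarrow>
        (\<forall>i<length \<Gamma>. \<sigma> ! i \<notin> set ps \<longrightarrow> fs ! (\<sigma> ! i) = es ! (\<sigma> ! i))"
      using mem perm_list_length[OF \<sigma>] by auto
    also have "\<dots> \<longleftrightarrow> (\<forall>j<length \<Gamma>. j \<notin> set ps \<longrightarrow> fs ! j = es ! j)"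
      by (metis perm_list_inv[OF \<sigma>] perm_list_nth[OF \<sigma>])
    finally show ?thesis .
  qed
  have img: "idx ?Xs' = permute \<sigma> ` idx Xs" using permute_idx_bij[OF \<sigma>X] by (simp add: bij_betw_def)
  have "K \<in> amps (interp_core (Atomic R ts) ?\<Gamma>') ?Xs' \<longleftrightarrow> (\<forall>es\<in>idx ?Xs'. \<exists>r\<in>amps R (permute ps Xs).
      \<forall>fs\<in>idx ?Xs'.
      (\<forall>i<length \<Gamma>. i \<notin> set ps' \<longrightarrow> fs ! i = es ! i) \<longrightarrow> K fs = r (permute ps' fs))"
    using amps_atomic[OF vs(3,2) sub' q' Xs', of K] Atomic.prems(7) pp[of Xs]
    unfolding vs(1) ps'_def[symmetric] lenr by simp
  also have "\<dots> \<longleftrightarrow> (\<forall>es\<in>idx Xs. \<exists>r\<in>amps R (permute ps Xs). \<forall>fs\<in>idx Xs.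
      (\<forall>i<length \<Gamma>. i \<notin> set ps \<longrightarrow> fs ! i = es ! i) \<longrightarrow> pull \<sigma> Xs K fs = r (permute ps fs))"
    unfolding img ball_simps agree pp by (simp add: pull_def)
  also have "\<dots> \<longleftrightarrow> pull \<sigma> Xs K \<in> amps (interp_core (Atomic R ts) \<Gamma>) Xs"
    using amps_atomic[OF vs(3,2) sub Atomic.prems(5,6), of "pull \<sigma> Xs K"] pull_supported[of \<sigma> Xs K]
    unfolding vs(1) ps_def[symmetric] by simp
  finally show ?case .
next
  case (Neg \<phi>)
  let ?\<Gamma>' = "permute \<sigma> \<Gamma>" and ?Xs' = "permute \<sigma> Xs"
  note \<sigma> = Neg.prems(1)
  have len: "length Xs = length \<Gamma>" using listset_length[OF Neg.prems(6)] by simp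
  have \<sigma>X: "perm_list \<sigma> (length Xs)" using \<sigma> len by simp
  have wf: "core_wf \<phi>" "fvars \<phi> \<subseteq> set \<Gamma>" using Neg.prems(3,4) by auto
  have Xs': "?Xs' \<in> listset (map fst ?\<Gamma>')"
    using \<sigma> Neg.prems(6) by (rule permute_tuple)
  have rel: "relation_of_arity (interp_core \<phi> \<Gamma>) (map fst \<Gamma>)"
    using wf Neg.prems(5) by (rule relation_interp_core)
  have rel': "relation_of_arity (interp_core \<phi> ?\<Gamma>') (map fst ?\<Gamma>')"
    by (rule relation_interp_core_permute[OF \<sigma> wf Neg.prems(5)])
  have IH: "L \<in> amps (interp_core \<phi> ?\<Gamma>') ?Xs' \<longleftrightarrow> pull \<sigma> Xs L \<in> amps (interp_core \<phi> \<Gamma>) Xs"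
    if "L \<in> supported (idx ?Xs')" for L
    using Neg.IH[OF Neg.prems(1,2) wf Neg.prems(5,6) that] .
  have "(\<forall>L\<in>amps (interp_core \<phi> ?\<Gamma>') ?Xs'. dotp (idx ?Xs') L K = 0) \<longleftrightarrow>
      (\<forall>M\<in>amps (interp_core \<phi> \<Gamma>) Xs. dotp (idx Xs) M (pull \<sigma> Xs K) = 0)"
  proof
    assume *: "\<forall>L\<in>amps (interp_core \<phi> ?\<Gamma>') ?Xs'. dotp (idx ?Xs') L K = 0"
    show "\<forall>M\<in>amps (interp_core \<phi> \<Gamma>) Xs. dotp (idx Xs) M (pull \<sigma> Xs K) = 0"
    proof
      fix M assume M: "M \<in> amps (interp_core \<phi> \<Gamma>) Xs"
      then have "M \<in> supported (idx Xs)" using amps_supported[OF rel] by blast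
      then obtain L where L: "L \<in> supported (idx ?Xs')" "pull \<sigma> Xs L = M" by (rule pull_surj[OF \<sigma>X])
      then show "dotp (idx Xs) M (pull \<sigma> Xs K) = 0"
        using * M IH[OF L(1)] dotp_pull[OF \<sigma>X, of L K] by simp
    qed
  next
    assume *: "\<forall>M\<in>amps (interp_core \<phi> \<Gamma>) Xs. dotp (idx Xs) M (pull \<sigma> Xs K) = 0"
    show "\<forall>L\<in>amps (interp_core \<phi> ?\<Gamma>') ?Xs'. dotp (idx ?Xs') L K = 0"
    proof
      fix L assume L: "L \<in> amps (interp_core \<phi> ?\<Gamma>') ?Xs'"
      then have "L \<in> supported (idx ?Xs')" using amps_supported[OF rel'] by blast
      then show "dotp (idx ?Xs') L K = 0" using * L IH dotp_pull[OF \<sigma>X, of L K] by simp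
    qed
  qed
  then show ?case
    unfolding amps_interp_Neg[OF rel Neg.prems(6)] amps_interp_Neg[OF rel' Xs'] ortho_def
    using Neg.prems(7) pull_supported[of \<sigma> Xs K] by simp
next
  case (Conj \<phi> \<psi>)
  let ?\<Gamma>' = "permute \<sigma> \<Gamma>" and ?Xs' = "permute \<sigma> Xs"
  note \<sigma> = Conj.prems(1)
  have len: "length Xs = length \<Gamma>" using listset_length[OF Conj.prems(6)] by simp
  have wf: "core_wf \<phi>" "core_wf \<psi>" "fvars \<phi> \<subseteq> set \<Gamma>" "fvars \<psi> \<subseteq> set \<Gamma>" using Conj.prems(3,4) by auto
  have Xs': "?Xs' \<in> listset (map fst ?\<Gamma>')"
    using \<sigma> Conj.prems(6) by (rule permute_tuple)
  have rel: "relation_of_arity (interp_core \<chi> \<Gamma>) (map fst \<Gamma>)" if "core_wf \<chi>" "fvars \<chi> \<subseteq> set \<Gamma>" for \<chi>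
    using that Conj.prems(5) by (rule relation_interp_core)
  have rel': "relation_of_arity (interp_core \<chi> ?\<Gamma>') (map fst ?\<Gamma>')" if "core_wf \<chi>" "fvars \<chi> \<subseteq> set \<Gamma>" for
      \<chi>
    by (rule relation_interp_core_permute[OF \<sigma> that Conj.prems(5)])
  show ?case
    unfolding amps_interp_Conj[OF rel[OF wf(1,3)] rel[OF wf(2,4)] Conj.prems(6)]
      amps_interp_Conj[OF rel'[OF wf(1,3)] rel'[OF wf(2,4)] Xs'] Int_iff
    using Conj.IH(1)[OF Conj.prems(1,2) wf(1,3) Conj.prems(5-7)]
      Conj.IH(2)[OF Conj.prems(1,2) wf(2,4) Conj.prems(5-7)] by simp
next
  case (Forall x \<phi>)
  let ?\<Gamma>' = "permute \<sigma> \<Gamma>" and ?Xs' = "permute \<sigma> Xs" and ?\<sigma> = "0 # map Suc \<sigma>"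
  note \<sigma> = Forall.prems(1)
  have len: "length Xs = length \<Gamma>" using listset_length[OF Forall.prems(6)] by simp
  have qx: "qset (fst x)" and wf: "core_wf \<phi>" "fvars \<phi> \<subseteq> set (x # \<Gamma>)" using Forall.prems(3,4) by auto
  have q: "qset (fst y)" if "y \<in> set (x # \<Gamma>)" for y
    using that qx Forall.prems(5)[of y] by (cases "y = x") simp_all
  have Xs': "?Xs' \<in> listset (map fst ?\<Gamma>')"
    using \<sigma> Forall.prems(6) by (rule permute_tuple)
  have rel: "relation_of_arity (interp_core \<phi> (x # \<Gamma>)) (map fst (x # \<Gamma>))"
    using wf q by (rule relation_interp_core)
  have rel': "relation_of_arity (interp_core \<phi> (x # ?\<Gamma>')) (map fst (x # ?\<Gamma>'))"
    by (rule relation_interp_core[OF wf(1)]) (use wf(2) q set_permute[OF \<sigma>] in auto)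
  have q': "qset (fst y)" if "y \<in> set ?\<Gamma>'" for y using that Forall.prems(5) set_permute[OF \<sigma>] by blast
  have \<sigma>': "perm_list ?\<sigma> (length (x # \<Gamma>))" using perm_list_Cons[OF \<sigma>] by simp
  have pos: "position (x # \<Gamma>) y = ?\<sigma> ! position (permute ?\<sigma> (x # \<Gamma>)) y" if y: "y \<in> set (x # \<Gamma>)" for y
  proof -
    have "y \<in> set (x # ?\<Gamma>')" using y set_permute[OF \<sigma>] by simp
    moreover have "position ?\<Gamma>' y < length \<sigma>" if "y \<noteq> x"
      using position_less[of y ?\<Gamma>'] y that set_permute[OF \<sigma>] by simp
    ultimately show ?thesis
      unfolding permute_Cons using y Forall.prems(2)[of y]
      by (cases "y = x") (simp_all add: position_Cons)
  qed
  have "ktensor 1 T K \<in> amps (interp_core \<phi> (x # ?\<Gamma>')) (X # ?Xs') \<longleftrightarrow>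
      ktensor 1 T (pull \<sigma> Xs K) \<in> amps (interp_core \<phi> (x # \<Gamma>)) (X # Xs)"
    if X: "X \<in> fst x" and T: "T \<in> supported (idx [X])" for X T
  proof -
    have "X # Xs \<in> listset (map fst (x # \<Gamma>))" using X Forall.prems(6) by (simp add: set_Cons_def)
    moreover have "ktensor 1 T K \<in> supported (idx (permute ?\<sigma> (X # Xs)))"
      using ktensor_supported[OF T Forall.prems(7)] by (simp add: comp_def)
    ultimately show ?thesis
      using Forall.IH[OF \<sigma>' pos wf q, of "X # Xs" "ktensor 1 T K"]
      unfolding permute_Cons pull_ktensor[OF T] by blast
  qed
  moreover have "amps (interp_core (Forall x \<phi>) \<Gamma>) Xs = {K \<in> supported (idx Xs).
      \<forall>X\<in>fst x. \<forall>T\<in>supported (idx [X]). ktensor 1 T K \<in> amps (interp_core \<phi> (x # \<Gamma>)) (X # Xs)}"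
    by (rule amps_interp_Forall[OF qx _ rel Forall.prems(6)]) (rule Forall.prems(5))
  moreover have "amps (interp_core (Forall x \<phi>) ?\<Gamma>') ?Xs' = {K \<in> supported (idx ?Xs').
      \<forall>X\<in>fst x. \<forall>T\<in>supported (idx [X]). ktensor 1 T K \<in> amps (interp_core \<phi> (x # ?\<Gamma>')) (X # ?Xs')}"
    by (rule amps_interp_Forall[OF qx _ rel' Xs']) (rule q')
  ultimately show ?case
    using Forall.prems(7) pull_supported[of \<sigma> Xs K] by (simp del: interp_core.simps)
qed

section \<open>Formulas without function symbols\<close>

lemma qset_dual: "qset \<X> \<Longrightarrow> qset (dual \<X>)"
  by (auto simp: qset_def dual_def)

lemma binary_relation_id: "(\<And>\<X>. \<X> \<in> set \<X>s \<Longrightarrow> qset \<X>) \<Longrightarrow> binary_relation (rel_id \<X>s)"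
  unfolding rel_id_def
proof (rule binary_relation_mk_rel)
  fix Xs Ys :: "'a atom list" and a
  have "op.span {op_id (concat Xs)} \<subseteq> Op (concat Xs) (concat Xs)"
    by (rule op.span_minimal[OF _ Op_subspace]) (simp add: op_id_Op)
  then show "a \<in> (if Xs = Ys then op.span {op_id (concat Xs)} else {0}) \<Longrightarrow> a \<in> Op (concat Xs) (concat
      Ys)"
    by (auto simp: Op_zero split: if_splits)
qed (auto simp: op.subspace_single_0)

lemma relation_eq:
  assumes "qset \<X>"
  shows "relation_of_arity (rel_eq \<X>) [\<X>, dual \<X>]"
  unfolding relation_of_arity_def rel_eq_def rdom_mk_rel rcod_mk_rel
proof (intro conjI refl binary_relation_mk_rel)
  fix Xs Ys :: "'a atom list" and a
  assume Xs: "Xs \<in> listset [\<X>, dual \<X>]" and Ys: "Ys \<in> listset []"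
  obtain X Y where XY: "Xs = [X, Y]" "X \<in> \<X>" using Xs by (auto simp: set_Cons_def)
  then have "atom X" using assms by (simp add: qset_def)
  then have "op.span {op_eval X} \<subseteq> Op (X @ dual_atom X) []"
    by (intro op.span_minimal[OF _ Op_subspace]) (simp add: op_eval_Op)
  then show "a \<in> (if Xs ! 1 = dual_atom (Xs ! 0) then op.span {op_eval (Xs ! 0)} else {0}) \<Longrightarrow>
      a \<in> Op (concat Xs) (concat Ys)"
    using XY Ys by (auto simp: Op_zero split: if_splits)
qed (use assms qset_dual in \<open>auto simp: op.subspace_single_0\<close>)

lemma binary_relation_comp:
  assumes "binary_relation R" "binary_relation S" "rcod R = rdom S"
  shows "binary_relation (rel_comp S R)"
  unfolding rel_comp_def
proof (rule binary_relation_mk_rel)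
  fix Xs Zs a
  assume Xs: "Xs \<in> listset (rdom R)" and Zs: "Zs \<in> listset (rcod S)"
  let ?G = "{s \<circ> r |s r Ys. Ys \<in> listset (rcod R) \<and> s \<in> comps S Ys Zs \<and> r \<in> comps R Xs Ys}"
  have "?G \<subseteq> Op (concat Xs) (concat Zs)"
  proof clarify
    fix s r Ys assume Ys: "Ys \<in> listset (rcod R)" and s: "s \<in> comps S Ys Zs" and r: "r \<in> comps R Xs Ys"
    show "s \<circ> r \<in> Op (concat Xs) (concat Zs)"
      using binary_relation_Op[OF assms(1) Xs Ys r] binary_relation_Op[OF assms(2) _ Zs s] Ys assms(3)
      by (intro Op_comp[of r _ "concat Ys"]) simp_all
  qed
  then have "op.span ?G \<subseteq> Op (concat Xs) (concat Zs)" by (rule op.span_minimal[OF _ Op_subspace])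
  then show "a \<in> op.span ?G \<Longrightarrow> a \<in> Op (concat Xs) (concat Zs)" by blast
qed (use binary_relation_dom[OF assms(1)] binary_relation_cod[OF assms(2)] in auto)

lemma
  assumes "qfunction F \<X>s \<Y>"
  shows qfunction_qset: "qset \<Y>"
    and relation_hat: "relation_of_arity (rel_hat F) (\<X>s @ [dual \<Y>])"
proof -
  have F: "binary_relation F" "rdom F = \<X>s" "rcod F = [\<Y>]" using assms by (auto simp: qfunction_def)
  show q: "qset \<Y>" using binary_relation_cod[OF F(1)] F(3) by simp
  have id: "binary_relation (rel_id [dual \<Y>])" by (rule binary_relation_id) (simp add: qset_dual q)
  have eq: "binary_relation (rel_eq \<Y>)" "rdom (rel_eq \<Y>) = [\<Y>, dual \<Y>]" "rcod (rel_eq \<Y>) = []"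
    using relation_eq[OF q] by (simp_all add: relation_of_arity_def)
  have "rcod (rel_times F (rel_id [dual \<Y>])) = rdom (rel_eq \<Y>)"
    by (simp add: rel_times_def rel_id_def F(3) eq(2))
  then show "relation_of_arity (rel_hat F) (\<X>s @ [dual \<Y>])"
    using binary_relation_comp[OF binary_relation_times[OF F(1) id] eq(1)] eq(3)
    by (simp add: relation_of_arity_def rel_hat_def F(3) rel_comp_def)
      (simp add: rel_times_def rel_id_def F(2))
qed

lemma nondup_term_qset: "nondup_term t \<X> \<Longrightarrow> qset \<X>"
  by (induction rule: nondup_term.cases) (auto dest: qfunction_qset)

lemma core_wf_Eq:
  assumes "qset (fst x)" "fst y = dual (fst x)" "x \<noteq> y"
  shows "core_wf (Eq x y)"
  unfolding Eq_def core_wf.simps using assms relation_eq[OF assms(1)] by (intro exI[of _ "[x, y]"]) simp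

lemma fvars_Eq: "fvars (Eq x y) = {x, y}"
  by (auto simp: Eq_def)

lemma core_wf_ExistsEq:
  assumes "qset (fst x)" "fst y = dual (fst x)" "x \<noteq> y" "core_wf \<phi>"
  shows "core_wf (ExistsEq x y \<phi>)" and "fvars (ExistsEq x y \<phi>) = fvars \<phi> - {x, y}"
  using core_wf_Eq[OF assms(1-3)] assms qset_dual[OF assms(1)]
  by (auto simp: ExistsEq_def ForallEq_def Imp_def Disj_def fvars_Eq)

lemma core_wf_foldl_ExistsEq:
  assumes "core_wf \<phi>"
    and "\<And>i. i \<in> set is \<Longrightarrow> qset (fst (x i)) \<and> fst (y i) = dual (fst (x i)) \<and> x i \<noteq> y i"
  shows "core_wf (foldl (\<lambda>\<phi> i. ExistsEq (x i) (y i) \<phi>) \<phi> is) \<and>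
    fvars (foldl (\<lambda>\<phi> i. ExistsEq (x i) (y i) \<phi>) \<phi> is) = fvars \<phi> - (\<Union>i\<in>set is. {x i, y i})"
  using assms
proof (induction "is" arbitrary: \<phi>)
  case (Cons i "is")
  then have "core_wf (ExistsEq (x i) (y i) \<phi>)" "fvars (ExistsEq (x i) (y i) \<phi>) = fvars \<phi> - {x i, y i}"
    using core_wf_ExistsEq[of "x i" "y i" \<phi>] by simp_all
  with Cons.IH[of "ExistsEq (x i) (y i) \<phi>"] Cons.prems(2) show ?case by auto
qed simp

lemma core_wf_foldl_Conj:
  "core_wf (foldl Conj \<phi> \<psi>s) \<longleftrightarrow> core_wf \<phi> \<and> (\<forall>\<psi>\<in>set \<psi>s. core_wf \<psi>)"
  "fvars (foldl Conj \<phi> \<psi>s) = fvars \<phi> \<union> (\<Union>\<psi>\<in>set \<psi>s. fvars \<psi>)"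
  by (induction \<psi>s arbitrary: \<phi>) auto

lemma nondup_Var: "nondup_term (Var x) \<X> \<Longrightarrow> \<X> = fst x \<and> qset \<X>"
  by (auto elim: nondup_term.cases)

lemma core_wf_atomic_vars:
  assumes "relation_of_arity R \<Y>s" "list_all2 nondup_term ts \<Y>s" "no_shared_var ts" "\<forall>t\<in>set ts. is_Var
      t"
  shows "core_wf (Atomic R ts)"
  unfolding core_wf.simps
proof (intro exI conjI)
  have ts: "ts ! i = Var (the_var (ts ! i))" if "i < length ts" for i
    using assms(4) that by (metis nth_mem trm.collapse(1))
  show "ts = map Var (map the_var ts)"
    by (rule nth_equalityI) (use ts in auto)
  show "distinct (map the_var ts)"
    unfolding distinct_conv_nth
  proof (intro allI impI)
    fix i j assume ij: "i < length (map the_var ts)" "j < length (map the_var ts)" "i \<noteq> j"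
    then have "tvars (ts ! i) \<inter> tvars (ts ! j) = {}" using assms(3) by (simp add: no_shared_var_def)
    moreover have "tvars (ts ! i) = {the_var (ts ! i)}" "tvars (ts ! j) = {the_var (ts ! j)}"
      using ts ij by (metis length_map tvars.simps(1))+
    ultimately show "map the_var ts ! i \<noteq> map the_var ts ! j" using ij by auto
  qed
  have "map fst (map the_var ts) = \<Y>s"
  proof (rule nth_equalityI)
    show "length (map fst (map the_var ts)) = length \<Y>s" using assms(2) by (simp add: list_all2_lengthD)
    fix i assume "i < length (map fst (map the_var ts))"
    then show "map fst (map the_var ts) ! i = \<Y>s ! i"
      using list_all2_nthD[OF assms(2), of i] ts[of i] nondup_Var[of "the_var (ts ! i)" "\<Y>s ! i"] by
          simp
  qed
  then show "relation_of_arity R (map fst (map the_var ts))" using assms(1) by simp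
qed

lemma nondup_App:
  assumes "nondup_term (App F ss) \<Y>"
  obtains \<X>s where "qfunction F \<X>s \<Y>" "list_all2 nondup_term ss \<X>s" "no_shared_var ss"
  using assms by (cases rule: nondup_term.cases) (auto elim: list_all2_mono)

lemma no_shared_var_snoc:
  assumes "no_shared_var ss" "\<And>t. t \<in> set ss \<Longrightarrow> y \<notin> tvars t"
  shows "no_shared_var (ss @ [Var y])"
  using assms by (auto simp: no_shared_var_def nth_append less_Suc_eq in_set_conv_nth)

text \<open>
  All variables in sight have indices below \<open>k\<close> and the new ones have indices from \<open>k\<close> on, so that no
  variable is ever duplicated; this is what nonduplication of the original formula is for.
\<close>

lemma graph_expand_atom_wf:
  fixes t :: "'v::complex_inner trm" and R :: "'v brel"
  shows "nondup_term t \<Y> \<Longrightarrow> fst y' = dual \<Y> \<Longrightarrow> y' \<notin> tvars t \<Longrightarrow> snd y' < k \<Longrightarrow> (\<forall>x\<in>tvars t. snd x < k) \<Longrightarrow>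
    core_wf (graph k t y') \<and> fvars (graph k t y') \<subseteq> insert y' (tvars t)"
  and "relation_of_arity R \<Y>s \<Longrightarrow> list_all2 nondup_term ts \<Y>s \<Longrightarrow> no_shared_var ts \<Longrightarrow>
    (\<forall>t\<in>set ts. \<forall>x\<in>tvars t. snd x < k) \<Longrightarrow>
    core_wf (expand_atom k R ts) \<and> fvars (expand_atom k R ts) \<subseteq> (\<Union>t\<in>set ts. tvars t)"
proof (induction k t y' and k R ts arbitrary: \<Y> and \<Y>s rule: graph_expand_atom.induct)
  case (1 k x y')
  then show ?case
    using nondup_Var[of x \<Y>] core_wf_Eq[of x y'] by (auto simp: fvars_Eq)
next
  case (2 k F ss y')
  obtain \<X>s where F: "qfunction F \<X>s \<Y>" "list_all2 nondup_term ss \<X>s" "no_shared_var ss"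
    using 2(2) by (rule nondup_App)
  have "nondup_term (Var y') (dual \<Y>)"
    using nondup_term.intros(1)[of y'] qset_dual[OF qfunction_qset[OF F(1)]] 2(3) by simp
  then have "list_all2 nondup_term (ss @ [Var y']) (\<X>s @ [dual \<Y>])"
    using F(2) by (simp add: list_all2_appendI)
  moreover have "no_shared_var (ss @ [Var y'])"
    using F(3) 2(4) by (intro no_shared_var_snoc) auto
  moreover have "\<forall>t\<in>set (ss @ [Var y']). \<forall>x\<in>tvars t. snd x < k" using 2(5,6) by auto
  ultimately have "core_wf (expand_atom k (rel_hat F) (ss @ [Var y'])) \<and>
      fvars (expand_atom k (rel_hat F) (ss @ [Var y'])) \<subseteq> (\<Union>t\<in>set (ss @ [Var y']). tvars t)"
    by (rule "2.IH"[OF relation_hat[OF F(1)]])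
  then show ?case unfolding graph.simps by auto
next
  case (3 k R ts)
  show ?case
  proof (cases "\<forall>t\<in>set ts. is_Var t")
    case True
    then show ?thesis
      using core_wf_atomic_vars[OF 3(2-4) True] by (subst (1 2) expand_atom.simps) simp
  next
    case False
    define n where "n = length ts"
    define y where "y = (\<lambda>i. (rdom R ! i, k + 2 * i))"
    define y' where "y' = (\<lambda>i. (dual (rdom R ! i), k + 2 * i + 1))"
    define body where "body = foldl Conj (Atomic R (map (\<lambda>i. Var (y i)) [0..<n]))
             (map (\<lambda>i. graph (k + 2 * n) (ts ! i) (y' i)) [0..<n])"
    have eq: "expand_atom k R ts = foldl (\<lambda>\<phi> i. ExistsEq (y i) (y' i) \<phi>) body [0..<n]"
      unfolding expand_atom.simps[of k R ts] if_not_P[OF False] Let_def n_def y_def y'_def body_def by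
          (rule refl)
    have R: "rdom R = \<Y>s" using relation_rdom[OF 3(2)] .
    have n: "length \<Y>s = n" using 3(3) by (simp add: n_def list_all2_lengthD)
    have nd: "nondup_term (ts ! i) (\<Y>s ! i)" if "i < n" for i
      using list_all2_nthD[OF 3(3)] that by (simp add: n_def)
    have tv: "snd x < k" if "i < n" "x \<in> tvars (ts ! i)" for i x
      using 3(5) that nth_mem[of i ts] unfolding n_def by blast
    have g: "core_wf (graph (k + 2 * n) (ts ! i) (y' i)) \<and>
        fvars (graph (k + 2 * n) (ts ! i) (y' i)) \<subseteq> insert (y' i) (tvars (ts ! i))" if i: "i < n" for i
    proof (rule "3.IH"[OF False n_def])
      show "nondup_term (ts ! i) (\<Y>s ! i)" by (rule nd[OF i])
      show "fst (y' i) = dual (\<Y>s ! i)" by (simp add: y'_def R)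
      show "y' i \<notin> tvars (ts ! i)" using tv[OF i] by (fastforce simp: y'_def)
      \<comment> \<open>The nested call takes its new variables beyond the \<open>2 * n\<close> indices used here.\<close>
      show "snd (y' i) < k + 2 * n" using i by (simp add: y'_def)
      show "\<forall>x\<in>tvars (ts ! i). snd x < k + 2 * n" using tv[OF i] by force
    qed (use i in \<open>auto simp: y_def y'_def n_def\<close>)
    have "map fst (map y [0..<n]) = \<Y>s"
      by (rule nth_equalityI) (simp_all add: n y_def R)
    moreover have "distinct (map y [0..<n])"
      by (simp add: distinct_map inj_on_def y_def)
    ultimately have wf: "core_wf (Atomic R (map (\<lambda>i. Var (y i)) [0..<n]))"
      using 3(2) unfolding core_wf.simps by (intro exI[of _ "map y [0..<n]"]) simp
    have body_wf: "core_wf body"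
      unfolding body_def core_wf_foldl_Conj using wf g by simp
    have "fvars body = (\<Union>i<n. {y i}) \<union> (\<Union>i<n. fvars (graph (k + 2 * n) (ts ! i) (y' i)))"
      by (simp add: body_def core_wf_foldl_Conj atLeast0LessThan)
    also have "\<dots> \<subseteq> (\<Union>i<n. {y i}) \<union> (\<Union>i<n. insert (y' i) (tvars (ts ! i)))"
      using g by (intro Un_mono UN_mono) auto
    also have "\<dots> \<subseteq> (\<Union>i<n. {y i, y' i}) \<union> (\<Union>t\<in>set ts. tvars t)"
      using nth_mem[of _ ts] unfolding n_def by blast
    finally have body_fvars: "fvars body \<subseteq> (\<Union>i<n. {y i, y' i}) \<union> (\<Union>t\<in>set ts. tvars t)" .
    have "qset (fst (y i)) \<and> fst (y' i) = dual (fst (y i)) \<and> y i \<noteq> y' i" if "i \<in> set [0..<n]" for i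
      using that nondup_term_qset[OF nd] by (simp add: y_def y'_def R)
    from core_wf_foldl_ExistsEq[of body "[0..<n]" y y', OF body_wf this] body_fvars show ?thesis
      unfolding eq by (simp only: set_upt atLeast0LessThan Diff_subset_conv simp_thms)
  qed
qed

lemma expand_wf:
  "nondup_formula \<phi> \<Longrightarrow> (\<forall>x\<in>allvars \<phi>. snd x < k) \<Longrightarrow> core_wf (expand k \<phi>) \<and> fvars (expand k \<phi>) \<subseteq> fvars \<phi>"
proof (induction rule: nondup_formula.induct)
  case (1 R \<Y>s ts)
  have "list_all2 nondup_term ts \<Y>s" using 1(2) by (auto elim: list_all2_mono)
  then show ?case using graph_expand_atom_wf(2)[OF 1(1) _ 1(3), of k] 1(4) by auto
qed auto

lemma finite_tvars: "finite (tvars t)"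
  by (induction t) auto

lemma finite_allvars: "finite (allvars \<phi>)"
  by (induction \<phi>) (auto simp: finite_tvars)

lemma fresh_index:
  assumes "finite V"
  defines "k \<equiv> LEAST k. \<forall>x\<in>V. snd x < (k::nat)"
  shows "\<forall>x\<in>V. snd x < k"
proof -
  have "\<forall>x\<in>V. snd x < Suc (Max (snd ` V))"
    using assms(1) by (auto simp: less_Suc_eq_le)
  then show ?thesis unfolding k_def by (rule LeastI)
qed

section \<open>Implication from equality\<close>

text \<open>
  The quantum implication \<open>E \<rightarrow> N\<close> is \<open>E\<^sup>\<bottom> \<or> (E \<and> N)\<close>, the complement of \<open>E \<and> (E \<and> N)\<^sup>\<bottom>\<close>.  Inside \<open>E\<close>
  it agrees with \<open>N\<close>: this is the orthomodular law, obtained by projecting to \<open>E \<inter> N\<close>.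
\<close>

lemma sasaki_iff:
  assumes S: "finite S" and E: "fn.subspace E" "E \<subseteq> supported S" and N: "fn.subspace N" and K: "K \<in> E"
  shows "K \<in> ortho S (E \<inter> ortho S (E \<inter> N)) \<longleftrightarrow> K \<in> N"
proof
  assume *: "K \<in> ortho S (E \<inter> ortho S (E \<inter> N))"
  have "E \<inter> N \<subseteq> supported S" "fn.subspace (E \<inter> N)" "K \<in> supported S"
    using E N K by (auto intro: fn.subspace_inter)
  then obtain P where P: "P \<in> E \<inter> N" "\<And>L. L \<in> E \<inter> N \<Longrightarrow> dotp S L (K - P) = 0"
    using dotp_projection[OF S] by blast
  have KP: "K - P \<in> E" using K P(1) by (intro fn.subspace_diff[OF E(1)]) auto
  then have "K - P \<in> E \<inter> ortho S (E \<inter> N)" using P(2) E(2) by (auto simp: ortho_def)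
  then have "dotp S (K - P) K = 0" using * by (auto simp: ortho_def)
  moreover have "dotp S (K - P) P = 0" using P dotp_eq_0_commute by blast
  ultimately have "dotp S (K - P) (K - P) = 0" by (simp add: dotp_diff_right)
  then have "K - P = 0" using dotp_self_pos[OF S, of "K - P"] KP E(2) by force
  then show "K \<in> N" using P(1) by simp
next
  assume "K \<in> N"
  then have "dotp S K L = 0" if "L \<in> ortho S (E \<inter> N)" for L
    using that K by (auto simp: ortho_def)
  then show "K \<in> ortho S (E \<inter> ortho S (E \<inter> N))"
    using K E(2) dotp_eq_0_commute unfolding ortho_def by blast
qed

text \<open>
  \<open>diag X c\<close> is \<open>\<epsilon>\<^sub>X \<otimes> c\<close> in coordinates, and \<open>trace_out X M\<close> is \<open>M \<circ> (\<epsilon>\<^sub>X\<^sup>\<dagger> \<otimes> 1)\<close>: in the product basis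
  \<open>\<epsilon>\<^sub>X\<close> is the Kronecker delta.  The two labels come from \<open>X\<close> and \<open>X\<^sup>*\<close> in either order, as both have
  the same labels.
\<close>

fun diag :: "'v::complex_inner atom \<Rightarrow> ('v list list \<Rightarrow> complex) \<Rightarrow> 'v list list \<Rightarrow> complex" where
  "diag X c (f # g # hs) = (if f = g \<and> f \<in> basis X then c hs else 0)"
| "diag X c _ = 0"

definition trace_out :: "'v::complex_inner atom \<Rightarrow> ('v list list \<Rightarrow> complex) \<Rightarrow> 'v list list \<Rightarrow> complex"
    where
  "trace_out X M = (\<lambda>hs. \<Sum>b\<in>basis X. M (b # b # hs))"

lemma diag_supported:
  assumes "c \<in> supported (idx Zs)" "basis Y = basis X"
  shows "diag X c \<in> supported (idx (Y # X # Zs))"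
  unfolding supported_def
proof (intro CollectI allI impI)
  fix es assume "es \<notin> idx (Y # X # Zs)"
  then show "diag X c es = 0"
    using assms by (cases "(X, c, es)" rule: diag.cases) (auto simp: idx_Cons supported_def)
qed

text \<open>
  Tensoring with \<open>\<epsilon>\<^sub>X\<close> is adjoint to contracting with it.
\<close>

lemma dotp_diag:
  assumes "finite (basis X)" "basis Y = basis X"
  shows "dotp (idx (Y # X # Zs)) L (diag X c) = dotp (idx Zs) (trace_out X L) c"
proof -
  have "dotp (idx (Y # X # Zs)) L (diag X c) =
      (\<Sum>f\<in>basis X. \<Sum>g\<in>basis X. \<Sum>hs\<in>idx Zs. cnj (L (f # g # hs)) * diag X c (f # g # hs))"
    by (simp add: dotp_def sum_idx_Cons assms(2) del: diag.simps)
  also have "\<dots> = (\<Sum>f\<in>basis X. \<Sum>g\<in>basis X. if g = f then \<Sum>hs\<in>idx Zs. cnj (L (f # g # hs)) * c hs else 0)"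
    by (intro sum.cong refl) auto
  also have "\<dots> = (\<Sum>f\<in>basis X. \<Sum>hs\<in>idx Zs. cnj (L (f # f # hs)) * c hs)"
    using assms(1) by simp
  also have "\<dots> = dotp (idx Zs) (trace_out X L) c"
    by (subst sum.swap) (simp add: dotp_def trace_out_def sum_distrib_right)
  finally show ?thesis .
qed

lemma trace_out_diag:
  "trace_out X (diag X c) = (\<lambda>hs. of_nat (card (basis X)) * c hs)"
  by (simp add: trace_out_def fun_eq_iff)

lemma diag_eq_sum:
  assumes "finite (basis X)"
  shows "diag X c = (\<Sum>b\<in>basis X. ktensor 1 (\<lambda>es. if es = [b] then 1 else 0)
    (ktensor 1 (\<lambda>es. if es = [b] then 1 else 0) c))"
proof
  fix es
  show "diag X c es = (\<Sum>b\<in>basis X. ktensor 1 (\<lambda>es. if es = [b] then 1 else 0)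
    (ktensor 1 (\<lambda>es. if es = [b] then 1 else 0) c)) es"
  proof (cases "(X, c, es)" rule: diag.cases)
    case (1 X c f g hs)
    have "(\<Sum>b\<in>basis X. (if f = b then 1 else 0) * ((if g = b then 1 else 0) * c hs)) =
        (\<Sum>b\<in>basis X. if b = f then (if g = f then c hs else 0) else 0)"
      by (intro sum.cong) auto
    then show ?thesis
      using 1 assms by (simp add: sum_fun_apply ktensor_def)
  qed (simp_all add: sum_fun_apply ktensor_def)
qed

lemma dotp_diag_ktensor:
  assumes "finite (basis X)" "basis Y = basis X"
  shows "dotp (idx (Y # X # Zs)) (diag X c) (ktensor 1 T2 (ktensor 1 T1 a)) =
    (\<Sum>b\<in>basis X. T2 [b] * T1 [b]) * dotp (idx Zs) c a"
proof -
  have "dotp (idx (Y # X # Zs)) (diag X c) (ktensor 1 T2 (ktensor 1 T1 a)) =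
      (\<Sum>f\<in>basis X. \<Sum>g\<in>basis X. \<Sum>hs\<in>idx Zs. cnj (diag X c (f # g # hs)) * (T2 [f] * (T1 [g] * a hs)))"
    by (simp add: dotp_def sum_idx_Cons assms(2) ktensor_def del: diag.simps)
  also have "\<dots> = (\<Sum>f\<in>basis X. \<Sum>g\<in>basis X. if g = f then \<Sum>hs\<in>idx Zs. cnj (c hs) * (T2 [f] * (T1 [g] * a
      hs)) else 0)"
    by (intro sum.cong refl) auto
  also have "\<dots> = (\<Sum>f\<in>basis X. \<Sum>hs\<in>idx Zs. cnj (c hs) * (T2 [f] * (T1 [f] * a hs)))"
    using assms(1) by simp
  also have "\<dots> = (\<Sum>f\<in>basis X. (T2 [f] * T1 [f]) * dotp (idx Zs) c a)"
    by (simp add: dotp_def sum_distrib_left mult_ac)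
  finally show ?thesis by (simp add: sum_distrib_right)
qed

text \<open>
  Here \<open>E\<close> is the space of all \<open>\<epsilon>\<^sub>X \<otimes> c\<close>.  Since \<open>\<epsilon>\<^sub>X\<close> is a sum of product functionals, testing
  \<open>E \<rightarrow> N\<close> on all \<open>T2 \<otimes> T1 \<otimes> a\<close> includes testing it on \<open>\<epsilon>\<^sub>X \<otimes> a\<close>, where it means membership in \<open>N\<close>.
  Conversely, the inner product of \<open>T2 \<otimes> T1 \<otimes> a\<close> with an element \<open>\<epsilon>\<^sub>X \<otimes> c\<close> of \<open>E\<close> is a multiple of
  \<open>\<langle>c | a\<rangle>\<close>, which vanishes as soon as \<open>\<epsilon>\<^sub>X \<otimes> a\<close> and \<open>\<epsilon>\<^sub>X \<otimes> c\<close> are orthogonal.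
\<close>

lemma implication_of_diag:
  assumes X: "atom X" "basis Y = basis X" and fin: "finite (idx (Y # X # Zs))"
    and E: "E = diag X ` supported (idx Zs)" "fn.subspace E" "E \<subseteq> supported (idx (Y # X # Zs))"
    and N: "fn.subspace N" and a: "a \<in> supported (idx Zs)"
  defines "S \<equiv> idx (Y # X # Zs)"
  shows "(\<forall>T1\<in>supported (idx [X]). \<forall>T2\<in>supported (idx [Y]).
      ktensor 1 T2 (ktensor 1 T1 a) \<in> ortho S (E \<inter> ortho S (E \<inter> N))) \<longleftrightarrow> diag X a \<in> N"
    (is "(\<forall>T1\<in>_. \<forall>T2\<in>_. _ \<in> ?J) \<longleftrightarrow> _")
proof -
  have dE: "diag X a \<in> E" using a E(1) by blast
  have J: "diag X a \<in> ?J \<longleftrightarrow> diag X a \<in> N"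
    by (rule sasaki_iff) (use fin E N dE in \<open>simp_all add: S_def\<close>)
  show ?thesis
  proof
    assume *: "\<forall>T1\<in>supported (idx [X]). \<forall>T2\<in>supported (idx [Y]). ktensor 1 T2 (ktensor 1 T1 a) \<in> ?J"
    have "(\<lambda>es. if es = [b] then 1 else 0) \<in> supported (idx [X])"
      "(\<lambda>es. if es = [b] then 1 else 0) \<in> supported (idx [Y])" if "b \<in> basis X" for b
      using that X(2) by (auto simp: supported_def idx_Cons)
    then have "diag X a \<in> ?J"
      unfolding diag_eq_sum[OF finite_basis[OF X(1)]] using *
      by (intro fn.subspace_sum[OF ortho_subspace]) blast
    then show "diag X a \<in> N" using J by blast
  next
    assume "diag X a \<in> N"
    then have J: "diag X a \<in> ?J" using J by blast
    show "\<forall>T1\<in>supported (idx [X]). \<forall>T2\<in>supported (idx [Y]). ktensor 1 T2 (ktensor 1 T1 a) \<in> ?J"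
    proof (intro ballI)
      fix T1 T2 assume T: "T1 \<in> supported (idx [X])" "T2 \<in> supported (idx [Y])"
      have "ktensor 1 T2 (ktensor 1 T1 a) \<in> supported S"
        using ktensor_supported[OF T(2) ktensor_supported[OF T(1) a]] by (simp add: S_def)
      moreover have "dotp S L (ktensor 1 T2 (ktensor 1 T1 a)) = 0" if L: "L \<in> E \<inter> ortho S (E \<inter> N)" for L
      proof -
        obtain c where c: "L = diag X c" using L E(1) by blast
        have "dotp S L (diag X a) = 0" using J L by (simp add: ortho_def)
        then have "dotp S (diag X a) (diag X c) = 0" using c dotp_eq_0_commute by blast
        then have "dotp (idx Zs) (\<lambda>hs. of_nat (card (basis X)) * a hs) c = 0"
          unfolding S_def dotp_diag[OF finite_basis[OF X(1)] X(2)] trace_out_diag .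
        then have "dotp (idx Zs) c (\<lambda>hs. of_nat (card (basis X)) * a hs) = 0"
          using dotp_eq_0_commute by blast
        then have "of_nat (card (basis X)) * dotp (idx Zs) c a = 0" by (simp only: dotp_scale_right)
        \<comment> \<open>Atoms are nonzero spaces: \<open>\<langle>\<epsilon>\<^sub>X | \<epsilon>\<^sub>X\<rangle>\<close> is the dimension of \<open>X\<close>.\<close>
        moreover have "card (basis X) \<noteq> 0" using basis_nonempty[OF X(1)] finite_basis[OF X(1)] by simp
        ultimately have "dotp (idx Zs) c a = 0" by simp
        then show ?thesis unfolding c S_def dotp_diag_ktensor[OF finite_basis[OF X(1)] X(2)] by simp
      qed
      ultimately show "ktensor 1 T2 (ktensor 1 T1 a) \<in> ?J" by (simp add: ortho_def)
    qed
  qed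
qed

lemma coord_op_eval:
  assumes "atom X"
  shows "coord [X, dual_atom X] (op_eval X) = (\<lambda>es. diag X (\<lambda>hs. if hs = [] then 1 else 0) es)"
proof
  fix es
  show "coord [X, dual_atom X] (op_eval X) es = diag X (\<lambda>hs. if hs = [] then 1 else 0) es"
  proof (cases "es \<in> idx [X, dual_atom X]")
    case True
    then obtain e e' where "es = [e, e']" "e \<in> basis X" "e' \<in> basis X" by (auto elim!: idx_ConsE)
    then show ?thesis using True op_eval_ket[OF assms] by (simp add: coord_def scalar_def)
  next
    case False
    then show ?thesis
      by (cases "(X, \<lambda>hs::'a list list. if hs = [] then 1 else 0::complex, es)" rule: diag.cases)
        (auto simp: coord_def idx_Cons)
  qed
qed

lemma amps_rel_eq:
  assumes "X \<in> \<X>" "Y \<in> dual \<X>" "qset \<X>"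
  shows "amps (rel_eq \<X>) [X, Y] =
    (if Y = dual_atom X then range (\<lambda>c es. c * diag X (\<lambda>hs. if hs = [] then 1 else 0) es) else {0})"
proof -
  have "comps (rel_eq \<X>) [X, Y] [] = (if Y = dual_atom X then op.span {op_eval X} else {0})"
    using assms(1,2) by (simp add: rel_eq_def comps_mk_rel set_Cons_def)
  moreover have "coord [X, dual_atom X] ` op.span {op_eval X} =
      range (\<lambda>c es. c * diag X (\<lambda>hs. if hs = [] then 1 else 0) es)"
    unfolding coord_span using coord_op_eval[of X] assms(1,3) by (simp add: qset_def fn.span_singleton)
  ultimately show ?thesis by (simp add: amps_def coord_zero)
qed

text \<open>
  The context is that of the body of \<open>\<forall>x1. \<forall>x2\<close>, in which \<open>x2\<close> comes first; the arguments of the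
  equality relation therefore sit at the positions 1 and 0.
\<close>

lemma amps_Eq:
  assumes x: "qset (fst x1)" "fst x2 = dual (fst x1)" "x1 \<noteq> x2" and q: "\<And>x. x \<in> set xs \<Longrightarrow> qset (fst x)"
    and X: "X \<in> fst x1" and Y: "Y \<in> fst x2" and Zs: "Zs \<in> listset (map fst xs)"
  shows "amps (interp_core (Eq x1 x2) (x2 # x1 # xs)) (Y # X # Zs) =
    (if Y = dual_atom X then diag X ` supported (idx Zs) else {0})"
proof -
  let ?\<Gamma> = "x2 # x1 # xs"
  let ?agree = "\<lambda>es' es :: 'a list list. \<forall>i<length ?\<Gamma>. i \<notin> set (map (position ?\<Gamma>) [x1, x2]) \<longrightarrow> es' ! i =
      es ! i"
  have pos: "position ?\<Gamma> x2 = 0" "position ?\<Gamma> x1 = 1" using x(3) by (simp_all add: position_Cons)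
  have at: "atom X" using X x(1) by (simp add: qset_def)
  have R: "relation_of_arity (rel_eq (fst x1)) (map fst [x1, x2])" using relation_eq[OF x(1)] x(2) by
      simp
  have q': "qset (fst x)" if "x \<in> set ?\<Gamma>" for x
    using that q[of x] x(1,2) qset_dual[OF x(1)] by auto
  have tup: "Y # X # Zs \<in> listset (map fst ?\<Gamma>)" using X Y Zs by (simp add: set_Cons_def)
  have len: "length xs = length Zs" using listset_length[OF Zs] by simp
  have agree: "?agree (f' # g' # hs') (f # g # hs) \<longleftrightarrow> hs' = hs" if "length hs' = length Zs" "length hs =
      length Zs" for f g f' g' :: "'a list" and hs hs'
  proof -
    have "?agree (f' # g' # hs') (f # g # hs)
       \<longleftrightarrow> (\<forall>i<length Zs. hs' ! i = hs ! i)"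
      using len by (simp add: pos All_less_Suc2)
    then show ?thesis using that by (simp add: list_eq_iff_nth_eq)
  qed
  define A where "A = amps (rel_eq (fst x1)) [X, Y]"
  have mem: "K \<in> amps (interp_core (Eq x1 x2) ?\<Gamma>) (Y # X # Zs) \<longleftrightarrow> K \<in> supported (idx (Y # X # Zs)) \<and>
      (\<forall>hs\<in>idx Zs. \<exists>r\<in>A. \<forall>f\<in>basis Y. \<forall>g\<in>basis X. K (f # g # hs) = r [g, f])" (is "?L = ?R") for K
  proof -
    have "?L \<longleftrightarrow> K \<in> supported (idx (Y # X # Zs)) \<and>
      (\<forall>es\<in>idx (Y # X # Zs). \<exists>r\<in>A. \<forall>es'\<in>idx (Y # X # Zs).
        ?agree es' es \<longrightarrow> K es' = r [es' ! 1, es' ! 0])"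
      using amps_atomic[OF R _ _ q' tup, of K] x(3) unfolding A_def Eq_def by (simp add: pos)
    also have "\<dots> \<longleftrightarrow> ?R"
    proof (intro conj_cong refl iffI ballI)
      fix hs assume *: "\<forall>es\<in>idx (Y # X # Zs). \<exists>r\<in>A. \<forall>es'\<in>idx (Y # X # Zs).
        ?agree es' es \<longrightarrow> K es' = r [es' ! 1, es' ! 0]"
        and hs: "hs \<in> idx Zs"
      have "atom Y" using q'[of x2] Y by (simp add: qset_def)
      then obtain f g where fg: "f \<in> basis Y" "g \<in> basis X" using at basis_nonempty by blast
      then obtain r where r: "r \<in> A" "\<And>es'. es' \<in> idx (Y # X # Zs) \<Longrightarrow>
        ?agree es' (f # g # hs) \<Longrightarrow> K es' = r [es' ! 1, es' ! 0]"
        using * hs by (metis idx_Cons)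
      have "K (f' # g' # hs) = r [g', f']" if "f' \<in> basis Y" "g' \<in> basis X" for f' g'
        using r(2)[of "f' # g' # hs"] agree[of hs hs] that hs idx_length[OF hs] by (simp add: idx_Cons)
      then show "\<exists>r\<in>A. \<forall>f\<in>basis Y. \<forall>g\<in>basis X. K (f # g # hs) = r [g, f]" using r(1) by blast
    next
      fix es assume *: "\<forall>hs\<in>idx Zs. \<exists>r\<in>A. \<forall>f\<in>basis Y. \<forall>g\<in>basis X. K (f # g # hs) = r [g, f]"
        and es: "es \<in> idx (Y # X # Zs)"
      obtain f g hs where e: "es = f # g # hs" "hs \<in> idx Zs" using es by (auto elim!: idx_ConsE)
      then obtain r where r: "r \<in> A" "\<And>f g. f \<in> basis Y \<Longrightarrow> g \<in> basis X \<Longrightarrow> K (f # g # hs) = r [g, f]"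
        using * by blast
      have "K es' = r [es' ! 1, es' ! 0]" if es': "es' \<in> idx (Y # X # Zs)"
        and ag: "?agree es' es" for es'
      proof -
        obtain f' g' hs' where e': "es' = f' # g' # hs'" "f' \<in> basis Y" "g' \<in> basis X" "hs' \<in> idx Zs"
          using es' by (auto elim!: idx_ConsE)
        then have "hs' = hs" using ag agree[OF idx_length[OF e'(4)] idx_length[OF e(2)]] e(1) by blast
        then show ?thesis using r(2) e' by simp
      qed
      then show "\<exists>r\<in>A. \<forall>es'\<in>idx (Y # X # Zs).
        ?agree es' es \<longrightarrow> K es' = r [es' ! 1, es' ! 0]"
        using r(1) by blast
    qed
    finally show ?thesis .
  qed
  show ?thesis
  proof (cases "Y = dual_atom X")
    case True
    then have bY: "basis Y = basis X" by simp
    have A: "A = range (\<lambda>c es. c * diag X (\<lambda>hs. if hs = [] then 1 else 0) es)"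
      unfolding A_def using amps_rel_eq[OF X _ x(1)] Y x(2) True by simp
    have "K \<in> amps (interp_core (Eq x1 x2) ?\<Gamma>) (Y # X # Zs) \<longleftrightarrow> K \<in> diag X ` supported (idx Zs)" for K
    proof
      assume "K \<in> amps (interp_core (Eq x1 x2) ?\<Gamma>) (Y # X # Zs)"
      then have K: "K \<in> supported (idx (Y # X # Zs))"
        and *: "\<And>hs. hs \<in> idx Zs \<Longrightarrow> \<exists>r\<in>A. \<forall>f\<in>basis X. \<forall>g\<in>basis X. K (f # g # hs) = r [g, f]"
        using mem bY by auto
      have "\<exists>k. \<forall>f\<in>basis X. \<forall>g\<in>basis X. K (f # g # hs) = (if f = g then k else 0)" if "hs \<in> idx Zs" for
          hs
        using *[OF that] unfolding A by auto
      then obtain k where k: "\<And>hs f g. hs \<in> idx Zs \<Longrightarrow> f \<in> basis X \<Longrightarrow> g \<in> basis X \<Longrightarrow>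
          K (f # g # hs) = (if f = g then k hs else 0)" by metis
      define c where "c = (\<lambda>hs. if hs \<in> idx Zs then k hs else 0)"
      have c: "c \<in> supported (idx Zs)" by (simp add: c_def supported_def)
      have "K es = diag X c es" for es
      proof (cases "es \<in> idx (Y # X # Zs)")
        case True
        then show ?thesis using k bY by (auto elim!: idx_ConsE simp: c_def)
      next
        case False
        then show ?thesis using K diag_supported[OF c bY] by (simp add: supported_def)
      qed
      then show "K \<in> diag X ` supported (idx Zs)" using c by blast
    next
      assume "K \<in> diag X ` supported (idx Zs)"
      then obtain c where c: "c \<in> supported (idx Zs)" "K = diag X c" by blast
      have "\<exists>r\<in>A. \<forall>f\<in>basis Y. \<forall>g\<in>basis X. K (f # g # hs) = r [g, f]" for hs
        unfolding A using c(2) bY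
        by (intro bexI[of _ "\<lambda>es. c hs * diag X (\<lambda>hs. if hs = [] then 1 else 0) es"]) auto
      then show "K \<in> amps (interp_core (Eq x1 x2) ?\<Gamma>) (Y # X # Zs)"
        using mem diag_supported[OF c(1) bY] c(2) by blast
    qed
    then show ?thesis using True by auto
  next
    case False
    have A: "A = {0}" unfolding A_def using amps_rel_eq[OF X _ x(1)] Y x(2) False by simp
    have "K \<in> amps (interp_core (Eq x1 x2) ?\<Gamma>) (Y # X # Zs) \<longleftrightarrow> K = 0" for K
    proof
      assume "K \<in> amps (interp_core (Eq x1 x2) ?\<Gamma>) (Y # X # Zs)"
      then have K: "K \<in> supported (idx (Y # X # Zs))"
        and *: "\<And>hs f g. hs \<in> idx Zs \<Longrightarrow> f \<in> basis Y \<Longrightarrow> g \<in> basis X \<Longrightarrow> K (f # g # hs) = 0"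
        using mem A by auto
      have "K es = 0" for es
        using K * by (cases "es \<in> idx (Y # X # Zs)") (auto elim!: idx_ConsE simp: supported_def)
      then show "K = 0" by auto
    qed (simp add: mem A fn.subspace_0[OF supported_subspace])
    then show ?thesis using False by auto
  qed
qed

section \<open>Contraction with the adjoint of equality\<close>

lemma span_op_id_iff:
  "q \<in> op.span {op_id X} \<longleftrightarrow> (\<exists>c. q = (\<lambda>f u. c * op_id X f u))"
  by (auto simp: op.span_singleton)

lemma op_id_ket: "atom X \<Longrightarrow> e \<in> basis X \<Longrightarrow> op_id X (ket X e) = ket X e"
  by (simp add: op_id_def ket_in_hilb basis_length)

lemma op_tensor_ids:
  assumes "atom X" "atom X'"
  shows "op_tensor X X X' X' (\<lambda>f u. c * op_id X f u) (\<lambda>f u. d * op_id X' f u) =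
    (\<lambda>f u. (c * d) * op_id (X @ X') f u)"
proof (rule Op_eqI)
  have ops: "(\<lambda>f u. c * op_id X f u) \<in> Op X X" "(\<lambda>f u. d * op_id X' f u) \<in> Op X' X'"
    by (rule Op_mult[OF op_id_Op])+
  show "atom (X @ X')" using assms by simp
  show "op_tensor X X X' X' (\<lambda>f u. c * op_id X f u) (\<lambda>f u. d * op_id X' f u) \<in> Op (X @ X') (X @ X')"
    by (rule op_tensor_Op[OF assms ops])
  show "(\<lambda>f u. (c * d) * op_id (X @ X') f u) \<in> Op (X @ X') (X @ X')" by (rule Op_mult[OF op_id_Op])
  fix e assume "e \<in> basis (X @ X')"
  then obtain e1 e2 where e: "e = e1 @ e2" "e1 \<in> basis X" "e2 \<in> basis X'" by (rule basis_appendE)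
  have "vtensor X (\<lambda>u. c * ket X e1 u) (\<lambda>u. d * ket X' e2 u) = (\<lambda>u. (c * d) * vtensor X (ket X e1) (ket
      X' e2) u)"
    by (rule ext) (simp add: vtensor_def)
  then show "op_tensor X X X' X' (\<lambda>f u. c * op_id X f u) (\<lambda>f u. d * op_id X' f u) (ket (X @ X') e) =
      (\<lambda>u. (c * d) * op_id (X @ X') (ket (X @ X') e) u)"
    unfolding e(1) op_tensor_ket[OF assms ops e(2,3)]
    using assms e by (simp add: op_id_ket vtensor_ket basis_append basis_length)
qed

lemma op_tensor_zero:
  assumes "atom X" "atom X'"
  shows "a \<in> Op X Y \<Longrightarrow> op_tensor X Y X' Y' a 0 = 0" and "b \<in> Op X' Y' \<Longrightarrow> op_tensor X Y X' Y' 0 b = 0"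
proof -
  show "op_tensor X Y X' Y' a 0 = 0" if a: "a \<in> Op X Y"
  proof (rule Op_eqI[OF _ op_tensor_Op[OF assms a Op_zero] Op_zero])
    fix e assume "e \<in> basis (X @ X')"
    then obtain e1 e2 where e: "e = e1 @ e2" "e1 \<in> basis X" "e2 \<in> basis X'" by (rule basis_appendE)
    show "op_tensor X Y X' Y' a 0 (ket (X @ X') e) = 0 (ket (X @ X') e)"
      unfolding e(1) op_tensor_ket[OF assms a Op_zero e(2,3)] by (simp add: vtensor_def fun_eq_iff)
  qed (use assms in simp)
  show "op_tensor X Y X' Y' 0 b = 0" if b: "b \<in> Op X' Y'"
  proof (rule Op_eqI[OF _ op_tensor_Op[OF assms Op_zero b] Op_zero])
    fix e assume "e \<in> basis (X @ X')"
    then obtain e1 e2 where e: "e = e1 @ e2" "e1 \<in> basis X" "e2 \<in> basis X'" by (rule basis_appendE)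
    show "op_tensor X Y X' Y' 0 b (ket (X @ X') e) = 0 (ket (X @ X') e)"
      unfolding e(1) op_tensor_ket[OF assms Op_zero b e(2,3)] by (simp add: vtensor_def fun_eq_iff)
  qed (use assms in simp)
qed

lemma rdom_rel_ids [simp]: "rdom (rel_ids \<X>s) = \<X>s" and rcod_rel_ids [simp]: "rcod (rel_ids \<X>s) = \<X>s"
  by (induction \<X>s) (simp_all add: rel_id_def rel_times_def)

lemma comps_rel_ids:
  assumes "\<And>\<X>. \<X> \<in> set \<X>s \<Longrightarrow> qset \<X>" "Xs \<in> listset \<X>s" "Ys \<in> listset \<X>s"
  shows "comps (rel_ids \<X>s) Xs Ys = (if Xs = Ys then op.span {op_id (concat Xs)} else {0})"
  using assms
proof (induction \<X>s arbitrary: Xs Ys)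
  case Nil
  then show ?case by (simp add: rel_id_def comps_mk_rel)
next
  case (Cons \<X> \<X>s)
  obtain X Xs' where X: "Xs = X # Xs'" "X \<in> \<X>" "Xs' \<in> listset \<X>s"
    using Cons.prems(2) by (auto simp: set_Cons_def)
  obtain Y Ys' where Y: "Ys = Y # Ys'" "Y \<in> \<X>" "Ys' \<in> listset \<X>s"
    using Cons.prems(3) by (auto simp: set_Cons_def)
  have at: "atom X" "atom (concat Xs')"
    using X Cons.prems(1) qsets_atoms[OF X(3)] by (auto simp: qset_def intro!: concat_atoms)
  have one: "comps (rel_id [\<X>]) [X] [Y] = (if X = Y then op.span {op_id X} else {0})"
    using X(2) Y(2) by (simp add: rel_id_def comps_mk_rel set_Cons_def)
  have IH: "comps (rel_ids \<X>s) Xs' Ys' = (if Xs' = Ys' then op.span {op_id (concat Xs')} else {0})"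
    using Cons.prems(1) by (intro Cons.IH X Y) auto
  have "comps (rel_ids (\<X> # \<X>s)) Xs Ys = op.span {op_tensor X Y (concat Xs') (concat Ys') r s | r s.
      r \<in> comps (rel_id [\<X>]) [X] [Y] \<and> s \<in> comps (rel_ids \<X>s) Xs' Ys'}" (is "_ = op.span ?G")
    using Cons.prems(2,3) X(1) Y(1) by (simp add: rel_times_def comps_mk_rel Let_def) (simp add:
        rel_id_def)
  also have "\<dots> = (if Xs = Ys then op.span {op_id (concat Xs)} else {0})"
  proof (cases "Xs = Ys")
    case True
    then have "?G = {op_tensor X X (concat Xs') (concat Xs') r s | r s.
        r \<in> op.span {op_id X} \<and> s \<in> op.span {op_id (concat Xs')}}"
      using one IH X(1) Y(1) by simp
    also have "\<dots> = {(\<lambda>f u. (c * d) * op_id (X @ concat Xs') f u) | c d. True}"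
      unfolding span_op_id_iff using op_tensor_ids[OF at] by (auto; metis)
    also have "\<dots> = op.span {op_id (concat Xs)}"
      unfolding X(1) by (auto simp: op.span_singleton image_iff) (metis mult_1)
    finally have "?G = op.span {op_id (concat Xs)}" .
    then show ?thesis using True by (simp only: op.span_span) simp
  next
    case False
    have "r \<in> Op X Y \<and> s \<in> Op (concat Xs') (concat Ys') \<and> (r = 0 \<or> s = 0)"
      if "r \<in> comps (rel_id [\<X>]) [X] [Y]" "s \<in> comps (rel_ids \<X>s) Xs' Ys'" for r s
      using that False X(1) Y(1) unfolding one IH
      by (auto simp: span_op_id_iff Op_zero Op_mult op_id_Op split: if_splits)
    then have "?G \<subseteq> {0}" using op_tensor_zero[OF at] by blast
    then have "op.span ?G \<subseteq> {0}" by (rule op.span_minimal) simp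
    then show ?thesis using False op.span_zero[of ?G] by auto
  qed
  finally show ?case .
qed

text \<open>
  The adjoint of a functional \<open>w\<close> is a vector whose coordinates are the conjugates of those of \<open>w\<close>;
  inserting it into the first factors of \<open>s\<close> sums over their labels.
\<close>

lemma coord_contract:
  assumes Vs: "\<And>V. V \<in> set Vs \<Longrightarrow> atom V" and Zs: "\<And>Z. Z \<in> set Zs \<Longrightarrow> atom Z"
    and w: "w \<in> Op (concat Vs) []" and s: "s \<in> Op (concat (Vs @ Zs)) []"
  shows "coord Zs (s \<circ> op_tensor [] (concat Vs) (concat Zs) (concat Zs) (adjoint (concat Vs) [] w)
      (\<lambda>f u. c * op_id (concat Zs) f u)) =
    (\<lambda>es. c * (\<Sum>fs\<in>idx Vs. cnj (coord Vs w fs) * coord (Vs @ Zs) s (fs @ es)))"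
proof
  fix es
  let ?V = "concat Vs" and ?Z = "concat Zs"
  let ?t = "op_tensor [] ?V ?Z ?Z (adjoint ?V [] w) (\<lambda>f u. c * op_id ?Z f u)"
  have at: "atom ?V" "atom ?Z" "atom ([] :: 'a atom)" using concat_atoms[OF Vs] concat_atoms[OF Zs] by
      simp_all
  have adj: "adjoint ?V [] w \<in> Op [] ?V" using adjoint_Op[OF at(1,3) w] .
  have cid: "(\<lambda>f u. c * op_id ?Z f u) \<in> Op ?Z ?Z" by (rule Op_mult[OF op_id_Op])
  define h where "h = adjoint ?V [] w (scalar 1)"
  have h: "h \<in> hilb ?V" unfolding h_def by (rule Op_hilb[OF adj]) simp
  show "coord Zs (s \<circ> ?t) es = c * (\<Sum>fs\<in>idx Vs. cnj (coord Vs w fs) * coord (Vs @ Zs) s (fs @ es))"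
  proof (cases "es \<in> idx Zs")
    case False
    then have "fs @ es \<notin> idx (Vs @ Zs)" if "fs \<in> idx Vs" for fs
      using idx_append[OF idx_length[OF that]] by simp
    then show ?thesis using False by (simp add: coord_def)
  next
    case es: True
    let ?k = "ket ?Z (concat es)"
    have k: "?k \<in> hilb ?Z" using at(2) concat_idx[OF es] by (simp add: ket_in_hilb basis_length)
    have "?t (ket ([] @ ?Z) ([] @ concat es)) = vtensor ?V (adjoint ?V [] w (ket [] [])) (\<lambda>u. c * op_id
        ?Z ?k u)"
      by (rule op_tensor_ket[OF at(3,2) adj cid]) (use concat_idx[OF es] in simp_all)
    then have t: "?t ?k = vtensor ?V h (\<lambda>u. c * ?k u)"
      using at(2) concat_idx[OF es] by (simp add: h_def ket_Nil_scalar op_id_ket)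
    have tk: "vtensor ?V h (\<lambda>u. c * ?k u) \<in> hilb (concat (Vs @ Zs))"
      using vtensor_in_hilb[OF h hilb_scale[OF k]] by simp
    have atVZ: "atom (concat (Vs @ Zs))" using at by simp
    have "coord Zs (s \<circ> ?t) es = s (vtensor ?V h (\<lambda>u. c * ?k u)) []"
      using es t by (simp add: coord_def)
    also have "\<dots> = (\<Sum>e\<in>basis (?V @ ?Z). vtensor ?V h (\<lambda>u. c * ?k u) e * s (ket (?V @ ?Z) e) [])"
      using Op_expand[OF atVZ s tk] by simp
    also have "\<dots> = (\<Sum>fs\<in>idx Vs. \<Sum>gs\<in>idx Zs. vtensor ?V h (\<lambda>u. c * ?k u) (concat fs @ concat gs) *
        s (ket (?V @ ?Z) (concat fs @ concat gs)) [])"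
      by (simp add: sum_basis_append sum_basis_concat)
    also have "\<dots> = (\<Sum>fs\<in>idx Vs. \<Sum>gs\<in>idx Zs. if gs = es then
        c * (cnj (coord Vs w fs) * coord (Vs @ Zs) s (fs @ es)) else 0)"
    proof (intro sum.cong refl)
      fix fs gs assume fs: "fs \<in> idx Vs" and gs: "gs \<in> idx Zs"
      have "h (concat fs) = cnj (coord Vs w fs)"
        unfolding h_def using adjoint_functional_scalar[OF at(1) w concat_idx[OF fs]] fs by (simp add:
            coord_def)
      moreover have "?k (concat gs) = (if gs = es then 1 else 0)"
        using ket_basis[OF at(2) concat_idx[OF es] concat_idx[OF gs]] concat_idx_inject[OF es gs] by
            auto
      moreover have "fs @ es \<in> idx (Vs @ Zs)" using idx_append[OF idx_length[OF fs]] fs es by simp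
      ultimately show "vtensor ?V h (\<lambda>u. c * ?k u) (concat fs @ concat gs) *
          s (ket (?V @ ?Z) (concat fs @ concat gs)) [] =
        (if gs = es then c * (cnj (coord Vs w fs) * coord (Vs @ Zs) s (fs @ es)) else 0)"
        using concat_idx[OF fs] by (simp add: vtensor_append basis_length coord_def)
    qed
    also have "\<dots> = c * (\<Sum>fs\<in>idx Vs. cnj (coord Vs w fs) * coord (Vs @ Zs) s (fs @ es))"
      using es finite_idx[OF Zs] by (simp add: sum_distrib_left)
    finally show ?thesis .
  qed
qed

lemma sum_idx_pair_diag:
  assumes "finite (basis X)" "basis Y = basis X"
  shows "(\<Sum>fs\<in>idx [X, Y]. cnj (d * diag X (\<lambda>hs. if hs = [] then 1 else 0) fs) * M (fs @ es)) = cnj d *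
      trace_out X M es"
proof -
  have "(\<Sum>fs\<in>idx [X, Y]. cnj (d * diag X (\<lambda>hs. if hs = [] then 1 else 0) fs) * M (fs @ es)) =
      (\<Sum>f\<in>basis X. \<Sum>g\<in>basis X. if g = f then cnj d * M (f # g # es) else 0)"
    unfolding sum_idx_Cons assms(2) by (intro sum.cong refl) auto
  also have "\<dots> = cnj d * trace_out X M es"
    using assms(1) by (simp add: trace_out_def sum_distrib_left)
  finally show ?thesis .
qed

lemma trace_out_supported:
  assumes "M \<in> supported (idx (X # Y # Zs))"
  shows "trace_out X M \<in> supported (idx Zs)"
  using assms by (auto simp: supported_def trace_out_def idx_Cons intro!: sum.neutral)

text \<open>
  The common value of both sides of the theorem, at the tuple \<open>Zs\<close> of atoms for the remaining
  variables.
\<close>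

abbreviation joined_amps ::
  "'v::complex_inner brel \<Rightarrow> 'v qset \<Rightarrow> 'v atom list \<Rightarrow> ('v list list \<Rightarrow> complex) set" where
  "joined_amps \<Phi> \<X> Zs \<equiv>
     fn.span {trace_out X M | X M. X \<in> \<X> \<and> M \<in> amps \<Phi> (X # dual_atom X # Zs)}"

context
  fixes \<Phi> T :: "'v::complex_inner brel" and \<X> :: "'v qset" and \<Z>s :: "'v qset list"
  assumes \<Phi>: "relation_of_arity \<Phi> (\<X> # dual \<X> # \<Z>s)"
  defines "T \<equiv> rel_times (rel_dagger (rel_eq \<X>)) (rel_ids \<Z>s)"
begin

lemma contraction_qset: "qset \<X>" "\<And>\<Z>. \<Z> \<in> set \<Z>s \<Longrightarrow> qset \<Z>"
  using relation_qset[OF \<Phi>] by auto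

lemma comps_contraction:
  assumes "Zs \<in> listset \<Z>s" "X \<in> \<X>" "Y \<in> dual \<X>" "Ws \<in> listset \<Z>s"
  shows "comps T Zs (X # Y # Ws) = op.span {op_tensor [] (X @ Y) (concat Zs) (concat Ws) (adjoint (X @
      Y) [] w) q | w q.
      w \<in> comps (rel_eq \<X>) [X, Y] [] \<and> q \<in> (if Zs = Ws then op.span {op_id (concat Zs)} else {0})}"
proof -
  have dag: "rdom (rel_dagger (rel_eq \<X>)) = []" "rcod (rel_dagger (rel_eq \<X>)) = [\<X>, dual \<X>]"
    "comps (rel_dagger (rel_eq \<X>)) [] [X, Y] = adjoint (X @ Y) [] ` comps (rel_eq \<X>) [X, Y] []"
    using assms(2,3) by (simp_all add: rel_dagger_def rel_eq_def comps_mk_rel set_Cons_def)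
  have "X # Y # Ws \<in> listset ([\<X>, dual \<X>] @ \<Z>s)" using assms by (simp add: set_Cons_def)
  then have "comps T Zs (X # Y # Ws) = op.span {op_tensor [] (X @ Y) (concat Zs) (concat Ws) r q | r q.
      r \<in> adjoint (X @ Y) [] ` comps (rel_eq \<X>) [X, Y] [] \<and> q \<in> comps (rel_ids \<Z>s) Zs Ws}"
    using assms(1) dag by (simp add: T_def rel_times_def comps_mk_rel Let_def)
  also have "comps (rel_ids \<Z>s) Zs Ws = (if Zs = Ws then op.span {op_id (concat Zs)} else {0})"
    by (rule comps_rel_ids[OF contraction_qset(2) assms(1,4)])
  also have "{op_tensor [] (X @ Y) (concat Zs) (concat Ws) r q | r q. r \<in> adjoint (X @ Y) [] ` A \<and> q \<in>
      B} =
      {op_tensor [] (X @ Y) (concat Zs) (concat Ws) (adjoint (X @ Y) [] w) q | w q. w \<in> A \<and> q \<in> B}" for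
          A B
    by blast
  finally show ?thesis .
qed

text \<open>
  Only the tuples \<open>X, X\<^sup>*, Zs\<close> contribute: at all others either the component of equality or that of
  the identity is zero.
\<close>

lemma contraction_generator:
  assumes Zs: "Zs \<in> listset \<Z>s" and X: "X \<in> \<X>" and Y: "Y \<in> dual \<X>" and Ws: "Ws \<in> listset \<Z>s"
    and w: "w \<in> comps (rel_eq \<X>) [X, Y] []" and q: "q \<in> (if Zs = Ws then op.span {op_id (concat Zs)}
        else {0})"
    and s: "s \<in> comps \<Phi> (X # Y # Ws) []"
  defines "t \<equiv> op_tensor [] (X @ Y) (concat Zs) (concat Ws) (adjoint (X @ Y) [] w) q"
  shows "t \<in> Op (concat Zs) (concat (X # Y # Ws))"
    and "coord Zs (s \<circ> t) \<in> joined_amps \<Phi> \<X> Zs"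
proof -
  have at: "atom X" "atom Y" using X Y contraction_qset(1) qset_dual by (auto simp: qset_def)
  have atZ: "atom Z" if "Z \<in> set Zs" for Z by (rule qsets_atoms[OF Zs contraction_qset(2) that])
  have "w \<in> Op (concat [X, Y]) []"
    using relation_Op[OF relation_eq[OF contraction_qset(1)] _ w] X Y by (simp add: set_Cons_def)
  then have w': "w \<in> Op (X @ Y) []" by simp
  have adj: "adjoint (X @ Y) [] w \<in> Op [] (X @ Y)" using adjoint_Op[OF _ _ w'] at by simp
  have q': "q \<in> Op (concat Zs) (concat Ws)"
    using q by (auto simp: span_op_id_iff Op_zero Op_mult op_id_Op split: if_splits)
  show t: "t \<in> Op (concat Zs) (concat (X # Y # Ws))"
    unfolding t_def using op_tensor_Op[OF _ concat_atoms[OF atZ] adj q'] by simp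
  have s': "s \<in> Op (concat (X # Y # Ws)) []"
    using relation_Op[OF \<Phi> _ s] X Y Ws by (simp add: set_Cons_def)
  show "coord Zs (s \<circ> t) \<in> joined_amps \<Phi> \<X> Zs"
  proof (cases "Zs = Ws")
    case False
    then have "t = 0"
      unfolding t_def using op_tensor_zero(1)[OF _ concat_atoms[OF atZ] adj] q by simp
    moreover have "s 0 = 0" using Op_scale[OF s' hilb_zero, of 0] by (simp add: fun_eq_iff zero_fun_def)
    ultimately have "coord Zs (s \<circ> t) es = 0" for es by (simp add: coord_def)
    then have "coord Zs (s \<circ> t) = 0" by auto
    then show ?thesis by (simp add: fn.span_zero)
  next
    case True
    then obtain c where c: "q = (\<lambda>f u. c * op_id (concat Zs) f u)" using q by (auto simp:
        span_op_id_iff)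
    have atXY: "atom V" if "V \<in> set [X, Y]" for V using that at by auto
    have s'': "s \<in> Op (concat ([X, Y] @ Zs)) []" using s' True by simp
    have contr: "coord Zs (s \<circ> t) = (\<lambda>es. c * (\<Sum>fs\<in>idx [X, Y]. cnj (coord [X, Y] w fs) * coord ([X, Y] @
        Zs) s (fs @ es)))"
      using coord_contract[OF atXY atZ \<open>w \<in> Op (concat [X, Y]) []\<close> s'', of c] True
      unfolding t_def c by simp
    have wa: "coord [X, Y] w \<in> amps (rel_eq \<X>) [X, Y]" using w by (simp add: amps_def)
    show ?thesis
    proof (cases "Y = dual_atom X")
      case False
      then have "coord [X, Y] w = 0" using wa amps_rel_eq[OF X Y contraction_qset(1)] by simp
      then have "coord Zs (s \<circ> t) = 0" unfolding contr by (simp add: fun_eq_iff)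
      then show ?thesis by (simp add: fn.span_zero)
    next
      case dualXY: True
      then obtain d where d: "coord [X, Y] w = (\<lambda>es. d * diag X (\<lambda>hs. if hs = [] then 1 else 0) es)"
        using wa amps_rel_eq[OF X Y contraction_qset(1)] by auto
      have bY: "basis Y = basis X" using dualXY by simp
      have "coord Zs (s \<circ> t) = (\<lambda>es. (c * cnj d) * trace_out X (coord ([X, Y] @ Zs) s) es)"
        unfolding contr d
        by (rule ext) (simp only: sum_idx_pair_diag[OF finite_basis[OF at(1)] bY, where M = "coord ([X,
            Y] @ Zs) s"]
            mult.assoc)
      moreover have "coord ([X, Y] @ Zs) s \<in> amps \<Phi> (X # dual_atom X # Zs)"
        using s True dualXY by (simp add: amps_def)
      then have "trace_out X (coord ([X, Y] @ Zs) s) \<in> joined_amps \<Phi> \<X> Zs" using X by (intro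
          fn.span_base) blast
      ultimately show ?thesis by (simp only: fn.span_scale)
    qed
  qed
qed

lemma rdom_contraction: "rdom T = \<Z>s" and rcod_contraction: "rcod T = \<X> # dual \<X> # \<Z>s"
  by (simp_all add: T_def rel_times_def rel_dagger_def rel_eq_def)

lemma contraction_component:
  assumes Zs: "Zs \<in> listset \<Z>s" and Ys: "Ys \<in> listset (\<X> # dual \<X> # \<Z>s)"
    and r: "r \<in> comps T Zs Ys" and s: "s \<in> comps \<Phi> Ys []"
  shows "r \<in> Op (concat Zs) (concat Ys)"
    and "coord Zs (s \<circ> r) \<in> joined_amps \<Phi> \<X> Zs"
proof -
  obtain X Y Ws where XYW: "Ys = X # Y # Ws" "X \<in> \<X>" "Y \<in> dual \<X>" "Ws \<in> listset \<Z>s"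
    using Ys by (auto simp: set_Cons_def)
  have s': "s \<in> Op (concat Ys) []" by (rule relation_Op[OF \<Phi> Ys s])
  have atZ: "atom Z" if "Z \<in> set Zs" for Z by (rule qsets_atoms[OF Zs contraction_qset(2) that])
  have k: "ket (concat Zs) (concat es) \<in> hilb (concat Zs)" if "es \<in> idx Zs" for es
    using concat_atoms[OF atZ] concat_idx[OF that] by (simp add: ket_in_hilb basis_length)
  let ?C = "{r \<in> Op (concat Zs) (concat Ys). coord Zs (s \<circ> r) \<in> joined_amps \<Phi> \<X> Zs}"
  have "op.subspace ?C"
  proof (rule op.subspaceI)
    have "s 0 = 0" using Op_scale[OF s' hilb_zero, of 0] by (simp add: fun_eq_iff zero_fun_def)
    then have "coord Zs (s \<circ> 0) es = 0" for es by (simp add: coord_def)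
    then have "coord Zs (s \<circ> 0) = 0" by auto
    then show "0 \<in> ?C" by (simp add: Op_zero fn.span_zero)
    fix a assume a: "a \<in> ?C"
    have "coord Zs (s \<circ> (\<lambda>f u. c * a f u)) = (\<lambda>es. c * coord Zs (s \<circ> a) es)" for c
      using a Op_scale[OF s' Op_hilb[OF _ k]] by (auto simp: coord_def fun_eq_iff)
    then show "(\<lambda>f u. c * a f u) \<in> ?C" for c
      using a fn.span_scale[of "coord Zs (s \<circ> a)" _ c] by (simp add: Op_mult)
    fix b assume b: "b \<in> ?C"
    have "coord Zs (s \<circ> (a + b)) = coord Zs (s \<circ> a) + coord Zs (s \<circ> b)"
      using a b Op_add[OF s' Op_hilb[OF _ k] Op_hilb[OF _ k]] by (auto simp: coord_def fun_eq_iff)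
    then show "a + b \<in> ?C"
      using a b fn.span_add[of "coord Zs (s \<circ> a)" _ "coord Zs (s \<circ> b)"] by (simp add: Op_plus)
  qed
  moreover have "{op_tensor [] (X @ Y) (concat Zs) (concat Ws) (adjoint (X @ Y) [] w) q | w q.
      w \<in> comps (rel_eq \<X>) [X, Y] [] \<and> q \<in> (if Zs = Ws then op.span {op_id (concat Zs)} else {0})} \<subseteq> ?C"
    using contraction_generator[OF Zs XYW(2-4)] s unfolding XYW(1) by blast
  ultimately have "comps T Zs Ys \<subseteq> ?C"
    unfolding XYW(1) comps_contraction[OF Zs XYW(2-4)] by (intro op.span_minimal)
  then show "r \<in> Op (concat Zs) (concat Ys)" "coord Zs (s \<circ> r) \<in> joined_amps \<Phi> \<X> Zs" using r by auto
qed

lemma relation_contraction: "relation_of_arity (rel_comp \<Phi> T) \<Z>s"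
  unfolding relation_of_arity_def rel_comp_def rdom_mk_rel rcod_mk_rel rdom_contraction rcod_contraction
    relation_rcod[OF \<Phi>]
proof (intro conjI refl binary_relation_mk_rel)
  fix Zs Us :: "'v atom list" and a assume Zs: "Zs \<in> listset \<Z>s" and Us: "Us \<in> listset []"
  have "{s \<circ> r |s r Ys. Ys \<in> listset (\<X> # dual \<X> # \<Z>s) \<and> s \<in> comps \<Phi> Ys [] \<and> r \<in> comps T Zs Ys} \<subseteq> Op
      (concat Zs) []"
  proof clarify
    fix s r Ys assume *: "Ys \<in> listset (\<X> # dual \<X> # \<Z>s)" "s \<in> comps \<Phi> Ys []" "r \<in> comps T Zs Ys"
    show "s \<circ> r \<in> Op (concat Zs) []"
      by (rule Op_comp[OF contraction_component(1)[OF Zs *(1,3,2)] relation_Op[OF \<Phi> *(1,2)]])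
  qed
  then have "op.span {s \<circ> r |s r Ys. Ys \<in> listset (\<X> # dual \<X> # \<Z>s) \<and> s \<in> comps \<Phi> Ys [] \<and> r \<in> comps T Zs
      Ys} \<subseteq> Op (concat Zs) []"
    by (rule op.span_minimal[OF _ Op_subspace])
  then show "a \<in> op.span {s \<circ> r |s r Ys. Ys \<in> listset (\<X> # dual \<X> # \<Z>s) \<and> s \<in> comps \<Phi> Ys Us \<and> r \<in> comps
      T Zs Ys}
      \<Longrightarrow> a \<in> Op (concat Zs) (concat Us)"
    using Us by auto
qed (use contraction_qset in auto)

lemma amps_contraction:
  assumes Zs: "Zs \<in> listset \<Z>s"
  shows "amps (rel_comp \<Phi> T) Zs = joined_amps \<Phi> \<X> Zs"
proof -
  let ?G = "{trace_out X M | X M. X \<in> \<X> \<and> M \<in> amps \<Phi> (X # dual_atom X # Zs)}"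
  let ?C = "{s \<circ> r |s r Ys. Ys \<in> listset (\<X> # dual \<X> # \<Z>s) \<and> s \<in> comps \<Phi> Ys [] \<and> r \<in> comps T Zs Ys}"
  have "comps (rel_comp \<Phi> T) Zs [] = op.span ?C"
    using Zs by (simp add: rel_comp_def comps_mk_rel rdom_contraction rcod_contraction relation_rcod[OF
        \<Phi>])
  then have "amps (rel_comp \<Phi> T) Zs = fn.span (coord Zs ` ?C)" by (simp add: amps_def coord_span)
  also have "\<dots> = fn.span ?G"
  proof
    have "coord Zs ` ?C \<subseteq> fn.span ?G" using contraction_component(2)[OF Zs] by blast
    then show "fn.span (coord Zs ` ?C) \<subseteq> fn.span ?G" by (rule fn.span_minimal) simp
    have "?G \<subseteq> coord Zs ` ?C"
    proof clarify
      fix X M assume X: "X \<in> \<X>" and "M \<in> amps \<Phi> (X # dual_atom X # Zs)"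
      then obtain s where s: "M = coord (X # dual_atom X # Zs) s" "s \<in> comps \<Phi> (X # dual_atom X # Zs)
          []"
        by (auto simp: amps_def)
      let ?Y = "dual_atom X"
      have Y: "?Y \<in> dual \<X>" using X by (simp add: dual_def)
      have at: "atom X" using X contraction_qset(1) by (simp add: qset_def)
      have tup: "X # ?Y # Zs \<in> listset (\<X> # dual \<X> # \<Z>s)" using X Y Zs by (simp add: set_Cons_def)
      have atZ: "atom Z" if "Z \<in> set Zs" for Z by (rule qsets_atoms[OF Zs contraction_qset(2) that])
      have atXY: "atom V" if "V \<in> set [X, ?Y]" for V using that at by auto
      let ?q = "\<lambda>f u. 1 * op_id (concat Zs) f u"
      let ?t = "op_tensor [] (X @ ?Y) (concat Zs) (concat Zs) (adjoint (X @ ?Y) [] (op_eval X)) ?q"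
      have "op_eval X \<in> comps (rel_eq \<X>) [X, ?Y] []"
        using X Y by (simp add: rel_eq_def comps_mk_rel set_Cons_def op.span_base)
      moreover have "?q \<in> op.span {op_id (concat Zs)}" by (simp add: op.span_base)
      ultimately have t: "?t \<in> comps T Zs (X # ?Y # Zs)"
        unfolding comps_contraction[OF Zs X Y Zs] by (intro op.span_base) auto
      have ev: "op_eval X \<in> Op (concat [X, ?Y]) []" using op_eval_Op[OF at] by simp
      have s': "s \<in> Op (concat ([X, ?Y] @ Zs)) []" using relation_Op[OF \<Phi> tup s(2)] by simp
      have "coord Zs (s \<circ> ?t) = (\<lambda>es. 1 * (\<Sum>fs\<in>idx [X, ?Y]. cnj (coord [X, ?Y] (op_eval X) fs) * coord
          ([X, ?Y] @ Zs) s (fs @ es)))"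
        using coord_contract[OF atXY atZ ev s', of 1] by simp
      also have "\<dots> = trace_out X M"
        unfolding coord_op_eval[OF at]
        using sum_idx_pair_diag[OF finite_basis[OF at] basis_dual, where d = 1 and M = M] s(1)
        by (intro ext) simp
      finally have "trace_out X M = coord Zs (s \<circ> ?t)" by simp
      then show "trace_out X M \<in> coord Zs ` ?C" using t s(2) tup by blast
    qed
    then show "fn.span ?G \<subseteq> fn.span (coord Zs ` ?C)" by (rule fn.span_mono)
  qed
  finally show ?thesis .
qed

end

section \<open>Joining two wires\<close>

text \<open>
  The list \<open>[1, 0, 2, 3, \<dots>]\<close> exchanges the first two positions.  Contraction is symmetric in them.
\<close>

lemma trace_out_pull:
  assumes "L \<in> supported (idx (permute (1 # 0 # map (\<lambda>i. i + 2) [0..<length Zs]) (X # Y # Zs)))" "basis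
      Y = basis X"
  shows "trace_out X (pull (1 # 0 # map (\<lambda>i. i + 2) [0..<length Zs]) (X # Y # Zs) L) = trace_out X L"
proof
  fix hs
  have "pull (1 # 0 # map (\<lambda>i. i + 2) [0..<length Zs]) (X # Y # Zs) L (b # b # hs) = L (b # b # hs)" if
      "b \<in> basis X" for b
  proof (cases "hs \<in> idx Zs")
    case True
    then have "map ((!) hs) [0..<length Zs] = hs" using idx_length[OF True] map_nth[of hs] by simp
    then show ?thesis using True that assms(2) by (simp add: pull_def idx_Cons comp_def)
  next
    case False
    moreover have "map ((!) Zs) [0..<length Zs] = Zs" by (rule map_nth)
    ultimately show ?thesis using assms(1) by (simp add: pull_def idx_Cons comp_def supported_def)
  qed
  then show "trace_out X (pull (1 # 0 # map (\<lambda>i. i + 2) [0..<length Zs]) (X # Y # Zs) L) hs = trace_out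
      X L hs"
    by (simp add: trace_out_def)
qed

lemma swap_perm_list: "perm_list (1 # 0 # map (\<lambda>i. i + 2) [0..<n]) (Suc (Suc n))"
proof -
  have "set (map (\<lambda>i. i + 2) [0..<n]) = {2..<n + 2}"
    by (simp only: set_map set_upt image_add_atLeastLessThan' add_0)
  moreover have "distinct (map (\<lambda>i. i + 2) [0..<n])"
    by (simp add: distinct_map inj_on_def)
  ultimately show ?thesis
    unfolding perm_list_def distinct.simps list.set by auto
qed

lemma permute_swap: "permute (1 # 0 # map (\<lambda>i. i + 2) [0..<length zs]) (x # y # zs) = y # x # zs"
  by (simp add: comp_def map_nth)

lemma amps_swap:
  assumes "core_wf \<phi>" "fvars \<phi> \<subseteq> set (x1 # x2 # xs)" "x1 \<noteq> x2" "\<And>x. x \<in> set (x1 # x2 # xs) \<Longrightarrow> qset (fst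
      x)"
    and "X \<in> fst x1" "Y \<in> fst x2" "Zs \<in> listset (map fst xs)" "basis Y = basis X"
  shows "trace_out X ` amps (interp_core \<phi> (x2 # x1 # xs)) (Y # X # Zs) =
    trace_out X ` amps (interp_core \<phi> (x1 # x2 # xs)) (X # Y # Zs)"
proof -
  let ?\<sigma> = "1 # 0 # map (\<lambda>i. i + 2) [0..<length Zs]"
  let ?\<Gamma> = "x1 # x2 # xs" and ?\<Gamma>' = "x2 # x1 # xs"
  have len: "length xs = length Zs" using listset_length[OF assms(7)] by simp
  have \<sigma>: "perm_list ?\<sigma> (length ?\<Gamma>)" "perm_list ?\<sigma> (length (X # Y # Zs))" using swap_perm_list[of
      "length Zs"] len by simp_all
  have p\<Gamma>: "permute ?\<sigma> ?\<Gamma> = ?\<Gamma>'" using permute_swap[where x = x1 and y = x2 and zs = xs] len by simp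
  have pX: "permute ?\<sigma> (X # Y # Zs) = Y # X # Zs" by (rule permute_swap)
  have pos: "position ?\<Gamma> x = ?\<sigma> ! position (permute ?\<sigma> ?\<Gamma>) x" if x: "x \<in> set ?\<Gamma>" for x
  proof -
    have "x \<in> set ?\<Gamma>'" using x by auto
    moreover have "position xs x < length Zs" if "x \<noteq> x1" "x \<noteq> x2"
      using position_less[of x xs] x that len by simp
    ultimately show ?thesis unfolding p\<Gamma> using x assms(3) by (auto simp: position_Cons)
  qed
  have tup: "X # Y # Zs \<in> listset (map fst ?\<Gamma>)" "Y # X # Zs \<in> listset (map fst ?\<Gamma>')"
    using assms(5-7) by (simp_all add: set_Cons_def)
  have iff: "L \<in> amps (interp_core \<phi> ?\<Gamma>') (Y # X # Zs) \<longleftrightarrow> pull ?\<sigma> (X # Y # Zs) L \<in> amps (interp_core \<phi>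
      ?\<Gamma>) (X # Y # Zs)"
    if "L \<in> supported (idx (Y # X # Zs))" for L
    using interp_core_permute[OF \<sigma>(1) pos assms(1,2,4) tup(1), of L] that unfolding p\<Gamma> pX by blast
  have tr: "trace_out X (pull ?\<sigma> (X # Y # Zs) L) = trace_out X L" if "L \<in> supported (idx (Y # X # Zs))"
      for L
    by (rule trace_out_pull[OF _ assms(8)]) (use that pX in simp)
  have rel: "relation_of_arity (interp_core \<phi> ?\<Gamma>) (map fst ?\<Gamma>)"
    by (rule relation_interp_core[OF assms(1,2,4)])
  have rel': "relation_of_arity (interp_core \<phi> ?\<Gamma>') (map fst ?\<Gamma>')"
    by (rule relation_interp_core[OF assms(1)]) (use assms(2,4) in auto)
  show ?thesis
  proof
    show "trace_out X ` amps (interp_core \<phi> ?\<Gamma>') (Y # X # Zs) \<subseteq> trace_out X ` amps (interp_core \<phi> ?\<Gamma>) (X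
        # Y # Zs)"
    proof clarify
      fix L assume L: "L \<in> amps (interp_core \<phi> ?\<Gamma>') (Y # X # Zs)"
      then have sup: "L \<in> supported (idx (Y # X # Zs))" using amps_supported[OF rel'] by blast
      have "trace_out X (pull ?\<sigma> (X # Y # Zs) L) \<in> trace_out X ` amps (interp_core \<phi> ?\<Gamma>) (X # Y # Zs)"
        using L iff[OF sup] by (intro imageI) blast
      then show "trace_out X L \<in> trace_out X ` amps (interp_core \<phi> ?\<Gamma>) (X # Y # Zs)"
        unfolding tr[OF sup] .
    qed
    show "trace_out X ` amps (interp_core \<phi> ?\<Gamma>) (X # Y # Zs) \<subseteq> trace_out X ` amps (interp_core \<phi> ?\<Gamma>') (Y
        # X # Zs)"
    proof clarify
      fix M assume M: "M \<in> amps (interp_core \<phi> ?\<Gamma>) (X # Y # Zs)"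
      then have "M \<in> supported (idx (X # Y # Zs))" using amps_supported[OF rel] by blast
      then obtain L where "L \<in> supported (idx (permute ?\<sigma> (X # Y # Zs)))" and LM: "pull ?\<sigma> (X # Y # Zs)
          L = M"
        by (rule pull_surj[OF \<sigma>(2)])
      then have sup: "L \<in> supported (idx (Y # X # Zs))" unfolding pX by blast
      have "trace_out X L \<in> trace_out X ` amps (interp_core \<phi> ?\<Gamma>') (Y # X # Zs)"
        using M iff[OF sup] unfolding LM by (intro imageI) blast
      then show "trace_out X M \<in> trace_out X ` amps (interp_core \<phi> ?\<Gamma>') (Y # X # Zs)"
        unfolding LM[symmetric] tr[OF sup] .
    qed
  qed
qed

text \<open>
  The universally quantified formula is interpreted by the functionals \<open>a\<close> such that every
  \<open>\<epsilon>\<^sub>X \<otimes> a\<close> is orthogonal to \<open>\<phi>\<close>, i.e. by the complement of the contractions of \<open>\<phi>\<close>; its negation is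
  the double complement.
\<close>

lemma amps_join:
  assumes wf: "core_wf \<phi>" "fvars \<phi> \<subseteq> set (x1 # x2 # xs)" and x: "x1 \<noteq> x2" "fst x2 = dual (fst x1)"
    and q: "\<And>x. x \<in> set (x1 # x2 # xs) \<Longrightarrow> qset (fst x)" and Zs: "Zs \<in> listset (map fst xs)"
  shows "amps (interp_core (Neg (Forall x1 (Forall x2 (Imp (Eq x1 x2) (Neg \<phi>))))) xs) Zs =
    joined_amps (interp_core \<phi> (x1 # x2 # xs)) (fst x1) Zs"
proof -
  let ?G = "{trace_out X M | X M. X \<in> fst x1 \<and> M \<in> amps (interp_core \<phi> (x1 # x2 # xs)) (X # dual_atom X
      # Zs)}"
  let ?\<Gamma> = "x2 # x1 # xs" and ?I = "Imp (Eq x1 x2) (Neg \<phi>)"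
  have q1: "qset (fst x1)" "qset (fst x2)" using q by simp_all
  have q2: "qset (fst x)" if "x \<in> set ?\<Gamma>" for x
    by (rule q) (use that in auto)
  have wfE: "core_wf (Eq x1 x2)" using core_wf_Eq[OF q1(1) x(2,1)] .
  have rel: "relation_of_arity (interp_core \<chi> ?\<Gamma>) (map fst ?\<Gamma>)" if "core_wf \<chi>" "fvars \<chi> \<subseteq> set ?\<Gamma>" for \<chi>
    using that q2 by (rule relation_interp_core)
  have wf': "fvars \<phi> \<subseteq> set ?\<Gamma>" "fvars (Eq x1 x2) \<subseteq> set ?\<Gamma>" using wf(2) by (auto simp: fvars_Eq)
  have wfI: "core_wf ?I" "fvars ?I \<subseteq> set ?\<Gamma>" using wf wfE wf' by (auto simp: Imp_def Disj_def)
  have rel1: "relation_of_arity (interp_core (Forall x2 ?I) (x1 # xs)) (map fst (x1 # xs))"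
    by (rule relation_interp_core) (use wfI q1 q in auto)
  have rel0: "relation_of_arity (interp_core (Forall x1 (Forall x2 ?I)) xs) (map fst xs)"
    by (rule relation_interp_core) (use wfI q1 q in auto)
  have fin: "finite (idx Zs)"
    by (rule finite_idx) (rule relation_atom[OF rel0 Zs])
  let ?A = "{K \<in> supported (idx Zs). \<forall>X\<in>fst x1. \<forall>T1\<in>supported (idx [X]). \<forall>Y\<in>fst x2. \<forall>T2\<in>supported (idx
      [Y]).
      ktensor 1 T2 (ktensor 1 T1 K) \<in> amps (interp_core ?I ?\<Gamma>) (Y # X # Zs)}"
  have forall: "amps (interp_core (Forall x1 (Forall x2 ?I)) xs) Zs = ?A"
  proof -
    have "amps (interp_core (Forall x1 (Forall x2 ?I)) xs) Zs = {K \<in> supported (idx Zs).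
      \<forall>X\<in>fst x1. \<forall>T\<in>supported (idx [X]). ktensor 1 T K \<in> amps (interp_core (Forall x2 ?I) (x1 # xs)) (X
          # Zs)}"
      by (rule amps_interp_Forall[OF q1(1) _ rel1 Zs]) (use q in simp)
    moreover have "amps (interp_core (Forall x2 ?I) (x1 # xs)) (X # Zs) = {K \<in> supported (idx (X # Zs)).
      \<forall>Y\<in>fst x2. \<forall>T\<in>supported (idx [Y]). ktensor 1 T K \<in> amps (interp_core ?I ?\<Gamma>) (Y # X # Zs)}"
      if "X \<in> fst x1" for X
      by (rule amps_interp_Forall[OF q1(2) _ rel[OF wfI]]) (use q1 q that Zs in \<open>auto simp: set_Cons_def\<close>)
    moreover have "ktensor 1 T K \<in> supported (idx (X # Zs))"
      if "T \<in> supported (idx [X])" "K \<in> supported (idx Zs)" for T K X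
      using ktensor_supported[OF that] by simp
    ultimately show ?thesis by auto
  qed
  have tup: "Y # X # Zs \<in> listset (map fst ?\<Gamma>)" if "X \<in> fst x1" "Y \<in> fst x2" for X Y
    using that Zs by (simp add: set_Cons_def)
  \<comment> \<open>For atoms that are not dual to each other equality is zero, and the implication holds trivially.\<close>
  have imp: "(\<forall>T1\<in>supported (idx [X]). \<forall>T2\<in>supported (idx [Y]).
        ktensor 1 T2 (ktensor 1 T1 K) \<in> amps (interp_core ?I ?\<Gamma>) (Y # X # Zs)) \<longleftrightarrow>
      (Y = dual_atom X \<longrightarrow> (\<forall>L\<in>amps (interp_core \<phi> ?\<Gamma>) (Y # X # Zs). dotp (idx Zs) (trace_out X L) K =
          0))"
    if X: "X \<in> fst x1" and Y: "Y \<in> fst x2" and K: "K \<in> supported (idx Zs)" for X Y K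
  proof -
    define S where "S = idx (Y # X # Zs)"
    define E where "E = amps (interp_core (Eq x1 x2) ?\<Gamma>) (Y # X # Zs)"
    define N where "N = amps (interp_core (Neg \<phi>) ?\<Gamma>) (Y # X # Zs)"
    note t = tup[OF X Y]
    note relE = rel[OF wfE wf'(2)] and rel\<phi> = rel[OF wf(1) wf'(1)]
    have relN: "relation_of_arity (interp_core (Neg \<phi>) ?\<Gamma>) (map fst ?\<Gamma>)" by (rule rel) (use wf wf' in
        simp_all)
    have finS: "finite S" unfolding S_def by (rule finite_idx) (rule relation_atom[OF relE t])
    have E: "fn.subspace E" "E \<subseteq> supported S" unfolding E_def S_def by (rule amps_subspace[OF relE]
        amps_supported[OF relE])+
    have N: "fn.subspace N" "N = ortho S (amps (interp_core \<phi> ?\<Gamma>) (Y # X # Zs))"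
      unfolding N_def S_def by (rule amps_subspace[OF relN] amps_interp_Neg[OF rel\<phi> t])+
    have J: "amps (interp_core ?I ?\<Gamma>) (Y # X # Zs) = ortho S (E \<inter> ortho S (E \<inter> N))"
    proof -
      have neg: "amps (interp_core (Neg \<chi>) ?\<Gamma>) (Y # X # Zs) = ortho S (amps (interp_core \<chi> ?\<Gamma>) (Y # X #
          Zs))"
        if "core_wf \<chi>" "fvars \<chi> \<subseteq> set ?\<Gamma>" for \<chi>
        unfolding S_def by (rule amps_interp_Neg[OF rel[OF that] t])
      have conj: "amps (interp_core (Conj \<chi> \<chi>') ?\<Gamma>) (Y # X # Zs) =
          amps (interp_core \<chi> ?\<Gamma>) (Y # X # Zs) \<inter> amps (interp_core \<chi>' ?\<Gamma>) (Y # X # Zs)"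
        if "core_wf \<chi>" "fvars \<chi> \<subseteq> set ?\<Gamma>" "core_wf \<chi>'" "fvars \<chi>' \<subseteq> set ?\<Gamma>" for \<chi> \<chi>'
        by (rule amps_interp_Conj[OF rel[OF that(1,2)] rel[OF that(3,4)] t])
      have "amps (interp_core ?I ?\<Gamma>) (Y # X # Zs) = ortho S (ortho S (ortho S E) \<inter> ortho S (E \<inter> N))"
        unfolding Imp_def Disj_def E_def N_def
        by (simp only: neg conj core_wf.simps fvars.simps wfE wf(1) wf' Un_subset_iff simp_thms)
      then show ?thesis by (simp only: ortho_ortho[OF finS E(2,1)])
    qed
    show ?thesis
    proof (cases "Y = dual_atom X")
      case True
      have at: "atom X" using X q1(1) by (simp add: qset_def)
      have bY: "basis Y = basis X" using True by simp
      have Ed: "E = diag X ` supported (idx Zs)"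
        unfolding E_def using amps_Eq[OF q1(1) x(2,1) _ X Y Zs] q True by simp
      have "(\<forall>T1\<in>supported (idx [X]). \<forall>T2\<in>supported (idx [Y]).
          ktensor 1 T2 (ktensor 1 T1 K) \<in> amps (interp_core ?I ?\<Gamma>) (Y # X # Zs)) \<longleftrightarrow> diag X K \<in> N"
        using implication_of_diag[OF at bY _ Ed _ _ N(1) K] finS E J unfolding S_def by simp
      also have "\<dots> \<longleftrightarrow> (\<forall>L\<in>amps (interp_core \<phi> ?\<Gamma>) (Y # X # Zs). dotp (idx Zs) (trace_out X L) K = 0)"
        unfolding N(2) ortho_def S_def dotp_diag[OF finite_basis[OF at] bY, symmetric]
        using diag_supported[OF K bY] by simp
      finally show ?thesis using True by simp
    next
      case False
      have "E = {0}" unfolding E_def using amps_Eq[OF q1(1) x(2,1) _ X Y Zs] q False by simp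
      then have "E \<inter> ortho S (E \<inter> N) \<subseteq> {0}" by blast
      moreover have "dotp S 0 L = 0" for L by (simp add: dotp_def)
      ultimately have "ortho S (E \<inter> ortho S (E \<inter> N)) = supported S" by (auto simp: ortho_def)
      moreover have "ktensor 1 T2 (ktensor 1 T1 K) \<in> supported S"
        if "T1 \<in> supported (idx [X])" "T2 \<in> supported (idx [Y])" for T1 T2
        using ktensor_supported[OF that(2) ktensor_supported[OF that(1) K]] by (simp add: S_def)
      ultimately show ?thesis
        using False unfolding J by simp
    qed
  qed
  have "?A = {K \<in> supported (idx Zs). \<forall>X\<in>fst x1. \<forall>Y\<in>fst x2. Y = dual_atom X \<longrightarrow>
      (\<forall>L\<in>amps (interp_core \<phi> ?\<Gamma>) (Y # X # Zs). dotp (idx Zs) (trace_out X L) K = 0)}"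
    using imp by (intro Collect_cong conj_cong refl) meson
  also have "\<dots> = {K \<in> supported (idx Zs). \<forall>X\<in>fst x1.
      \<forall>H\<in>trace_out X ` amps (interp_core \<phi> ?\<Gamma>) (dual_atom X # X # Zs). dotp (idx Zs) H K = 0}"
    unfolding x(2) by (auto simp: dual_def)
  also have "\<dots> = {K \<in> supported (idx Zs). \<forall>X\<in>fst x1.
      \<forall>H\<in>trace_out X ` amps (interp_core \<phi> (x1 # x2 # xs)) (X # dual_atom X # Zs). dotp (idx Zs) H K =
          0}"
    using amps_swap[OF wf x(1) q _ _ Zs basis_dual] x(2) by (auto simp: dual_def)
  also have "\<dots> = ortho (idx Zs) ?G"
    by (auto simp: ortho_def)
  finally have A: "?A = ortho (idx Zs) ?G" .
  have "amps (interp_core (Neg (Forall x1 (Forall x2 ?I))) xs) Zs = ortho (idx Zs) (ortho (idx Zs)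
      (fn.span ?G))"
    unfolding amps_interp_Neg[OF rel0 Zs] forall A ortho_span ..
  also have "\<dots> = fn.span ?G"
  proof (rule ortho_ortho[OF fin _ fn.subspace_span])
    have "relation_of_arity (interp_core \<phi> (x1 # x2 # xs)) (map fst (x1 # x2 # xs))"
      by (rule relation_interp_core[OF wf q])
    then have "?G \<subseteq> supported (idx Zs)"
      using trace_out_supported amps_supported by blast
    then show "fn.span ?G \<subseteq> supported (idx Zs)" by (rule fn.span_minimal[OF _ supported_subspace])
  qed
  finally show ?thesis .
qed

theorem theorem1p2p1:
  fixes \<phi> :: "'v::complex_inner fm"
    and x1 x2 :: "'v var"
    and xs :: "'v var list"
  assumes "nondup_formula \<phi>"
    and "distinct (x1 # x2 # xs)"
    and "\<forall>x\<in>set (x1 # x2 # xs). qset (fst x)"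
    and "fvars \<phi> \<subseteq> set (x1 # x2 # xs)"
    and "fst x2 = dual (fst x1)"
  shows "interp xs (Neg (Forall x1 (Forall x2 (Imp (Eq x1 x2) (Neg \<phi>))))) =
    rel_comp (interp (x1 # x2 # xs) \<phi>)
      (rel_times (rel_dagger (rel_eq (fst x1))) (rel_ids (map fst xs)))"
proof -
  define V where "V = set (x1 # x2 # xs) \<union> allvars \<phi>"
  define k where "k = (LEAST k. \<forall>x\<in>V. snd x < k)"
  define \<phi>' where "\<phi>' = expand k \<phi>"
  let ?\<psi> = "Neg (Forall x1 (Forall x2 (Imp (Eq x1 x2) (Neg \<phi>))))"
  let ?\<psi>' = "Neg (Forall x1 (Forall x2 (Imp (Eq x1 x2) (Neg \<phi>'))))"
  have right: "interp (x1 # x2 # xs) \<phi> = interp_core \<phi>' (x1 # x2 # xs)"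
    by (simp only: interp_def Let_def V_def k_def \<phi>'_def)
  \<comment> \<open>Both sides of the theorem choose the same index for new variables, since \<open>\<psi>\<close> binds the variables
      that its context lacks.\<close>
  have "set xs \<union> allvars ?\<psi> = V"
    by (auto simp: V_def Imp_def Disj_def Eq_def)
  moreover have "expand k ?\<psi> = ?\<psi>'"
    by (simp add: Imp_def Disj_def Eq_def \<phi>'_def)
  ultimately have left: "interp xs ?\<psi> = interp_core ?\<psi>' xs"
    by (simp only: interp_def Let_def k_def)
  have "\<forall>x\<in>V. snd x < k" unfolding k_def by (rule fresh_index) (simp add: V_def finite_allvars)
  then have wf: "core_wf \<phi>'" "fvars \<phi>' \<subseteq> set (x1 # x2 # xs)"
    using expand_wf[OF assms(1), of k] assms(4) by (auto simp: \<phi>'_def V_def)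
  have q: "qset (fst x)" if "x \<in> set (x1 # x2 # xs)" for x using assms(3) that by blast
  have x: "x1 \<noteq> x2" using assms(2) by auto
  have "relation_of_arity (interp_core \<phi>' (x1 # x2 # xs)) (map fst (x1 # x2 # xs))"
    by (rule relation_interp_core[OF wf q])
  then have rel: "relation_of_arity (interp_core \<phi>' (x1 # x2 # xs)) (fst x1 # dual (fst x1) # map fst
      xs)"
    using assms(5) by simp
  have "core_wf ?\<psi>'" "fvars ?\<psi>' \<subseteq> set xs"
    using wf core_wf_Eq[OF q assms(5) x] q by (auto simp: Imp_def Disj_def fvars_Eq)
  then have rel_left: "relation_of_arity (interp_core ?\<psi>' xs) (map fst xs)"
    by (rule relation_interp_core) (use q in simp)
  show ?thesis
    unfolding left right
  proof (rule relation_of_arity_eqI[OF rel_left relation_contraction[OF rel]])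
    fix Zs assume Zs: "Zs \<in> listset (map fst xs)"
    show "amps (interp_core ?\<psi>' xs) Zs = amps (rel_comp (interp_core \<phi>' (x1 # x2 # xs))
        (rel_times (rel_dagger (rel_eq (fst x1))) (rel_ids (map fst xs)))) Zs"
      unfolding amps_contraction[OF rel Zs] by (rule amps_join[OF wf x assms(5) q Zs])
  qed
qed

end
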